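(* Let $n\ge2$ and $0\le t\le 2n-2$. Consider on $\mathrm{IGr}(2,V)$ the bicomplex with terms $$\wedge^{t-b-c}V^\vee\otimes\Sigma^{c,-b}\mathcal U^\vee,\qquad b,c\ge0,\ b+c\le t,$$ whose vertical arrows $\wedge^{t-b-c}V^\vee\otimes\Sigma^{c,-b}\mathcal U^\vee\to\wedge^{t-b-c-1}V^\vee\otimes\Sigma^{c+1,-b}\mathcal U^\vee$ are given by $\mathbf d_0$, and whose horizontal arrows $$\wedge^{t-b-c}V^\vee\otimes\Sigma^{c,-b}\mathcal U^\vee\to\wedge^{t-b-c+1}V^\vee\otimes\Sigma^{c,1-b}\mathcal U^\vee\qquad(b\ge1)$$ are given by $$(-1)^c\Big(\tfrac{b}{(b+c)(b+c+1)}\mathbf d_1+\tfrac{b}{b+c}\mathbf d_2\Big).$$ Then its total complex is quasi-isomorphic to the complex $$\mathcal E_t^\bullet=\Big\{\mathcal E^{0,t}\xrightarrow{\mathbf d}\mathcal E^{1,t-1}\xrightarrow{\mathbf d}\dots\xrightarrow{\mathbf d}\mathcal E^{t-1,1}\xrightarrow{\mathbf d}\mathcal E^{t,0}\Big\}$$ (rightmost term in degree $0$). In particular, if $t=n-1$, the total complex is acyclic.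
   Context: Work over an algebraically closed field of characteristic zero. $V$ is a $2n$-dimensional vector space with symplectic form $\omega$. $\mathrm{IGr}(2,V)\subset\mathrm{Gr}(2,V)$ is the Grassmannian of $\omega$-isotropic 2-dimensional subspaces, $\mathcal U\subset V\otimes\mathcal O$ is the tautological rank-2 subbundle, and $\mathcal O(1)=\det\mathcal U^\vee$. For integers $\alpha_1\ge\alpha_2$, $\Sigma^{\alpha_1,\alpha_2}\mathcal U^\vee\cong\mathrm S^{\alpha_1-\alpha_2}\mathcal U^\vee\otimes\mathcal O(\alpha_2)\cong\mathrm S^{\alpha_1-\alpha_2}\mathcal U\otimes\mathcal O(\alpha_1)$; in particular $\Sigma^{c,-b}\mathcal U^\vee\cong\mathrm S^{b+c}\mathcal U(c)$. Negative wedge and symmetric powers are zero. At a point $[U]$ with basis $e_1,e_2$ of $U$, for $\lambda\in\wedge^pV^\vee$ and $P\in\mathrm S^qU$ (a polynomial of degree $q$ in $e_1,e_2$), write $\lambda_i,\omega_i$ for the evaluation of the skew form on $e_i$ in the last argument (so $(\mu\wedge f)_i=f(e_i)\mu$ if $f\in V^\vee$ and $\mu_i=0$; $\omega_i=\omega(-,e_i)$), and $P_i=\partial P/\partial e_i$. The following maps are independent of the basis and are extended to twists by $\mathcal O(c)$: - $\mathbf d_0\colon\wedge^pV^\vee\otimes\mathrm S^q\mathcal U\to\wedge^{p-1}V^\vee\otimes\mathrm S^{q+1}\mathcal U(1)$, $\ \mathbf d_0(\lambda\otimes P)=(\lambda_1\otimes e_2P-\lambda_2\otimes e_1P)\cdot\det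 U^\vee$, where $\det U^\vee$ denotes the generator of the fiber of $\mathcal O(1)$ determined by the basis; - $\mathbf d_1\colon\wedge^pV^\vee\otimes\mathrm S^q\mathcal U\to\wedge^{p+1}V^\vee\otimes\mathrm S^{q-1}\mathcal U$, $\ \mathbf d_1(\lambda\otimes P)=\lambda_1\wedge\omega\otimes P_1+\lambda_2\wedge\omega\otimes P_2$; - $\mathbf d_2\colon\wedge^pV^\vee\otimes\mathrm S^q\mathcal U\to\wedge^{p+1}V^\vee\otimes\mathrm S^{q-1}\mathcal U$, $\ \mathbf d_2(\lambda\otimes P)=\lambda\wedge(\omega_1\otimes P_1+\omega_2\otimes P_2)$. For $a,b\ge0$, $a+b\le2n-2$, the bundle $\mathcal E^{a,b}$ is the kernel of $\mathbf d_0\colon\wedge^aV^\vee\otimes\mathrm S^b\mathcal U\to\wedge^{a-1}V^\vee\otimes\mathrm S^{b+1}\mathcal U(1)$. It has the right resolution $0\to\mathcal E^{a,b}\to\wedge^aV^\vee\otimes\Sigma^{0,-b}\mathcal U^\vee\to\dots\to V^\vee\otimes\Sigma^{a-1,-b}\mathcal U^\vee\to\Sigma^{a,-b}\mathcal U^\vee\to0$ with differentials $\mathbf d_0$. The differential $\mathbf d\colon\mathcal E^{a,b}\to\mathcal E^{a+1,b-1}$ is the restriction of $\tfrac1{b+1}\mathbf d_1+\mathbf d_2\colon\wedge^aV^\vee\otimes\mathrm S^b\mathcal U\to\wedge^{a+1}V^\vee\otimes\mathrm S^{b-1}\mathcal U$, which preserves these subbundles. The column with index $b$ of the bicomplex is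 the right resolution of $\mathcal E^{t-b,b}$. The term $(b,c)$ has total degree $c-b$, and the total complex is formed with the standard sign convention. *)

theory Defs
  imports
    "HOL-Analysis.Abstract_Topology"
    "HOL-Library.Function_Algebras"
    "HOL-Computational_Algebra.Polynomial"
begin

section \<open>Complexes of sheaves of modules on a space with functions\<close>

text \<open>
  A variety is given by a topology \<open>T\<close> on its set of closed points and by the sets \<open>R W\<close> of
  functions that are regular on the open set \<open>W\<close>. Elements of \<open>R W\<close> are total functions whose
  values outside \<open>W\<close> are irrelevant, so restriction of regular functions is the identity and the
  action of \<open>R W\<close> on sections over \<open>W\<close> is required to depend on the values on \<open>W\<close> only.
  The map \<open>res W\<close> restricts a section over any larger open set to \<open>W\<close>.
\<close>

record ('p, 'k, 's) modsheaf =
  sec :: "'p set \<Rightarrow> 's set"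
  res :: "'p set \<Rightarrow> 's \<Rightarrow> 's"
  act :: "('p \<Rightarrow> 'k) \<Rightarrow> 's \<Rightarrow> 's"

definition presheaf_of_modules ::
  "'p topology \<Rightarrow> ('p set \<Rightarrow> ('p \<Rightarrow> 'k::field) set) \<Rightarrow> ('p, 'k, 's::ab_group_add) modsheaf \<Rightarrow> bool"
where
  "presheaf_of_modules T R M \<longleftrightarrow>
    (\<forall>W. openin T W \<longrightarrow>
       0 \<in> sec M W \<and> (\<forall>s\<in>sec M W. \<forall>s'\<in>sec M W. s - s' \<in> sec M W) \<and>
       (\<forall>s\<in>sec M W. res M W s = s)) \<and>
    (\<forall>W W'. openin T W \<and> openin T W' \<and> W' \<subseteq> W \<longrightarrow>
       (\<forall>s\<in>sec M W. res M W' s \<in> sec M W') \<and>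
       (\<forall>s\<in>sec M W. \<forall>s'\<in>sec M W. res M W' (s + s') = res M W' s + res M W' s') \<and>
       (\<forall>r\<in>R W. \<forall>s\<in>sec M W. res M W' (act M r s) = act M r (res M W' s)) \<and>
       (\<forall>W''. openin T W'' \<and> W'' \<subseteq> W' \<longrightarrow>
          (\<forall>s\<in>sec M W. res M W'' (res M W' s) = res M W'' s))) \<and>
    (\<forall>W. openin T W \<longrightarrow>
       (\<forall>r\<in>R W. \<forall>s\<in>sec M W. act M r s \<in> sec M W) \<and>
       (\<forall>r\<in>R W. \<forall>r'\<in>R W. \<forall>s\<in>sec M W. (\<forall>p\<in>W. r p = r' p) \<longrightarrow> act M r s = act M r' s) \<and>
       (\<forall>r\<in>R W. \<forall>s\<in>sec M W. \<forall>s'\<in>sec M W. act M r (s + s') = act M r s + act M r s') \<and>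
       (\<forall>r\<in>R W. \<forall>r'\<in>R W. \<forall>s\<in>sec M W.
          act M (\<lambda>p. r p + r' p) s = act M r s + act M r' s \<and>
          act M (\<lambda>p. r p * r' p) s = act M r (act M r' s)) \<and>
       (\<forall>s\<in>sec M W. act M (\<lambda>_. 1) s = s))"

definition sheaf_of_modules ::
  "'p topology \<Rightarrow> ('p set \<Rightarrow> ('p \<Rightarrow> 'k::field) set) \<Rightarrow> ('p, 'k, 's::ab_group_add) modsheaf \<Rightarrow> bool"
where
  "sheaf_of_modules T R M \<longleftrightarrow> presheaf_of_modules T R M \<and>
    (\<forall>\<W> \<sigma>. (\<forall>W\<in>\<W>. openin T W \<and> \<sigma> W \<in> sec M W) \<and>
           (\<forall>W\<in>\<W>. \<forall>W'\<in>\<W>. res M (W \<inter> W') (\<sigma> W) = res M (W \<inter> W') (\<sigma> W')) \<longrightarrow>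
       (\<exists>!s. s \<in> sec M (\<Union>\<W>) \<and> (\<forall>W\<in>\<W>. res M W s = \<sigma> W)))"

definition sheaf_hom ::
  "'p topology \<Rightarrow> ('p set \<Rightarrow> ('p \<Rightarrow> 'k::field) set) \<Rightarrow>
   ('p, 'k, 's::ab_group_add) modsheaf \<Rightarrow> ('p, 'k, 'u::ab_group_add) modsheaf \<Rightarrow>
   ('p set \<Rightarrow> 's \<Rightarrow> 'u) \<Rightarrow> bool"
where
  "sheaf_hom T R M N \<phi> \<longleftrightarrow>
    (\<forall>W. openin T W \<longrightarrow>
       (\<forall>s\<in>sec M W. \<phi> W s \<in> sec N W) \<and>
       (\<forall>s\<in>sec M W. \<forall>s'\<in>sec M W. \<phi> W (s + s') = \<phi> W s + \<phi> W s') \<and>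
       (\<forall>r\<in>R W. \<forall>s\<in>sec M W. \<phi> W (act M r s) = act N r (\<phi> W s)) \<and>
       (\<forall>W'. openin T W' \<and> W' \<subseteq> W \<longrightarrow> (\<forall>s\<in>sec M W. res N W' (\<phi> W s) = \<phi> W' (res M W' s))))"

definition zero_sheaf :: "('p, 'k, 's::ab_group_add) modsheaf" where
  "zero_sheaf = \<lparr>sec = (\<lambda>_. {0}), res = (\<lambda>_ _. 0), act = (\<lambda>_ _. 0)\<rparr>"

definition kernel_sheaf ::
  "('p, 'k, 's::ab_group_add) modsheaf \<Rightarrow> ('p set \<Rightarrow> 's \<Rightarrow> 'u::ab_group_add) \<Rightarrow> ('p, 'k, 's) modsheaf"
where
  "kernel_sheaf M \<phi> = M\<lparr>sec := (\<lambda>W. {s \<in> sec M W. \<phi> W s = 0})\<rparr>"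

text \<open>Meant for finite \<open>I\<close>.\<close>

definition direct_sum_sheaf ::
  "'i set \<Rightarrow> ('i \<Rightarrow> ('p, 'k, 's::ab_group_add) modsheaf) \<Rightarrow> ('p, 'k, 'i \<Rightarrow> 's) modsheaf"
where
  "direct_sum_sheaf I M =
    \<lparr>sec = (\<lambda>W. {s. (\<forall>i\<in>I. s i \<in> sec (M i) W) \<and> (\<forall>i. i \<notin> I \<longrightarrow> s i = 0)}),
     res = (\<lambda>W s i. if i \<in> I then res (M i) W (s i) else 0),
     act = (\<lambda>r s i. if i \<in> I then act (M i) r (s i) else 0)\<rparr>"

text \<open>Complexes are cohomological and indexed by all integers.\<close>

record ('p, 'k, 's) sheaf_complex =
  obj :: "int \<Rightarrow> ('p, 'k, 's) modsheaf"
  diff :: "int \<Rightarrow> 'p set \<Rightarrow> 's \<Rightarrow> 's"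

definition is_complex ::
  "'p topology \<Rightarrow> ('p set \<Rightarrow> ('p \<Rightarrow> 'k::field) set) \<Rightarrow> ('p, 'k, 's::ab_group_add) sheaf_complex \<Rightarrow> bool"
where
  "is_complex T R C \<longleftrightarrow>
    (\<forall>k. sheaf_of_modules T R (obj C k) \<and>
         sheaf_hom T R (obj C k) (obj C (k + 1)) (diff C k) \<and>
         (\<forall>W. openin T W \<longrightarrow> (\<forall>s\<in>sec (obj C k) W. diff C (k + 1) W (diff C k W s) = 0)))"

definition chain_map ::
  "'p topology \<Rightarrow> ('p set \<Rightarrow> ('p \<Rightarrow> 'k::field) set) \<Rightarrow>
   ('p, 'k, 's::ab_group_add) sheaf_complex \<Rightarrow> ('p, 'k, 'u::ab_group_add) sheaf_complex \<Rightarrow>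
   (int \<Rightarrow> 'p set \<Rightarrow> 's \<Rightarrow> 'u) \<Rightarrow> bool"
where
  "chain_map T R C D \<phi> \<longleftrightarrow>
    (\<forall>k. sheaf_hom T R (obj C k) (obj D k) (\<phi> k) \<and>
         (\<forall>W. openin T W \<longrightarrow>
            (\<forall>s\<in>sec (obj C k) W. \<phi> (k + 1) W (diff C k W s) = diff D k W (\<phi> k W s))))"

definition cocycles :: "('p, 'k, 's::ab_group_add) sheaf_complex \<Rightarrow> int \<Rightarrow> 'p set \<Rightarrow> 's set" where
  "cocycles C k W = {s \<in> sec (obj C k) W. diff C k W s = 0}"

definition coboundaries :: "('p, 'k, 's::ab_group_add) sheaf_complex \<Rightarrow> int \<Rightarrow> 'p set \<Rightarrow> 's set" where
  "coboundaries C k W = diff C (k - 1) W ` sec (obj C (k - 1)) W"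

text \<open>
  The two conditions say that \<open>\<phi>\<close> induces an injection, respectively a surjection, between the
  stalks at \<open>p\<close> of the \<open>k\<close>-th cohomology sheaves, written out with representatives of germs.
\<close>

definition quasi_isomorphism ::
  "'p topology \<Rightarrow> ('p set \<Rightarrow> ('p \<Rightarrow> 'k::field) set) \<Rightarrow>
   ('p, 'k, 's::ab_group_add) sheaf_complex \<Rightarrow> ('p, 'k, 'u::ab_group_add) sheaf_complex \<Rightarrow>
   (int \<Rightarrow> 'p set \<Rightarrow> 's \<Rightarrow> 'u) \<Rightarrow> bool"
where
  "quasi_isomorphism T R C D \<phi> \<longleftrightarrow>
    is_complex T R C \<and> is_complex T R D \<and> chain_map T R C D \<phi> \<and>
    (\<forall>k W p. openin T W \<and> p \<in> W \<longrightarrow>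
      (\<forall>s\<in>cocycles C k W.
         (\<exists>W'. openin T W' \<and> p \<in> W' \<and> W' \<subseteq> W \<and> res (obj D k) W' (\<phi> k W s) \<in> coboundaries D k W') \<longrightarrow>
         (\<exists>W'. openin T W' \<and> p \<in> W' \<and> W' \<subseteq> W \<and> res (obj C k) W' s \<in> coboundaries C k W')) \<and>
      (\<forall>z\<in>cocycles D k W.
         \<exists>W'. openin T W' \<and> p \<in> W' \<and> W' \<subseteq> W \<and>
           (\<exists>s\<in>cocycles C k W'. res (obj D k) W' z - \<phi> k W' s \<in> coboundaries D k W')))"

text \<open>
  Isomorphism in the derived category: a roof of quasi-isomorphisms. HOL cannot quantify over the
  type of sections of the apex, so it is taken to be that of the second complex.
\<close>

definition quasi_isomorphic ::
  "'p topology \<Rightarrow> ('p set \<Rightarrow> ('p \<Rightarrow> 'k::field) set) \<Rightarrow>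
   ('p, 'k, 's::ab_group_add) sheaf_complex \<Rightarrow> ('p, 'k, 'u::ab_group_add) sheaf_complex \<Rightarrow> bool"
where
  "quasi_isomorphic T R C D \<longleftrightarrow>
    (\<exists>(B :: ('p, 'k, 'u) sheaf_complex) \<phi> \<psi>.
       quasi_isomorphism T R B C \<phi> \<and> quasi_isomorphism T R B D \<psi>)"

definition acyclic_complex ::
  "'p topology \<Rightarrow> ('p set \<Rightarrow> ('p \<Rightarrow> 'k::field) set) \<Rightarrow> ('p, 'k, 's::ab_group_add) sheaf_complex \<Rightarrow> bool"
where
  "acyclic_complex T R C \<longleftrightarrow> is_complex T R C \<and>
    (\<forall>k W p. openin T W \<and> p \<in> W \<longrightarrow>
      (\<forall>z\<in>cocycles C k W.
         \<exists>W'. openin T W' \<and> p \<in> W' \<and> W' \<subseteq> W \<and> res (obj C k) W' z \<in> coboundaries C k W'))"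

text \<open>
  A bicomplex with terms \<open>M b c\<close> for \<open>(b, c) \<in> I\<close> (and zero elsewhere), vertical maps
  \<open>v b c : M b c \<rightarrow> M b (c + 1)\<close>, horizontal maps \<open>h b c : M b c \<rightarrow> M (b - 1) c\<close>, and commuting
  squares. The pair \<open>(b, c)\<close> has bidegree \<open>(-b, c)\<close>, and the total differential is
  \<open>h + (-1)^(-b) v\<close>.
\<close>

definition bicomplex_obj ::
  "(nat \<times> nat) set \<Rightarrow> (nat \<Rightarrow> nat \<Rightarrow> ('p, 'k, 's::ab_group_add) modsheaf) \<Rightarrow>
   nat \<Rightarrow> nat \<Rightarrow> ('p, 'k, 's) modsheaf"
where
  "bicomplex_obj I M b c = (if (b, c) \<in> I then M b c else zero_sheaf)"

definition is_bicomplex ::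
  "'p topology \<Rightarrow> ('p set \<Rightarrow> ('p \<Rightarrow> 'k::field) set) \<Rightarrow> (nat \<times> nat) set \<Rightarrow>
   (nat \<Rightarrow> nat \<Rightarrow> ('p, 'k, 's::ab_group_add) modsheaf) \<Rightarrow>
   (nat \<Rightarrow> nat \<Rightarrow> 'p set \<Rightarrow> 's \<Rightarrow> 's) \<Rightarrow> (nat \<Rightarrow> nat \<Rightarrow> 'p set \<Rightarrow> 's \<Rightarrow> 's) \<Rightarrow> bool"
where
  "is_bicomplex T R I M h v \<longleftrightarrow>
    (let N = bicomplex_obj I M in
     \<forall>b c. sheaf_of_modules T R (N b c) \<and>
       sheaf_hom T R (N b c) (N b (c + 1)) (v b c) \<and>
       sheaf_hom T R (N (b + 1) c) (N b c) (h (b + 1) c) \<and>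
       (\<forall>W. openin T W \<longrightarrow>
         (\<forall>s\<in>sec (N b c) W. v b (c + 1) W (v b c W s) = 0) \<and>
         (\<forall>s\<in>sec (N (b + 2) c) W. h (b + 1) c W (h (b + 2) c W s) = 0) \<and>
         (\<forall>s\<in>sec (N (b + 1) c) W. h (b + 1) (c + 1) W (v (b + 1) c W s) = v b c W (h (b + 1) c W s))))"

definition total_complex ::
  "(nat \<times> nat) set \<Rightarrow> (nat \<Rightarrow> nat \<Rightarrow> ('p, 'k, 's::ab_group_add) modsheaf) \<Rightarrow>
   (nat \<Rightarrow> nat \<Rightarrow> 'p set \<Rightarrow> 's \<Rightarrow> 's) \<Rightarrow> (nat \<Rightarrow> nat \<Rightarrow> 'p set \<Rightarrow> 's \<Rightarrow> 's) \<Rightarrow>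
   ('p, 'k, nat \<times> nat \<Rightarrow> 's) sheaf_complex"
where
  "total_complex I M h v =
    \<lparr>obj = (\<lambda>k. direct_sum_sheaf {(b, c) \<in> I. int c - int b = k} (\<lambda>(b, c). M b c)),
     diff = (\<lambda>k W s (b, c).
       if (b, c) \<in> I \<and> int c - int b = k + 1
       then (if (b + 1, c) \<in> I then h (b + 1) c W (s (b + 1, c)) else 0) +
            (if c > 0 \<and> (b, c - 1) \<in> I
             then (if even b then v b (c - 1) W (s (b, c - 1)) else - v b (c - 1) W (s (b, c - 1)))
             else 0)
       else 0)\<rparr>"

section \<open>Exterior forms and polynomials in a frame\<close>

text \<open>
  A form of degree \<open>p\<close> is an alternating multilinear function of lists of length \<open>p\<close>, extended by
  zero to lists of other lengths. The wedge product is a sum over shuffles: the vectors with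
  positions in \<open>S\<close> are moved in front of the others. For homogeneous arguments of degrees \<open>p\<close>
  and \<open>q\<close> only the sets \<open>S\<close> of size \<open>p\<close> contribute, on lists of length \<open>p + q\<close>.
\<close>

type_synonym ('k, 'v) form = "'v list \<Rightarrow> 'k"

definition wedge :: "('k::comm_ring_1, 'v) form \<Rightarrow> ('k, 'v) form \<Rightarrow> ('k, 'v) form" where
  "wedge \<alpha> \<beta> = (\<lambda>vs. \<Sum>S\<in>Pow {..<length vs}.
     (-1) ^ card {(i, j). i < j \<and> i \<notin> S \<and> j \<in> S} * \<alpha> (nths vs S) * \<beta> (nths vs (- S)))"

definition contract :: "'v \<Rightarrow> ('k, 'v) form \<Rightarrow> ('k, 'v) form" where
  "contract x \<alpha> = (\<lambda>vs. \<alpha> (vs @ [x]))"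

text \<open>
  Given a basis \<open>e\<^sub>1, e\<^sub>2\<close> of \<open>U\<close>, an element \<open>F\<close> of \<open>\<Lambda>\<^sup>pV\<^sup>\<or> \<otimes> S\<^sup>qU\<close> is stored by its coefficients:
  \<open>F i j\<close> is the form multiplying \<open>e\<^sub>1\<^sup>i e\<^sub>2\<^sup>j\<close>.
\<close>

type_synonym ('k, 'v) form_poly = "nat \<Rightarrow> nat \<Rightarrow> ('k, 'v) form"

definition mult_e1 :: "('k::field, 'v) form_poly \<Rightarrow> ('k, 'v) form_poly" where
  "mult_e1 F = (\<lambda>i j. if i = 0 then 0 else F (i - 1) j)"

definition mult_e2 :: "('k::field, 'v) form_poly \<Rightarrow> ('k, 'v) form_poly" where
  "mult_e2 F = (\<lambda>i j. if j = 0 then 0 else F i (j - 1))"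

definition deriv_e1 :: "('k::field, 'v) form_poly \<Rightarrow> ('k, 'v) form_poly" where
  "deriv_e1 F = (\<lambda>i j vs. of_nat (i + 1) * F (i + 1) j vs)"

definition deriv_e2 :: "('k::field, 'v) form_poly \<Rightarrow> ('k, 'v) form_poly" where
  "deriv_e2 F = (\<lambda>i j vs. of_nat (j + 1) * F i (j + 1) vs)"

definition map_form ::
  "(('k, 'v) form \<Rightarrow> ('k, 'v) form) \<Rightarrow> ('k, 'v) form_poly \<Rightarrow> ('k, 'v) form_poly"
where
  "map_form f F = (\<lambda>i j. f (F i j))"

definition eval_form_poly :: "nat \<Rightarrow> ('k::field, 'v) form_poly \<Rightarrow> 'k \<Rightarrow> 'k \<Rightarrow> ('k, 'v) form" where
  "eval_form_poly q F X Y = (\<lambda>vs. \<Sum>i\<le>q. F i (q - i) vs * X ^ i * Y ^ (q - i))"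

section \<open>The isotropic Grassmannian and its bundles\<close>

locale symplectic_space = vector_space scale
  for scale :: "'k::field \<Rightarrow> 'v::ab_group_add \<Rightarrow> 'v" (infixr \<open>*s\<close> 75) +
  fixes \<omega> :: "'v \<Rightarrow> 'v \<Rightarrow> 'k"
  assumes linear_left: "\<And>y. Vector_Spaces.linear scale (*) (\<lambda>x. \<omega> x y)"
    and linear_right: "\<And>x. Vector_Spaces.linear scale (*) (\<lambda>y. \<omega> x y)"
    and alternating: "\<And>x. \<omega> x x = 0"
    and nondegenerate: "\<And>x. (\<And>y. \<omega> x y = 0) \<Longrightarrow> x = 0"
begin

definition IGr :: "'v set set" where
  "IGr = {U. subspace U \<and> dim U = 2 \<and> (\<forall>x\<in>U. \<forall>y\<in>U. \<omega> x y = 0)}"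

text \<open>
  The frames \<open>(e\<^sub>1, e\<^sub>2)\<close> spanning a member of \<open>W\<close>. For \<open>W = IGr\<close> they form a locally closed
  subvariety of \<open>V \<times> V\<close>, which is a Zariski locally trivial principal \<open>GL\<^sub>2\<close>-bundle over the isotropic
  Grassmannian. The Zariski topology and the regular functions of the latter are therefore those
  of the quotient, and sections of an associated bundle are equivariant regular functions
  on frames.
\<close>

definition frames :: "'v set set \<Rightarrow> ('v \<times> 'v) set" where
  "frames W = {(x, y). x \<noteq> y \<and> independent {x, y} \<and> span {x, y} \<in> W}"

definition frame_span :: "'v \<times> 'v \<Rightarrow> 'v set" where
  "frame_span e = span {fst e, snd e}"

inductive_set poly_funs :: "('v \<times> 'v \<Rightarrow> 'k) set" where
  const: "(\<lambda>_. a) \<in> poly_funs"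
| linear_fst: "Vector_Spaces.linear scale (*) f \<Longrightarrow> (\<lambda>e. f (fst e)) \<in> poly_funs"
| linear_snd: "Vector_Spaces.linear scale (*) f \<Longrightarrow> (\<lambda>e. f (snd e)) \<in> poly_funs"
| plus: "g \<in> poly_funs \<Longrightarrow> h \<in> poly_funs \<Longrightarrow> (\<lambda>e. g e + h e) \<in> poly_funs"
| times: "g \<in> poly_funs \<Longrightarrow> h \<in> poly_funs \<Longrightarrow> (\<lambda>e. g e * h e) \<in> poly_funs"

definition zariski_open :: "'v set set \<Rightarrow> bool" where
  "zariski_open W \<longleftrightarrow> W \<subseteq> IGr \<and>
    (\<forall>e\<in>frames W. \<exists>h\<in>poly_funs. h e \<noteq> 0 \<and> (\<forall>e'\<in>frames IGr. h e' \<noteq> 0 \<longrightarrow> e' \<in> frames W))"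

definition IGr_top :: "'v set topology" where
  "IGr_top = topology zariski_open"

lemma zariski_openD:
  assumes "zariski_open W" "e \<in> frames W"
  obtains h where "h \<in> poly_funs" "h e \<noteq> 0" "\<And>e'. e' \<in> frames IGr \<Longrightarrow> h e' \<noteq> 0 \<Longrightarrow> e' \<in> frames W"
  using assms unfolding zariski_open_def by blast

lemma istopology_zariski_open: "istopology zariski_open"
  unfolding istopology_def
proof (intro conjI allI impI)
  fix S T assume S: "zariski_open S" and T: "zariski_open T"
  show "zariski_open (S \<inter> T)"
    unfolding zariski_open_def
  proof (intro conjI ballI)
    show "S \<inter> T \<subseteq> IGr" using S by (auto simp: zariski_open_def)
    fix e assume e: "e \<in> frames (S \<inter> T)"
    have inter: "frames (S \<inter> T) = frames S \<inter> frames T" by (auto simp: frames_def)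
    from e inter have eS: "e \<in> frames S" and eT: "e \<in> frames T" by simp_all
    from S eS obtain g where g: "g \<in> poly_funs" "g e \<noteq> 0"
        "\<And>e'. e' \<in> frames IGr \<Longrightarrow> g e' \<noteq> 0 \<Longrightarrow> e' \<in> frames S"
      by (rule zariski_openD) (rule that)
    from T eT obtain h where h: "h \<in> poly_funs" "h e \<noteq> 0"
        "\<And>e'. e' \<in> frames IGr \<Longrightarrow> h e' \<noteq> 0 \<Longrightarrow> e' \<in> frames T"
      by (rule zariski_openD) (rule that)
    show "\<exists>h\<in>poly_funs. h e \<noteq> 0 \<and> (\<forall>e'\<in>frames IGr. h e' \<noteq> 0 \<longrightarrow> e' \<in> frames (S \<inter> T))"
      by (rule bexI[OF _ poly_funs.times[OF g(1) h(1)]]) (use g(2,3) h(2,3) inter in simp)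
  qed
next
  fix K assume K: "\<forall>W\<in>K. zariski_open W"
  show "zariski_open (\<Union>K)"
    unfolding zariski_open_def
  proof (intro conjI ballI)
    show "\<Union>K \<subseteq> IGr" using K by (auto simp: zariski_open_def)
    fix e assume "e \<in> frames (\<Union>K)"
    then obtain W where W: "W \<in> K" "e \<in> frames W" by (auto simp: frames_def)
    then have "zariski_open W" using K by simp
    then obtain h where h: "h \<in> poly_funs" "h e \<noteq> 0"
        "\<And>e'. e' \<in> frames IGr \<Longrightarrow> h e' \<noteq> 0 \<Longrightarrow> e' \<in> frames W"
      using W(2) by (rule zariski_openD) (rule that)
    have sub: "frames W \<subseteq> frames (\<Union>K)" using W(1) by (auto simp: frames_def)
    show "\<exists>h\<in>poly_funs. h e \<noteq> 0 \<and> (\<forall>e'\<in>frames IGr. h e' \<noteq> 0 \<longrightarrow> e' \<in> frames (\<Union>K))"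
      by (rule bexI[OF _ h(1)]) (use h(2,3) sub in blast)
  qed
qed

lemma openin_IGr_top: "openin IGr_top W \<longleftrightarrow> zariski_open W"
  by (simp add: IGr_top_def istopology_zariski_open)

definition regular_on :: "('v \<times> 'v) set \<Rightarrow> ('v \<times> 'v \<Rightarrow> 'k) \<Rightarrow> bool" where
  "regular_on A f \<longleftrightarrow>
    (\<forall>e\<in>A. \<exists>g\<in>poly_funs. \<exists>h\<in>poly_funs. h e \<noteq> 0 \<and> (\<forall>e'\<in>A. h e' \<noteq> 0 \<longrightarrow> f e' = g e' / h e'))"

definition IGr_reg :: "'v set set \<Rightarrow> ('v set \<Rightarrow> 'k) set" where
  "IGr_reg W = {r. regular_on (frames W) (\<lambda>e. r (frame_span e))}"

definition alt_forms :: "nat \<Rightarrow> ('k, 'v) form set" where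
  "alt_forms p = {\<alpha>. (\<forall>vs. length vs \<noteq> p \<longrightarrow> \<alpha> vs = 0) \<and>
     (\<forall>vs i. length vs = p \<and> i < p \<longrightarrow> Vector_Spaces.linear scale (*) (\<lambda>x. \<alpha> (vs[i := x]))) \<and>
     (\<forall>vs. length vs = p \<and> \<not> distinct vs \<longrightarrow> \<alpha> vs = 0)}"

text \<open>
  The bundle \<open>\<Lambda>\<^sup>pV\<^sup>\<or> \<otimes> S\<^sup>qU(m)\<close>. The value of a section at a frame \<open>e\<close> is the coefficient \<open>F\<close> of the
  \<open>m\<close>-th power of the generator \<open>e\<^sub>1\<^sup>* \<and> e\<^sub>2\<^sup>*\<close> of \<open>det U\<^sup>\<or>\<close>. Replacing \<open>e\<close> by
  \<open>(a e\<^sub>1 + b e\<^sub>2, c e\<^sub>1 + d e\<^sub>2)\<close> divides this generator by \<open>a d - b c\<close>, which yields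
  \<open>F'(a e\<^sub>1 + b e\<^sub>2, c e\<^sub>1 + d e\<^sub>2) = (a d - b c)\<^sup>m F(e\<^sub>1, e\<^sub>2)\<close>, an identity of polynomials in
  \<open>e\<^sub>1, e\<^sub>2\<close> that is stated by evaluation because the ground field is infinite. Sections are
  extended by zero to pairs that are not frames over \<open>W\<close>.
\<close>

definition form_bundle :: "nat \<Rightarrow> nat \<Rightarrow> nat \<Rightarrow> ('v set, 'k, 'v \<times> 'v \<Rightarrow> ('k, 'v) form_poly) modsheaf" where
  "form_bundle p q m =
    \<lparr>sec = (\<lambda>W. {s.
       (\<forall>e. e \<notin> frames W \<longrightarrow> s e = 0) \<and>
       (\<forall>e\<in>frames W. \<forall>i j. s e i j \<in> alt_forms p \<and> (i + j \<noteq> q \<longrightarrow> s e i j = 0)) \<and>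
       (\<forall>i j vs. regular_on (frames W) (\<lambda>e. s e i j vs)) \<and>
       (\<forall>x y a b c d X Y. (x, y) \<in> frames W \<and> a * d - b * c \<noteq> 0 \<longrightarrow>
          eval_form_poly q (s (a *s x + b *s y, c *s x + d *s y)) (a * X + b * Y) (c * X + d * Y) =
          (\<lambda>vs. (a * d - b * c) ^ m * eval_form_poly q (s (x, y)) X Y vs))}),
     res = (\<lambda>W s e. if e \<in> frames W then s e else 0),
     act = (\<lambda>r s e i j vs. r (frame_span e) * s e i j vs)\<rparr>"

definition \<omega>_form :: "('k, 'v) form" where
  "\<omega>_form = (\<lambda>vs. if length vs = 2 then \<omega> (vs ! 0) (vs ! 1) else 0)"

definition d0 :: "'v \<times> 'v \<Rightarrow> ('k, 'v) form_poly \<Rightarrow> ('k, 'v) form_poly" where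
  "d0 e F = map_form (contract (fst e)) (mult_e2 F) - map_form (contract (snd e)) (mult_e1 F)"

definition d1 :: "'v \<times> 'v \<Rightarrow> ('k, 'v) form_poly \<Rightarrow> ('k, 'v) form_poly" where
  "d1 e F =
    map_form (\<lambda>\<alpha>. wedge (contract (fst e) \<alpha>) \<omega>_form) (deriv_e1 F) +
    map_form (\<lambda>\<alpha>. wedge (contract (snd e) \<alpha>) \<omega>_form) (deriv_e2 F)"

definition d2 :: "'v \<times> 'v \<Rightarrow> ('k, 'v) form_poly \<Rightarrow> ('k, 'v) form_poly" where
  "d2 e F =
    map_form (\<lambda>\<alpha>. wedge \<alpha> (contract (fst e) \<omega>_form)) (deriv_e1 F) +
    map_form (\<lambda>\<alpha>. wedge \<alpha> (contract (snd e) \<omega>_form)) (deriv_e2 F)"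

definition vert :: "'v set set \<Rightarrow> ('v \<times> 'v \<Rightarrow> ('k, 'v) form_poly) \<Rightarrow> 'v \<times> 'v \<Rightarrow> ('k, 'v) form_poly" where
  "vert W s = (\<lambda>e. d0 e (s e))"

text \<open>The bundle \<open>\<E>\<^bsup>a,b\<^esup>\<close> and the complex \<open>\<E>\<^sub>t\<close>, with \<open>\<E>\<^bsup>t-b,b\<^esup>\<close> in degree \<open>-b\<close>.\<close>

definition E_sheaf :: "nat \<Rightarrow> nat \<Rightarrow> ('v set, 'k, 'v \<times> 'v \<Rightarrow> ('k, 'v) form_poly) modsheaf" where
  "E_sheaf a b = kernel_sheaf (form_bundle a b 0) vert"

definition E_diff ::
  "nat \<Rightarrow> 'v set set \<Rightarrow> ('v \<times> 'v \<Rightarrow> ('k, 'v) form_poly) \<Rightarrow> 'v \<times> 'v \<Rightarrow> ('k, 'v) form_poly"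
where
  "E_diff b W s = (\<lambda>e i j vs. 1 / of_nat (b + 1) * d1 e (s e) i j vs + d2 e (s e) i j vs)"

definition E_complex :: "nat \<Rightarrow> ('v set, 'k, 'v \<times> 'v \<Rightarrow> ('k, 'v) form_poly) sheaf_complex" where
  "E_complex t =
    \<lparr>obj = (\<lambda>k. if - int t \<le> k \<and> k \<le> 0 then E_sheaf (t - nat (- k)) (nat (- k)) else zero_sheaf),
     diff = (\<lambda>k. if - int t \<le> k \<and> k < 0 then E_diff (nat (- k)) else (\<lambda>_ _. 0))\<rparr>"

text \<open>
  The bicomplex. The Schur functor \<open>\<Sigma>\<^bsup>c,-b\<^esup>U\<^sup>\<or>\<close> is identified with \<open>S\<^bsup>b+c\<^esup>U(c)\<close>, the form
  in which the differentials are defined.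
\<close>

definition bic_index :: "nat \<Rightarrow> (nat \<times> nat) set" where
  "bic_index t = {(b, c). b + c \<le> t}"

definition bic_term :: "nat \<Rightarrow> nat \<Rightarrow> nat \<Rightarrow> ('v set, 'k, 'v \<times> 'v \<Rightarrow> ('k, 'v) form_poly) modsheaf" where
  "bic_term t b c = form_bundle (t - b - c) (b + c) c"

definition bic_horiz ::
  "nat \<Rightarrow> nat \<Rightarrow> 'v set set \<Rightarrow> ('v \<times> 'v \<Rightarrow> ('k, 'v) form_poly) \<Rightarrow> 'v \<times> 'v \<Rightarrow> ('k, 'v) form_poly"
where
  "bic_horiz b c W s = (\<lambda>e i j vs. (-1) ^ c *
     (of_nat b / (of_nat (b + c) * of_nat (b + c + 1)) * d1 e (s e) i j vs +
      of_nat b / of_nat (b + c) * d2 e (s e) i j vs))"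

definition bic_vert ::
  "nat \<Rightarrow> nat \<Rightarrow> 'v set set \<Rightarrow> ('v \<times> 'v \<Rightarrow> ('k, 'v) form_poly) \<Rightarrow> 'v \<times> 'v \<Rightarrow> ('k, 'v) form_poly"
where
  "bic_vert b c = vert"

definition bic_total ::
  "nat \<Rightarrow> ('v set, 'k, nat \<times> nat \<Rightarrow> 'v \<times> 'v \<Rightarrow> ('k, 'v) form_poly) sheaf_complex"
where
  "bic_total t = total_complex (bic_index t) (bic_term t) bic_horiz bic_vert"

end

end

theory Submission
  imports Defs
begin

text \<open>
  At a basis \<open>e\<^sub>1, e\<^sub>2\<close> of an isotropic plane \<open>U\<close> a local section is a polynomial in \<open>e\<^sub>1, e\<^sub>2\<close> with
  coefficients in \<open>\<Lambda>V\<^sup>\<or>\<close>, and every map in sight is composed of six kinds of operators: contraction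
  \<open>iota x\<close> with a vector, multiplication \<open>eps x\<close> by \<open>\<omega>(-, x)\<close>, multiplication \<open>lef\<close> by \<open>\<omega>\<close>,
  multiplication by \<open>e\<^sub>i\<close> and the derivations \<open>\<partial>\<^sub>i\<close>. Contractions and multiplications satisfy the
  Clifford relations, \<open>e\<^sub>i\<close> and \<open>\<partial>\<^sub>i\<close> the Weyl relations, and \<open>[iota x, lef] = eps x\<close>; every operator
  identity is obtained by rewriting both sides to a normal form. Put \<open>C = \<Sum> iota e\<^sub>i \<partial>\<^sub>i\<close> and
  \<open>D = \<Sum> eps e\<^sub>i \<partial>\<^sub>i\<close>. Then \<open>d\<^sub>1 = lef C\<close>, \<open>d\<^sub>2 = D\<close>, and \<open>d\<^sub>0\<close> is a Koszul differential. Since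
  \<open>[C, lef] = D\<close> and \<open>C D = - D C\<close> on isotropic planes, the given weights are those for which the rows
  are complexes (\<open>horizontal_square_zero\<close>) and anticommute with \<open>d\<^sub>0\<close>
  (\<open>horizontal_vertical_commute\<close>).

  Quasi-isomorphism. Let \<open>U'\<close> be an isotropic plane that \<open>\<omega>\<close> pairs perfectly with \<open>U\<close>. The basis of \<open>U'\<close>
  dual to \<open>e\<^sub>1, e\<^sub>2\<close> provides a homotopy \<open>H\<close> with \<open>d\<^sub>0 H + H d\<^sub>0 = q + N\<close> on polynomials of degree \<open>q\<close>,
  where \<open>N\<close> is diagonalizable with eigenvalues \<open>0, 1, 2\<close>. In the columns \<open>q\<close> is positive away
  from the first term, so they are exact there. This holds already for sections over any open set of
  planes paired perfectly with a fixed \<open>U'\<close> (\<open>vertical_exact\<close>), because the dual basis depends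
  regularly on the frame; such sets form a neighbourhood base (\<open>adapted_neighbourhood\<close>). A cochain
  of the total complex whose differential lies in the bottom row can then be moved into the bottom
  row (\<open>move_to_bottom_row\<close>). There being vertically closed means belonging to \<open>\<E>\<^sub>t\<close>, and the
  horizontal arrow is the differential of \<open>\<E>\<^sub>t\<close>. Hence the inclusion of \<open>\<E>\<^sub>t\<close> into the bottom row is a
  quasi-isomorphism.

  Acyclicity. With \<open>\<theta> = f\<^sub>1 e\<^sub>1 + f\<^sub>2 e\<^sub>2\<close>, where \<open>f\<^sub>1, f\<^sub>2\<close> are the linear forms dual to \<open>e\<^sub>1, e\<^sub>2\<close>
  that vanish on \<open>U'\<close> and on the complement \<open>W\<close> of \<open>U + U'\<close>, the kernel of \<open>d\<^sub>0\<close> consists of the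
  elements \<open>Z\<^sub>0 + \<theta> Z\<^sub>1\<close> such that \<open>Z\<^sub>0\<close> and \<open>Z\<^sub>1\<close> have coefficients in \<open>\<Lambda>(V/U)\<^sup>\<or>\<close>. The differential
  sends it to \<open>D Z\<^sub>0 + L Z\<^sub>1 - \<theta> D Z\<^sub>1\<close> (\<open>twisted_differential\<close>), with \<open>L\<close> the multiplication by
  the form that \<open>\<omega>\<close> induces on \<open>U\<^sup>\<bottom>/U \<cong> W\<close>. So \<open>\<E>\<^sub>t\<close> is the cone of \<open>L\<close> between two complexes with
  differential \<open>D\<close>. These are exact except in polynomial degree \<open>0\<close> (\<open>poincare\<close>), where their
  cohomology is \<open>\<Lambda>\<^bsup>t-2\<^esup>\<close> and \<open>\<Lambda>\<^sup>t\<close> of \<open>(U\<^sup>\<bottom>/U)\<^sup>\<or>\<close>. The space \<open>U\<^sup>\<bottom>/U\<close> is symplectic of dimension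
  \<open>2 (n - 2)\<close>, so for \<open>t = n - 1\<close> the map \<open>L\<close> between them is the Lefschetz isomorphism across the
  middle degree; it follows from the \<open>sl\<^sub>2\<close> relation (\<open>lefW_injective\<close>, \<open>lefschetz_surjective\<close>). The
  explicit form of this diagram chase is \<open>E_exact\<close>.
\<close>

section \<open>Wedge products and contractions\<close>

lemma wedge_Nil: "wedge \<alpha> \<beta> [] = \<alpha> [] * \<beta> []"
  by (simp add: wedge_def)

lemma wedge_zero_left [simp]: "wedge 0 \<beta> = 0"
  by (simp add: wedge_def fun_eq_iff)

lemma wedge_add_left: "wedge (\<alpha> + \<alpha>') \<beta> = wedge \<alpha> \<beta> + wedge \<alpha>' \<beta>"
  by (simp add: wedge_def fun_eq_iff algebra_simps sum.distrib)

lemma wedge_add_right: "wedge \<alpha> (\<beta> + \<beta>') = wedge \<alpha> \<beta> + wedge \<alpha> \<beta>'"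
  by (simp add: wedge_def fun_eq_iff algebra_simps sum.distrib)

lemma wedge_scale_left: "wedge (\<lambda>vs. c * \<alpha> vs) \<beta> = (\<lambda>vs. c * wedge \<alpha> \<beta> vs)"
  by (simp add: wedge_def fun_eq_iff sum_distrib_left mult_ac)

lemma wedge_scale_right: "wedge \<alpha> (\<lambda>vs. c * \<beta> vs) = (\<lambda>vs. c * wedge \<alpha> \<beta> vs)"
  by (simp add: wedge_def fun_eq_iff sum_distrib_left mult_ac)

lemma contract_zero [simp]: "contract x 0 = 0"
  by (simp add: contract_def fun_eq_iff)

lemma contract_add: "contract x (\<alpha> + \<beta>) = contract x \<alpha> + contract x \<beta>"
  by (simp add: contract_def fun_eq_iff)

lemma contract_scale: "contract x (\<lambda>vs. c * \<alpha> vs) = (\<lambda>vs. c * contract x \<alpha> vs)"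
  by (simp add: contract_def fun_eq_iff)

lemma form_eq_by_contract:
  assumes "\<alpha> [] = \<beta> []" and "\<And>x. contract x \<alpha> = contract x \<beta>"
  shows "\<alpha> = \<beta>"
proof
  fix vs show "\<alpha> vs = \<beta> vs"
    using assms by (cases vs rule: rev_cases) (auto simp: contract_def fun_eq_iff)
qed

lemma nths_cong: "(\<And>i. i < length xs \<Longrightarrow> i \<in> A \<longleftrightarrow> i \<in> B) \<Longrightarrow> nths xs A = nths xs B"
  unfolding nths_def by (rule arg_cong[of _ _ "map fst"], rule filter_cong) (auto simp: set_zip)

text \<open>
  The shuffles of \<open>vs @ [x]\<close> split according to the argument that receives \<open>x\<close>; handing it to \<open>\<alpha>\<close>
  moves it past the \<open>q\<close> arguments of \<open>\<beta>\<close>. This recursion replaces every further computation with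
  shuffles.
\<close>

lemma wedge_snoc:
  fixes \<alpha> \<beta> :: "('k::comm_ring_1, 'v) form"
  assumes deg: "\<And>vs. length vs \<noteq> q \<Longrightarrow> \<beta> vs = 0"
  shows "wedge \<alpha> \<beta> (vs @ [x]) = wedge \<alpha> (contract x \<beta>) vs + (-1) ^ q * wedge (contract x \<alpha>) \<beta> vs"
proof -
  let ?n = "length vs"
  let ?t = "\<lambda>S. (-1) ^ card {(i, j). i < j \<and> i \<notin> S \<and> j \<in> S} * \<alpha> (nths (vs @ [x]) S) * \<beta> (nths (vs @ [x]) (- S)) :: 'k"
  have Pow: "Pow {..<Suc ?n} = Pow {..<?n} \<union> insert ?n ` Pow {..<?n}"
    by (simp add: lessThan_Suc Pow_insert)
  have inj: "inj_on (insert ?n) (Pow {..<?n})"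
    by (auto simp: inj_on_def) (metis insertE lessThan_iff nat_neq_iff subsetD insertCI)+
  have disj: "Pow {..<?n} \<inter> insert ?n ` Pow {..<?n} = {}" by auto
  have "wedge \<alpha> \<beta> (vs @ [x]) = sum ?t (Pow {..<Suc ?n})" by (simp add: wedge_def)
  also have "\<dots> = sum ?t (Pow {..<?n}) + (\<Sum>S\<in>Pow {..<?n}. ?t (insert ?n S))"
    unfolding Pow by (subst sum.union_disjoint) (use disj inj in \<open>auto simp: sum.reindex\<close>)
  also have "sum ?t (Pow {..<?n}) = wedge \<alpha> (contract x \<beta>) vs"
    unfolding wedge_def contract_def
    by (intro sum.cong refl) (auto simp: nths_append)
  also have "(\<Sum>S\<in>Pow {..<?n}. ?t (insert ?n S)) = (-1) ^ q * wedge (contract x \<alpha>) \<beta> vs"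
    unfolding wedge_def sum_distrib_left
  proof (intro sum.cong refl)
    fix S assume "S \<in> Pow {..<?n}"
    then have S: "S \<subseteq> {..<?n}" by simp
    have fS: "finite S" using S finite_subset by blast
    have len: "length (nths vs (- S)) = card ({..<?n} - S)"
      unfolding length_nths by (rule arg_cong[of _ _ card]) auto
    have n1: "nths (vs @ [x]) (insert ?n S) = nths vs S @ [x]"
      using nths_cong[of vs "insert ?n S" S] by (simp add: nths_append)
    have n2: "nths (vs @ [x]) (- insert ?n S) = nths vs (- S)"
      using nths_cong[of vs "- insert ?n S" "- S"] by (simp add: nths_append)
    have inv: "{(i, j). i < j \<and> i \<notin> insert ?n S \<and> j \<in> insert ?n S} =
        {(i, j). i < j \<and> i \<notin> S \<and> j \<in> S} \<union> (\<lambda>i. (i, ?n)) ` ({..<?n} - S)"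
      using S by auto
    have fin: "finite {(i, j). i < j \<and> i \<notin> S \<and> j \<in> S}"
      by (rule finite_subset[of _ "{..<?n} \<times> {..<?n}"]) (use S in auto)
    have card: "card {(i, j). i < j \<and> i \<notin> insert ?n S \<and> j \<in> insert ?n S} =
        card {(i, j). i < j \<and> i \<notin> S \<and> j \<in> S} + length (nths vs (- S))"
      unfolding inv using fin S
      by (subst card_Un_disjoint) (auto simp: len card_image inj_on_def)
    show "?t (insert ?n S) = (-1) ^ q * ((-1) ^ card {(i, j). i < j \<and> i \<notin> S \<and> j \<in> S} *
        contract x \<alpha> (nths vs S) * \<beta> (nths vs (- S)))"
      unfolding n1 n2 card using deg[of "nths vs (- S)"]
      by (cases "length (nths vs (- S)) = q") (simp_all add: contract_def power_add mult_ac)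
  qed
  finally show ?thesis .
qed


lemma contract_wedge:
  fixes \<alpha> \<beta> :: "('k::comm_ring_1, 'v) form"
  assumes "\<And>vs. length vs \<noteq> q \<Longrightarrow> \<beta> vs = 0"
  shows "contract x (wedge \<alpha> \<beta>) = wedge \<alpha> (contract x \<beta>) + (\<lambda>vs. (-1) ^ q * wedge (contract x \<alpha>) \<beta> vs)"
  by (rule ext) (simp add: contract_def[of x "wedge \<alpha> \<beta>"] wedge_snoc[OF assms])

lemma wedge_degree_0:
  fixes \<alpha> \<beta> :: "('k::comm_ring_1, 'v) form"
  assumes "\<And>vs. vs \<noteq> [] \<Longrightarrow> \<beta> vs = 0"
  shows "wedge \<alpha> \<beta> = (\<lambda>vs. \<beta> [] * \<alpha> vs)"
proof
  fix vs show "wedge \<alpha> \<beta> vs = \<beta> [] * \<alpha> vs"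
  proof (induction vs arbitrary: \<alpha> rule: rev_induct)
    case Nil then show ?case by (simp add: wedge_Nil)
  next
    case (snoc x vs)
    have "contract x \<beta> = 0" using assms by (simp add: contract_def fun_eq_iff)
    moreover have "wedge \<alpha> 0 = 0" by (simp add: wedge_def fun_eq_iff)
    ultimately show ?case
      using snoc wedge_snoc[of 0 \<beta> \<alpha> vs x] assms by (simp add: contract_def)
  qed
qed

context symplectic_space
begin

definition wedge_vec :: "'v \<Rightarrow> ('k, 'v) form \<Rightarrow> ('k, 'v) form" where
  "wedge_vec x \<alpha> = wedge \<alpha> (contract x \<omega>_form)"

definition wedge_\<omega> :: "('k, 'v) form \<Rightarrow> ('k, 'v) form" where
  "wedge_\<omega> \<alpha> = wedge \<alpha> \<omega>_form"

lemma \<omega>_add_left: "\<omega> (x + y) z = \<omega> x z + \<omega> y z"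
  and \<omega>_scale_left: "\<omega> (c *s x) z = c * \<omega> x z"
  and \<omega>_add_right: "\<omega> x (y + z) = \<omega> x y + \<omega> x z"
  and \<omega>_scale_right: "\<omega> x (c *s z) = c * \<omega> x z"
  using linear_left[of z] linear_right[of x]
  by (auto simp: Vector_Spaces.linear_iff)

lemma \<omega>_skew: "\<omega> y x = - \<omega> x y"
proof -
  have "\<omega> y x + \<omega> x y = \<omega> (x + y) (x + y)"
    unfolding \<omega>_add_left[of x y "x + y"] \<omega>_add_right by (simp add: \<omega>_add_left alternating add.commute)
  then show ?thesis by (simp add: alternating eq_neg_iff_add_eq_0)
qed

lemmas \<omega>_linear = \<omega>_add_left \<omega>_add_right \<omega>_scale_left \<omega>_scale_right

lemma wedge_vec_Nil [simp]: "wedge_vec x \<alpha> [] = 0"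
  by (simp add: wedge_vec_def wedge_Nil contract_def \<omega>_form_def)

lemma wedge_\<omega>_Nil [simp]: "wedge_\<omega> \<alpha> [] = 0"
  by (simp add: wedge_\<omega>_def wedge_Nil \<omega>_form_def)

lemma wedge_vec_zero [simp]: "wedge_vec x 0 = 0" and wedge_\<omega>_zero [simp]: "wedge_\<omega> 0 = 0"
  by (simp_all add: wedge_vec_def wedge_\<omega>_def)

lemma wedge_vec_add: "wedge_vec x (\<alpha> + \<beta>) = wedge_vec x \<alpha> + wedge_vec x \<beta>"
  and wedge_\<omega>_add: "wedge_\<omega> (\<alpha> + \<beta>) = wedge_\<omega> \<alpha> + wedge_\<omega> \<beta>"
  by (simp_all add: wedge_vec_def wedge_\<omega>_def wedge_add_left)

lemma wedge_vec_scale: "wedge_vec x (\<lambda>vs. c * \<alpha> vs) = (\<lambda>vs. c * wedge_vec x \<alpha> vs)"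
  and wedge_\<omega>_scale: "wedge_\<omega> (\<lambda>vs. c * \<alpha> vs) = (\<lambda>vs. c * wedge_\<omega> \<alpha> vs)"
  by (simp_all add: wedge_vec_def wedge_\<omega>_def wedge_scale_left)

lemma wedge_vec_comb: "wedge_vec x (\<lambda>vs. c * \<alpha> vs - \<beta> vs) = (\<lambda>vs. c * wedge_vec x \<alpha> vs - wedge_vec x \<beta> vs)"
  and wedge_\<omega>_comb: "wedge_\<omega> (\<lambda>vs. c * \<alpha> vs - \<beta> vs) = (\<lambda>vs. c * wedge_\<omega> \<alpha> vs - wedge_\<omega> \<beta> vs)"
  by (simp_all add: wedge_vec_def wedge_\<omega>_def wedge_def fun_eq_iff algebra_simps sum_subtractf sum_distrib_left)

lemma wedge_vec_vec_add: "wedge_vec (x + y) \<alpha> = wedge_vec x \<alpha> + wedge_vec y \<alpha>"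
proof -
  have "contract (x + y) \<omega>_form = contract x \<omega>_form + contract y \<omega>_form"
    by (auto simp: fun_eq_iff contract_def \<omega>_form_def nth_append \<omega>_linear)
  then show ?thesis by (simp add: wedge_vec_def wedge_add_right)
qed

lemma wedge_vec_vec_scale: "wedge_vec (c *s x) \<alpha> = (\<lambda>vs. c * wedge_vec x \<alpha> vs)"
proof -
  have "contract (c *s x) \<omega>_form = (\<lambda>vs. c * contract x \<omega>_form vs)"
    by (auto simp: fun_eq_iff contract_def \<omega>_form_def nth_append \<omega>_linear)
  then show ?thesis by (simp add: wedge_vec_def wedge_scale_right)
qed

lemma contract_wedge_vec:
  "contract x (wedge_vec y \<alpha>) = (\<lambda>vs. \<omega> x y * \<alpha> vs - wedge_vec y (contract x \<alpha>) vs)"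
proof -
  have 1: "contract y \<omega>_form vs = 0" if "length vs \<noteq> 1" for vs
    using that by (simp add: contract_def \<omega>_form_def)
  have 2: "wedge \<alpha> (contract x (contract y \<omega>_form)) = (\<lambda>vs. \<omega> x y * \<alpha> vs)"
    by (subst wedge_degree_0) (auto simp: contract_def \<omega>_form_def)
  show ?thesis
    unfolding wedge_vec_def by (subst contract_wedge[of 1]) (auto simp: 1 2 fun_eq_iff)
qed

lemma contract_wedge_\<omega>: "contract x (wedge_\<omega> \<alpha>) = wedge_\<omega> (contract x \<alpha>) + wedge_vec x \<alpha>"
  unfolding wedge_vec_def wedge_\<omega>_def
  by (subst contract_wedge[of 2]) (auto simp: \<omega>_form_def fun_eq_iff)

text \<open>
  A form is determined by its contractions, so identities between products of such operators are
  proved by commuting a contraction past both sides and inducting on the length of the argument.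
\<close>

lemma wedge_vec_anticommute: "wedge_vec x (wedge_vec y \<alpha>) = - wedge_vec y (wedge_vec x \<alpha>)"
proof
  fix vs show "wedge_vec x (wedge_vec y \<alpha>) vs = (- wedge_vec y (wedge_vec x \<alpha>)) vs"
  proof (induction vs arbitrary: \<alpha> rule: rev_induct)
    case Nil then show ?case by simp
  next
    case (snoc z vs)
    have *: "wedge_vec x (wedge_vec y \<alpha>) (vs @ [z]) =
        \<omega> z x * wedge_vec y \<alpha> vs - \<omega> z y * wedge_vec x \<alpha> vs + wedge_vec x (wedge_vec y (contract z \<alpha>)) vs" for x y
    proof -
      have "wedge_vec x (wedge_vec y \<alpha>) (vs @ [z]) = contract z (wedge_vec x (wedge_vec y \<alpha>)) vs"
        by (simp add: contract_def)
      then show ?thesis by (simp add: contract_wedge_vec wedge_vec_comb)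
    qed
    show ?case using snoc[of "contract z \<alpha>"] by (simp add: *)
  qed
qed

lemma wedge_vec_wedge_\<omega>: "wedge_vec x (wedge_\<omega> \<alpha>) = wedge_\<omega> (wedge_vec x \<alpha>)"
proof
  fix vs show "wedge_vec x (wedge_\<omega> \<alpha>) vs = wedge_\<omega> (wedge_vec x \<alpha>) vs"
  proof (induction vs arbitrary: \<alpha> rule: rev_induct)
    case Nil then show ?case by simp
  next
    case (snoc z vs)
    have 1: "wedge_vec x (wedge_\<omega> \<alpha>) (vs @ [z]) = \<omega> z x * wedge_\<omega> \<alpha> vs
        - wedge_vec x (wedge_\<omega> (contract z \<alpha>)) vs - wedge_vec x (wedge_vec z \<alpha>) vs"
    proof -
      have "wedge_vec x (wedge_\<omega> \<alpha>) (vs @ [z]) = contract z (wedge_vec x (wedge_\<omega> \<alpha>)) vs"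
        by (simp add: contract_def)
      then show ?thesis by (simp add: contract_wedge_vec contract_wedge_\<omega> wedge_vec_add)
    qed
    have 2: "wedge_\<omega> (wedge_vec x \<alpha>) (vs @ [z]) = \<omega> z x * wedge_\<omega> \<alpha> vs
        - wedge_\<omega> (wedge_vec x (contract z \<alpha>)) vs + wedge_vec z (wedge_vec x \<alpha>) vs"
    proof -
      have "wedge_\<omega> (wedge_vec x \<alpha>) (vs @ [z]) = contract z (wedge_\<omega> (wedge_vec x \<alpha>)) vs"
        by (simp add: contract_def)
      then show ?thesis by (simp add: contract_wedge_vec contract_wedge_\<omega> wedge_\<omega>_comb)
    qed
    show ?case using snoc[of "contract z \<alpha>"] wedge_vec_anticommute[of x z \<alpha>] by (simp add: 1 2)
  qed
qed


subsection \<open>Alternating forms\<close>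

lemma alt_formsI:
  assumes "\<And>vs. length vs \<noteq> p \<Longrightarrow> \<alpha> vs = 0"
    and "\<And>vs i x y. length vs = p \<Longrightarrow> i < p \<Longrightarrow> \<alpha> (vs[i := x + y]) = \<alpha> (vs[i := x]) + \<alpha> (vs[i := y])"
    and "\<And>vs i c x. length vs = p \<Longrightarrow> i < p \<Longrightarrow> \<alpha> (vs[i := c *s x]) = c * \<alpha> (vs[i := x])"
    and "\<And>vs. length vs = p \<Longrightarrow> \<not> distinct vs \<Longrightarrow> \<alpha> vs = 0"
  shows "\<alpha> \<in> alt_forms p"
proof -
  have "vector_space ((*) :: 'k \<Rightarrow> 'k \<Rightarrow> 'k)"
    by unfold_locales (simp_all add: algebra_simps)
  then show ?thesis
    using assms vector_space_axioms unfolding alt_forms_def Vector_Spaces.linear_iff by simp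
qed

lemma alt_forms_length: "\<alpha> \<in> alt_forms p \<Longrightarrow> length vs \<noteq> p \<Longrightarrow> \<alpha> vs = 0"
  by (simp add: alt_forms_def)

lemma alt_forms_slot_add:
  "\<alpha> \<in> alt_forms p \<Longrightarrow> length vs = p \<Longrightarrow> i < p \<Longrightarrow> \<alpha> (vs[i := x + y]) = \<alpha> (vs[i := x]) + \<alpha> (vs[i := y])"
  and alt_forms_slot_scale:
  "\<alpha> \<in> alt_forms p \<Longrightarrow> length vs = p \<Longrightarrow> i < p \<Longrightarrow> \<alpha> (vs[i := c *s x]) = c * \<alpha> (vs[i := x])"
  by (simp_all add: alt_forms_def Vector_Spaces.linear_iff)

lemma alt_forms_distinct: "\<alpha> \<in> alt_forms p \<Longrightarrow> \<not> distinct vs \<Longrightarrow> \<alpha> vs = 0"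
  by (cases "length vs = p") (auto simp: alt_forms_def)

lemma alt_forms_zero [simp]: "0 \<in> alt_forms p"
  by (rule alt_formsI) auto

lemma alt_forms_add: "\<alpha> \<in> alt_forms p \<Longrightarrow> \<beta> \<in> alt_forms p \<Longrightarrow> \<alpha> + \<beta> \<in> alt_forms p"
  by (rule alt_formsI)
    (simp_all add: alt_forms_length alt_forms_distinct alt_forms_slot_add alt_forms_slot_scale algebra_simps)

lemma alt_forms_scale: "\<alpha> \<in> alt_forms p \<Longrightarrow> (\<lambda>vs. c * \<alpha> vs) \<in> alt_forms p"
  by (rule alt_formsI)
    (simp_all add: alt_forms_length alt_forms_distinct alt_forms_slot_add alt_forms_slot_scale algebra_simps)

lemma alt_forms_diff: "\<alpha> \<in> alt_forms p \<Longrightarrow> \<beta> \<in> alt_forms p \<Longrightarrow> \<alpha> - \<beta> \<in> alt_forms p"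
  by (rule alt_formsI)
    (simp_all add: alt_forms_length alt_forms_distinct alt_forms_slot_add alt_forms_slot_scale algebra_simps)

lemma contract_alt_forms: assumes "\<alpha> \<in> alt_forms p" shows "contract x \<alpha> \<in> alt_forms (p - 1)"
proof (cases "p = 0")
  case True
  then have "contract x \<alpha> = 0" using assms by (auto simp: contract_def fun_eq_iff alt_forms_length)
  then show ?thesis by simp
next
  case False
  have upd: "vs[i := y] @ [x] = (vs @ [x])[i := y]" if "i < length vs" for vs i and y :: 'v
    using that by (simp add: list_update_append)
  show ?thesis
    unfolding contract_def
    by (rule alt_formsI)
      (use False assms in \<open>simp_all add: upd alt_forms_length[OF assms] alt_forms_distinct[OF assms]
         alt_forms_slot_add[OF assms] alt_forms_slot_scale[OF assms]\<close>)
qed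

lemma contract_degree_0: "\<alpha> \<in> alt_forms 0 \<Longrightarrow> contract x \<alpha> = 0"
  by (auto simp: contract_def fun_eq_iff alt_forms_length)

lemma contract_vec_add: assumes "\<alpha> \<in> alt_forms p" shows "contract (x + y) \<alpha> = contract x \<alpha> + contract y \<alpha>"
proof
  fix vs
  show "contract (x + y) \<alpha> vs = (contract x \<alpha> + contract y \<alpha>) vs"
    using alt_forms_slot_add[OF assms, of "vs @ [0]" "length vs" x y] alt_forms_length[OF assms]
    by (cases "Suc (length vs) = p") (auto simp: contract_def)
qed

lemma contract_vec_scale: assumes "\<alpha> \<in> alt_forms p" shows "contract (c *s x) \<alpha> = (\<lambda>vs. c * contract x \<alpha> vs)"
proof
  fix vs
  show "contract (c *s x) \<alpha> vs = c * contract x \<alpha> vs"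
    using alt_forms_slot_scale[OF assms, of "vs @ [0]" "length vs" c x] alt_forms_length[OF assms]
    by (cases "Suc (length vs) = p") (auto simp: contract_def)
qed

lemma contract_same: assumes "\<alpha> \<in> alt_forms p" shows "contract x (contract x \<alpha>) = 0"
  by (auto simp: contract_def fun_eq_iff alt_forms_distinct[OF assms])

lemma contract_anticommute:
  assumes "\<alpha> \<in> alt_forms p" shows "contract x (contract y \<alpha>) = - contract y (contract x \<alpha>)"
proof -
  have "contract (x + y) (contract (x + y) \<alpha>) = 0" by (rule contract_same[OF assms])
  then have "contract y (contract x \<alpha>) + contract x (contract y \<alpha>) = 0"
    by (simp add: contract_vec_add[OF assms] contract_vec_add[OF contract_alt_forms[OF assms]]
        contract_add contract_same[OF assms])
  then show ?thesis by (simp add: eq_neg_iff_add_eq_0 add.commute)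
qed

lemma alt_forms_swap:
  assumes \<alpha>: "\<alpha> \<in> alt_forms p" and i: "i < length us"
  shows "\<alpha> (us[i := x] @ [y]) = - \<alpha> (us[i := y] @ [x])"
proof (cases "Suc (length us) = p")
  case False then show ?thesis by (simp add: alt_forms_length[OF \<alpha>])
next
  case True
  have nd: "\<not> distinct (us[i := z] @ [z])" for z
    using i by (simp add: set_update_memI)
  have slot: "\<alpha> (us[i := x + y] @ [z]) = \<alpha> (us[i := x] @ [z]) + \<alpha> (us[i := y] @ [z])" for z
    using alt_forms_slot_add[OF \<alpha>, of "us @ [z]" i x y] True i by (simp add: list_update_append)
  have last: "\<alpha> (ws @ [x + y]) = \<alpha> (ws @ [x]) + \<alpha> (ws @ [y])" for ws
    using contract_vec_add[OF \<alpha>, of x y] by (simp add: contract_def fun_eq_iff)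
  have "\<alpha> (us[i := x + y] @ [x + y]) = 0" by (rule alt_forms_distinct[OF \<alpha> nd])
  then show ?thesis
    using alt_forms_distinct[OF \<alpha> nd] by (simp add: slot last eq_neg_iff_add_eq_0 add.commute)
qed

text \<open>
  Contracting an operator identity lowers the degree of the forms, so this criterion turns the
  closure of alternating forms under multiplication into an induction on the degree.
\<close>

lemma alt_forms_Suc:
  assumes Nil: "\<beta> [] = 0"
    and alt: "\<And>x. contract x \<beta> \<in> alt_forms p"
    and add: "\<And>x y. contract (x + y) \<beta> = contract x \<beta> + contract y \<beta>"
    and scale: "\<And>c x. contract (c *s x) \<beta> = (\<lambda>vs. c * contract x \<beta> vs)"
    and same: "\<And>x. contract x (contract x \<beta>) = 0"
  shows "\<beta> \<in> alt_forms (Suc p)"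
proof (rule alt_formsI)
  have snoc: "\<beta> (ws @ [z]) = contract z \<beta> ws" for ws z by (simp add: contract_def)
  show "\<beta> vs = 0" if "length vs \<noteq> Suc p" for vs
    using that Nil by (cases vs rule: rev_cases) (auto simp: snoc alt_forms_length[OF alt])
  show "\<beta> (vs[i := x + y]) = \<beta> (vs[i := x]) + \<beta> (vs[i := y])" if "length vs = Suc p" "i < Suc p" for vs i x y
    using that by (cases vs rule: rev_cases; cases "i = p")
      (auto simp: snoc list_update_append add alt_forms_slot_add[OF alt])
  show "\<beta> (vs[i := c *s x]) = c * \<beta> (vs[i := x])" if "length vs = Suc p" "i < Suc p" for vs i c x
    using that by (cases vs rule: rev_cases; cases "i = p")
      (auto simp: snoc list_update_append scale alt_forms_slot_scale[OF alt])
  show "\<beta> vs = 0" if len: "length vs = Suc p" and nd: "\<not> distinct vs" for vs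
  proof -
    obtain ws z where vs: "vs = ws @ [z]" using len by (cases vs rule: rev_cases) auto
    show ?thesis
    proof (cases "distinct ws")
      case False then show ?thesis by (simp add: vs snoc alt_forms_distinct[OF alt])
    next
      case True
      then have "z \<in> set ws" using nd vs by auto
      then obtain us y where ws: "ws = us @ [y]" by (cases ws rule: rev_cases) auto
      have zero: "\<beta> (us' @ [z, z]) = 0" for us'
        using same[of z] by (simp add: contract_def fun_eq_iff)
      show ?thesis
      proof (cases "z = y")
        case True then show ?thesis using zero[of us] by (simp add: vs ws)
      next
        case False
        then obtain i where i: "i < length us" "us ! i = z"
          using \<open>z \<in> set ws\<close> ws by (auto simp: in_set_conv_nth nth_append split: if_splits)
        then have us: "us = us[i := z]" by auto
        have "contract z \<beta> (us[i := z] @ [y]) = - contract z \<beta> (us[i := y] @ [z])"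
          by (rule alt_forms_swap[OF alt i(1)])
        also have "\<dots> = 0" by (simp add: contract_def zero)
        finally show ?thesis unfolding vs ws snoc using us by simp
      qed
    qed
  qed
qed

lemma wedge_vec_alt_forms: "\<alpha> \<in> alt_forms p \<Longrightarrow> wedge_vec x \<alpha> \<in> alt_forms (Suc p)"
proof (induction p arbitrary: \<alpha>)
  case (0 \<alpha>)
  have c: "contract z (wedge_vec x \<alpha>) = (\<lambda>vs. \<omega> z x * \<alpha> vs)" for z
    by (simp add: contract_wedge_vec contract_degree_0[OF 0] fun_eq_iff)
  show ?case
    by (rule alt_forms_Suc)
      (simp_all add: c 0 alt_forms_scale \<omega>_linear distrib_right mult.assoc contract_scale contract_degree_0[OF 0] fun_eq_iff)
next
  case (Suc p \<alpha>)
  have c: "contract z (wedge_vec x \<alpha>) = (\<lambda>vs. \<omega> z x * \<alpha> vs) - wedge_vec x (contract z \<alpha>)" for z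
    by (simp add: contract_wedge_vec fun_eq_iff)
  have "wedge_vec x (contract z \<alpha>) \<in> alt_forms (Suc p)" for z
    using Suc.IH contract_alt_forms[OF Suc.prems] by simp
  then have alt: "contract z (wedge_vec x \<alpha>) \<in> alt_forms (Suc p)" for z
    unfolding c by (intro alt_forms_diff alt_forms_scale Suc.prems)
  have "contract z (contract z (wedge_vec x \<alpha>)) = 0" for z
  proof -
    have "contract z (contract z (wedge_vec x \<alpha>)) =
        contract z (\<lambda>vs. \<omega> z x * \<alpha> vs) - contract z (wedge_vec x (contract z \<alpha>))"
      unfolding c by (simp add: contract_def fun_eq_iff)
    then show ?thesis
      by (simp add: contract_wedge_vec contract_scale contract_same[OF Suc.prems] fun_eq_iff)
  qed
  then show ?case
    by (intro alt_forms_Suc alt)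
      (simp_all add: c \<omega>_linear contract_vec_add[OF Suc.prems] contract_vec_scale[OF Suc.prems]
         wedge_vec_add wedge_vec_scale distrib_right right_diff_distrib mult.assoc fun_eq_iff)
qed

lemma wedge_\<omega>_alt_forms: "\<alpha> \<in> alt_forms p \<Longrightarrow> wedge_\<omega> \<alpha> \<in> alt_forms (Suc (Suc p))"
proof (induction p arbitrary: \<alpha>)
  case (0 \<alpha>)
  have c: "contract z (wedge_\<omega> \<alpha>) = wedge_vec z \<alpha>" for z
    by (simp add: contract_wedge_\<omega> contract_degree_0[OF 0])
  show ?case
    by (rule alt_forms_Suc)
      (simp_all add: c wedge_vec_alt_forms[OF 0] wedge_vec_vec_add wedge_vec_vec_scale contract_wedge_vec alternating
         contract_degree_0[OF 0] fun_eq_iff)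
next
  case (Suc p \<alpha>)
  have c: "contract z (wedge_\<omega> \<alpha>) = wedge_\<omega> (contract z \<alpha>) + wedge_vec z \<alpha>" for z
    by (rule contract_wedge_\<omega>)
  have "wedge_\<omega> (contract z \<alpha>) \<in> alt_forms (Suc (Suc p))" for z
    using Suc.IH contract_alt_forms[OF Suc.prems] by simp
  then have alt: "contract z (wedge_\<omega> \<alpha>) \<in> alt_forms (Suc (Suc p))" for z
    unfolding c by (intro alt_forms_add wedge_vec_alt_forms Suc.prems)
  have same: "contract z (contract z (wedge_\<omega> \<alpha>)) = 0" for z
    by (simp add: c contract_add contract_wedge_\<omega> contract_wedge_vec contract_same[OF Suc.prems] alternating fun_eq_iff)
  show ?case
    by (intro alt_forms_Suc alt same)
      (simp_all add: c contract_vec_add[OF Suc.prems] contract_vec_scale[OF Suc.prems]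
         wedge_\<omega>_add wedge_\<omega>_scale wedge_vec_vec_add wedge_vec_vec_scale distrib_left fun_eq_iff)
qed

end

section \<open>Operators on polynomials with coefficients in forms\<close>

definition scale_poly :: "'k::field \<Rightarrow> ('k, 'v) form_poly \<Rightarrow> ('k, 'v) form_poly" where
  "scale_poly c F = (\<lambda>i j vs. c * F i j vs)"

lemma scale_poly_0 [simp]: "scale_poly c 0 = 0" "scale_poly 0 F = 0"
  and scale_poly_1 [simp]: "scale_poly 1 F = F"
  and scale_poly_scale_poly: "scale_poly c (scale_poly d F) = scale_poly (c * d) F"
  and scale_poly_add: "scale_poly c (F + G) = scale_poly c F + scale_poly c G"
  and scale_poly_diff: "scale_poly c (F - G) = scale_poly c F - scale_poly c G"
  and scale_poly_minus: "scale_poly c (- F) = - scale_poly c F"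
  by (simp_all add: scale_poly_def fun_eq_iff algebra_simps)

lemma scale_poly_minus_1: "scale_poly (- 1) F = - F"
  by (simp add: scale_poly_def fun_eq_iff)

lemma scale_poly_eq_0D: "scale_poly c F = 0 \<Longrightarrow> c \<noteq> 0 \<Longrightarrow> F = 0"
  by (simp add: scale_poly_def fun_eq_iff)

lemma numeral_fun: "(numeral w :: 'a \<Rightarrow> 'b::semiring_1) = (\<lambda>_. numeral w)"
  by (induction w) (simp_all add: numeral.simps fun_eq_iff one_fun_def)

text \<open>
  The simplifier collects \<open>F + F\<close> into a product of functions \<open>2 * F\<close>; this returns it to the
  scalar multiplication for which the operators are linear.
\<close>

lemma numeral_mult_poly: "numeral w * F = scale_poly (numeral w) F"
  by (simp add: scale_poly_def fun_eq_iff numeral_fun)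

lemma mult_lin:
  "mult_e1 0 = 0" "mult_e1 (F + G) = mult_e1 F + mult_e1 G" "mult_e1 (F - G) = mult_e1 F - mult_e1 G"
  "mult_e1 (- F) = - mult_e1 F" "mult_e1 (scale_poly c F) = scale_poly c (mult_e1 F)"
  "mult_e2 0 = 0" "mult_e2 (F + G) = mult_e2 F + mult_e2 G" "mult_e2 (F - G) = mult_e2 F - mult_e2 G"
  "mult_e2 (- F) = - mult_e2 F" "mult_e2 (scale_poly c F) = scale_poly c (mult_e2 F)"
  by (simp_all add: mult_e1_def mult_e2_def scale_poly_def fun_eq_iff)

lemma deriv_lin:
  "deriv_e1 0 = 0" "deriv_e1 (F + G) = deriv_e1 F + deriv_e1 G" "deriv_e1 (F - G) = deriv_e1 F - deriv_e1 G"
  "deriv_e1 (- F) = - deriv_e1 F" "deriv_e1 (scale_poly c F) = scale_poly c (deriv_e1 F)"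
  "deriv_e2 0 = 0" "deriv_e2 (F + G) = deriv_e2 F + deriv_e2 G" "deriv_e2 (F - G) = deriv_e2 F - deriv_e2 G"
  "deriv_e2 (- F) = - deriv_e2 F" "deriv_e2 (scale_poly c F) = scale_poly c (deriv_e2 F)"
  by (simp_all add: deriv_e1_def deriv_e2_def scale_poly_def fun_eq_iff algebra_simps)

lemma weyl:
  "deriv_e1 (mult_e1 F) = F + mult_e1 (deriv_e1 F)"
  "deriv_e2 (mult_e2 F) = F + mult_e2 (deriv_e2 F)"
  "deriv_e1 (mult_e2 F) = mult_e2 (deriv_e1 F)"
  "deriv_e2 (mult_e1 F) = mult_e1 (deriv_e2 F)"
  "mult_e2 (mult_e1 F) = mult_e1 (mult_e2 F)"
  "deriv_e2 (deriv_e1 F) = deriv_e1 (deriv_e2 F)"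
  by (auto simp: deriv_e1_def deriv_e2_def mult_e1_def mult_e2_def fun_eq_iff algebra_simps
      split: nat_diff_split)

lemma mult_e1_eq_0D: "mult_e1 F = 0 \<Longrightarrow> F = 0"
proof (intro ext)
  fix i j vs assume "mult_e1 F = 0"
  then have "mult_e1 F (Suc i) j vs = 0" by simp
  then show "F i j vs = 0 i j vs" by (simp add: mult_e1_def)
qed

context symplectic_space
begin

text \<open>
  By nondegeneracy the linear forms are the \<open>\<omega>(-, x)\<close>. Indexing multiplications by the vector \<open>x\<close>,
  as contractions are, makes all commutation relations depend on \<open>\<omega>\<close> only.
\<close>

definition iota :: "'v \<Rightarrow> ('k, 'v) form_poly \<Rightarrow> ('k, 'v) form_poly" where
  "iota x = map_form (contract x)"

definition eps :: "'v \<Rightarrow> ('k, 'v) form_poly \<Rightarrow> ('k, 'v) form_poly" where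
  "eps x = map_form (wedge_vec x)"

definition lef :: "('k, 'v) form_poly \<Rightarrow> ('k, 'v) form_poly" where
  "lef = map_form wedge_\<omega>"

definition form_polys :: "nat \<Rightarrow> nat \<Rightarrow> ('k, 'v) form_poly set" where
  "form_polys p q = {F. \<forall>i j. F i j \<in> alt_forms p \<and> (i + j \<noteq> q \<longrightarrow> F i j = 0)}"

text \<open>
  The degree is existentially quantified so that the simplifier can discharge the side condition of
  \<open>iota_swap\<close> without tracking degrees through composites.
\<close>

definition alternating_poly :: "('k, 'v) form_poly \<Rightarrow> bool" where
  "alternating_poly F \<longleftrightarrow> (\<exists>p. \<forall>i j. F i j \<in> alt_forms p)"

lemma form_polys_alternating: "F \<in> form_polys p q \<Longrightarrow> alternating_poly F"
  by (auto simp: form_polys_def alternating_poly_def)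

lemma alternating_poly_ops [simp]:
  assumes "alternating_poly F"
  shows "alternating_poly (mult_e1 F)" "alternating_poly (mult_e2 F)"
    "alternating_poly (deriv_e1 F)" "alternating_poly (deriv_e2 F)"
    "alternating_poly (scale_poly c F)" "alternating_poly (iota x F)"
    "alternating_poly (eps x F)" "alternating_poly (lef F)"
proof -
  from assms obtain p where p: "\<And>i j. F i j \<in> alt_forms p" by (auto simp: alternating_poly_def)
  show "alternating_poly (mult_e1 F)" "alternating_poly (mult_e2 F)"
    "alternating_poly (deriv_e1 F)" "alternating_poly (deriv_e2 F)" "alternating_poly (scale_poly c F)"
    unfolding alternating_poly_def using p
    by (auto intro!: exI[of _ p] alt_forms_scale
        simp: mult_e1_def mult_e2_def deriv_e1_def deriv_e2_def scale_poly_def simp del: of_nat_add of_nat_Suc)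
  show "alternating_poly (iota x F)" "alternating_poly (eps x F)" "alternating_poly (lef F)"
    unfolding alternating_poly_def iota_def eps_def lef_def map_form_def
    using contract_alt_forms[OF p] wedge_vec_alt_forms[OF p] wedge_\<omega>_alt_forms[OF p] by blast+
qed

lemma form_polys_zero [simp]: "0 \<in> form_polys p q"
  by (simp add: form_polys_def)

lemma form_polys_add: "F \<in> form_polys p q \<Longrightarrow> G \<in> form_polys p q \<Longrightarrow> F + G \<in> form_polys p q"
  and form_polys_diff: "F \<in> form_polys p q \<Longrightarrow> G \<in> form_polys p q \<Longrightarrow> F - G \<in> form_polys p q"
  by (simp_all add: form_polys_def alt_forms_add alt_forms_diff)

lemma form_polys_scale: "F \<in> form_polys p q \<Longrightarrow> scale_poly c F \<in> form_polys p q"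
  by (simp add: form_polys_def scale_poly_def alt_forms_scale fun_eq_iff)

lemma form_polys_iota: "F \<in> form_polys p q \<Longrightarrow> iota x F \<in> form_polys (p - 1) q"
  using contract_alt_forms by (fastforce simp: form_polys_def iota_def map_form_def)

lemma form_polys_eps: "F \<in> form_polys p q \<Longrightarrow> eps x F \<in> form_polys (Suc p) q"
  by (simp add: form_polys_def eps_def map_form_def wedge_vec_alt_forms)

lemma form_polys_lef: "F \<in> form_polys p q \<Longrightarrow> lef F \<in> form_polys (Suc (Suc p)) q"
  by (simp add: form_polys_def lef_def map_form_def wedge_\<omega>_alt_forms)

lemma form_polys_mult:
  assumes "F \<in> form_polys p q"
  shows "mult_e1 F \<in> form_polys p (Suc q)" "mult_e2 F \<in> form_polys p (Suc q)"
  using assms by (auto simp: form_polys_def mult_e1_def mult_e2_def)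

lemma form_polys_deriv:
  assumes "F \<in> form_polys p q"
  shows "deriv_e1 F \<in> form_polys p (q - 1)" "deriv_e2 F \<in> form_polys p (q - 1)"
  using assms by (auto simp: form_polys_def deriv_e1_def deriv_e2_def fun_eq_iff
      intro!: alt_forms_scale simp del: of_nat_add of_nat_Suc)

lemma iota_degree_0: "F \<in> form_polys 0 q \<Longrightarrow> iota x F = 0"
  by (simp add: form_polys_def iota_def map_form_def fun_eq_iff contract_degree_0)

lemma deriv_degree_0:
  assumes "F \<in> form_polys p 0" shows "deriv_e1 F = 0" "deriv_e2 F = 0"
  using assms by (auto simp: form_polys_def deriv_e1_def deriv_e2_def fun_eq_iff)

text \<open>Euler's identity, oriented as a rewrite rule that eliminates \<open>e\<^sub>2 \<partial>\<^sub>2\<close>.\<close>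

lemma euler:
  assumes "F \<in> form_polys p q"
  shows "mult_e2 (deriv_e2 F) = scale_poly (of_nat q) F - mult_e1 (deriv_e1 F)"
proof (intro ext)
  fix i j vs
  have "F i j vs = 0" if "i + j \<noteq> q" using assms that by (simp add: form_polys_def)
  then show "mult_e2 (deriv_e2 F) i j vs = (scale_poly (of_nat q) F - mult_e1 (deriv_e1 F)) i j vs"
    by (cases "i + j = q"; cases i; cases j)
      (auto simp: mult_e1_def mult_e2_def deriv_e1_def deriv_e2_def scale_poly_def algebra_simps)
qed

lemma iota_lin:
  "iota x 0 = 0" "iota x (F + G) = iota x F + iota x G" "iota x (F - G) = iota x F - iota x G"
  "iota x (- F) = - iota x F" "iota x (scale_poly c F) = scale_poly c (iota x F)"
  by (simp_all add: iota_def map_form_def contract_def scale_poly_def fun_eq_iff)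

lemma eps_lin:
  "eps x 0 = 0" "eps x (F + G) = eps x F + eps x G" "eps x (F - G) = eps x F - eps x G"
  "eps x (- F) = - eps x F" "eps x (scale_poly c F) = scale_poly c (eps x F)"
proof -
  show 0: "eps x 0 = 0" and "eps x (scale_poly c F) = scale_poly c (eps x F)"
    by (simp_all add: eps_def map_form_def wedge_vec_scale scale_poly_def fun_eq_iff)
  show add: "eps x (F + G) = eps x F + eps x G" for F G
    by (simp add: eps_def map_form_def wedge_vec_add fun_eq_iff)
  show "eps x (F - G) = eps x F - eps x G" using add[of "F - G" G] by simp
  show "eps x (- F) = - eps x F" using add[of "- F" F] by (simp add: 0 eq_neg_iff_add_eq_0)
qed

lemma lef_lin:
  "lef 0 = 0" "lef (F + G) = lef F + lef G" "lef (F - G) = lef F - lef G"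
  "lef (- F) = - lef F" "lef (scale_poly c F) = scale_poly c (lef F)"
proof -
  show 0: "lef 0 = 0" and "lef (scale_poly c F) = scale_poly c (lef F)"
    by (simp_all add: lef_def map_form_def wedge_\<omega>_scale scale_poly_def fun_eq_iff)
  show add: "lef (F + G) = lef F + lef G" for F G
    by (simp add: lef_def map_form_def wedge_\<omega>_add fun_eq_iff)
  show "lef (F - G) = lef F - lef G" using add[of "F - G" G] by simp
  show "lef (- F) = - lef F" using add[of "- F" F] by (simp add: 0 eq_neg_iff_add_eq_0)
qed

lemma form_ops_past_poly_ops:
  "mult_e1 (iota x F) = iota x (mult_e1 F)" "mult_e2 (iota x F) = iota x (mult_e2 F)"
  "deriv_e1 (iota x F) = iota x (deriv_e1 F)" "deriv_e2 (iota x F) = iota x (deriv_e2 F)"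
  "mult_e1 (eps x F) = eps x (mult_e1 F)" "mult_e2 (eps x F) = eps x (mult_e2 F)"
  "deriv_e1 (eps x F) = eps x (deriv_e1 F)" "deriv_e2 (eps x F) = eps x (deriv_e2 F)"
  "mult_e1 (lef F) = lef (mult_e1 F)" "mult_e2 (lef F) = lef (mult_e2 F)"
  "deriv_e1 (lef F) = lef (deriv_e1 F)" "deriv_e2 (lef F) = lef (deriv_e2 F)"
  by (simp_all add: iota_def eps_def lef_def map_form_def mult_e1_def mult_e2_def deriv_e1_def deriv_e2_def
      contract_scale wedge_vec_scale wedge_\<omega>_scale fun_eq_iff contract_zero[unfolded zero_fun_def]
      del: of_nat_add of_nat_Suc)

lemma iota_eps: "iota x (eps y F) = scale_poly (\<omega> x y) F - eps y (iota x F)"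
  by (simp add: iota_def eps_def map_form_def scale_poly_def contract_wedge_vec fun_eq_iff)

lemma iota_lef: "iota x (lef F) = lef (iota x F) + eps x F"
  by (simp add: iota_def eps_def lef_def map_form_def contract_wedge_\<omega> fun_eq_iff)

lemma eps_lef: "eps x (lef F) = lef (eps x F)"
  by (simp add: eps_def lef_def map_form_def wedge_vec_wedge_\<omega>)

lemma eps_swap: "eps x (eps y F) = - eps y (eps x F)"
  by (simp add: eps_def map_form_def fun_eq_iff wedge_vec_anticommute[of x y])

lemma iota_swap: "alternating_poly F \<Longrightarrow> iota x (iota y F) = - iota y (iota x F)"
  unfolding alternating_poly_def using contract_anticommute[of _ _ x y]
  by (auto simp: iota_def map_form_def fun_eq_iff)

lemma iota_same: "alternating_poly F \<Longrightarrow> iota x (iota x F) = 0"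
  unfolding alternating_poly_def using contract_same by (fastforce simp: iota_def map_form_def fun_eq_iff)

lemma iota_vec_add: "alternating_poly F \<Longrightarrow> iota (x + y) F = iota x F + iota y F"
  unfolding alternating_poly_def using contract_vec_add by (fastforce simp: iota_def map_form_def fun_eq_iff)

lemma iota_vec_scale: "alternating_poly F \<Longrightarrow> iota (c *s x) F = scale_poly c (iota x F)"
  unfolding alternating_poly_def using contract_vec_scale
  by (fastforce simp: iota_def map_form_def scale_poly_def fun_eq_iff)

lemma eps_vec_add: "eps (x + y) F = eps x F + eps y F"
  and eps_vec_scale: "eps (c *s x) F = scale_poly c (eps x F)"
  by (simp_all add: eps_def map_form_def wedge_vec_vec_add wedge_vec_vec_scale scale_poly_def fun_eq_iff)

lemma iota_vec_minus: "alternating_poly F \<Longrightarrow> iota (- x) F = - iota x F"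
  using iota_vec_scale[of F "- 1" x] by (simp add: scale_poly_minus_1)

lemma eps_vec_minus: "eps (- x) F = - eps x F"
  using eps_vec_scale[of "- 1" x F] by (simp add: scale_poly_minus_1)

text \<open>
  Rewriting with these rules brings a composite to normal form: \<open>lef\<close> outermost, then \<open>eps\<close>, \<open>iota\<close>,
  multiplications by \<open>e\<^sub>i\<close> and derivations \<open>\<partial>\<^sub>i\<close>. The order among several \<open>eps\<close> or \<open>iota\<close> is
  fixed by instances of \<open>eps_swap\<close> and \<open>iota_swap\<close> given to each proof.
\<close>

lemmas op_lin = mult_lin deriv_lin iota_lin eps_lin lef_lin
  scale_poly_add scale_poly_diff scale_poly_minus scale_poly_scale_poly

lemmas op_comm = form_ops_past_poly_ops weyl iota_eps iota_lef eps_lef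

lemma eps_same: "(eps x (eps x F) :: ('k, 'v) form_poly) = 0" if "(2 :: 'k) \<noteq> 0"
proof -
  have "eps x (eps x F) i j vs = - eps x (eps x F) i j vs" for i j vs
    by (subst eps_swap) simp
  then have "2 * eps x (eps x F) i j vs = 0" for i j vs
    by (metis add.left_inverse mult_2)
  then show ?thesis using that by (simp add: fun_eq_iff)
qed

end

section \<open>Koszul and de Rham operators\<close>

locale symplectic_char_0 = symplectic_space scale \<omega>
  for scale :: "'k::field_char_0 \<Rightarrow> 'v::ab_group_add \<Rightarrow> 'v" (infixr \<open>*s\<close> 75)
    and \<omega> :: "'v \<Rightarrow> 'v \<Rightarrow> 'k"
begin

lemma eps_same_0 [simp]: "eps x (eps x F) = 0"
  by (rule eps_same) simp

text \<open>
  \<open>exd\<close> is the exterior differential when \<open>\<omega>(-, u\<^sub>i)\<close> is read as the differential of \<open>e\<^sub>i\<close>, and \<open>kos\<close>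
  is contraction with an Euler vector field; \<open>num\<close> counts factors \<open>\<omega>(-, u\<^sub>i)\<close> when \<open>v\<^sub>1, v\<^sub>2\<close> is dual
  to \<open>u\<^sub>1, u\<^sub>2\<close>. Two different choices of the vectors matter. For a frame \<open>x, y\<close>, \<open>exd x y\<close> is \<open>d\<^sub>2\<close> and
  \<open>con x y\<close> is the contraction in \<open>d\<^sub>1\<close>, whereas \<open>d\<^sub>0\<close> is \<open>kos (- y) x\<close>.
\<close>

definition exd :: "'v \<Rightarrow> 'v \<Rightarrow> ('k, 'v) form_poly \<Rightarrow> ('k, 'v) form_poly" where
  "exd u\<^sub>1 u\<^sub>2 F = eps u\<^sub>1 (deriv_e1 F) + eps u\<^sub>2 (deriv_e2 F)"

definition kos :: "'v \<Rightarrow> 'v \<Rightarrow> ('k, 'v) form_poly \<Rightarrow> ('k, 'v) form_poly" where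
  "kos v\<^sub>1 v\<^sub>2 F = iota v\<^sub>1 (mult_e1 F) + iota v\<^sub>2 (mult_e2 F)"

definition con :: "'v \<Rightarrow> 'v \<Rightarrow> ('k, 'v) form_poly \<Rightarrow> ('k, 'v) form_poly" where
  "con v\<^sub>1 v\<^sub>2 F = iota v\<^sub>1 (deriv_e1 F) + iota v\<^sub>2 (deriv_e2 F)"

definition num :: "'v \<Rightarrow> 'v \<Rightarrow> 'v \<Rightarrow> 'v \<Rightarrow> ('k, 'v) form_poly \<Rightarrow> ('k, 'v) form_poly" where
  "num u\<^sub>1 u\<^sub>2 v\<^sub>1 v\<^sub>2 F = eps u\<^sub>1 (iota v\<^sub>1 F) + eps u\<^sub>2 (iota v\<^sub>2 F)"

lemmas op_defs = exd_def kos_def con_def num_def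

lemma d0_eq: "d0 (x, y) F = iota x (mult_e2 F) - iota y (mult_e1 F)"
  by (simp add: d0_def iota_def)

lemma d0_kos: "alternating_poly F \<Longrightarrow> d0 (x, y) F = kos (- y) x F"
  by (simp add: d0_eq kos_def iota_vec_minus)

lemma d1_eq: "d1 (x, y) F = lef (con x y F)"
proof -
  have "d1 (x, y) F = lef (iota x (deriv_e1 F)) + lef (iota y (deriv_e2 F))"
    by (simp add: d1_def lef_def iota_def map_form_def wedge_\<omega>_def)
  then show ?thesis by (simp add: con_def lef_lin)
qed

lemma d2_eq: "d2 (x, y) F = exd x y F"
  by (simp add: d2_def exd_def eps_def map_form_def wedge_vec_def)

lemma exd_exd: "exd u\<^sub>1 u\<^sub>2 (exd u\<^sub>1 u\<^sub>2 F) = 0"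
  by (simp add: op_defs op_lin op_comm eps_swap[of u\<^sub>2 u\<^sub>1])

lemma con_con: "alternating_poly F \<Longrightarrow> con v\<^sub>1 v\<^sub>2 (con v\<^sub>1 v\<^sub>2 F) = 0"
  by (simp add: op_defs op_lin op_comm iota_swap[of _ v\<^sub>2 v\<^sub>1] iota_same)

lemma con_lef: "con x y (lef F) = lef (con x y F) + exd x y F"
  by (simp add: op_defs op_lin op_comm)

lemma con_exd:
  assumes "\<omega> x y = 0"
  shows "con x y (exd x y F) = - exd x y (con x y F)"
  using assms \<omega>_skew[of x y] by (simp add: op_defs op_lin op_comm alternating)

lemma exd_lef: "exd u\<^sub>1 u\<^sub>2 (lef F) = lef (exd u\<^sub>1 u\<^sub>2 F)"
  by (simp add: op_defs op_lin op_comm)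

lemma op_lin_1:
  "exd u\<^sub>1 u\<^sub>2 0 = 0" "exd u\<^sub>1 u\<^sub>2 (F + G) = exd u\<^sub>1 u\<^sub>2 F + exd u\<^sub>1 u\<^sub>2 G"
  "exd u\<^sub>1 u\<^sub>2 (F - G) = exd u\<^sub>1 u\<^sub>2 F - exd u\<^sub>1 u\<^sub>2 G" "exd u\<^sub>1 u\<^sub>2 (- F) = - exd u\<^sub>1 u\<^sub>2 F"
  "exd u\<^sub>1 u\<^sub>2 (scale_poly c F) = scale_poly c (exd u\<^sub>1 u\<^sub>2 F)"
  "kos v\<^sub>1 v\<^sub>2 0 = 0" "kos v\<^sub>1 v\<^sub>2 (F + G) = kos v\<^sub>1 v\<^sub>2 F + kos v\<^sub>1 v\<^sub>2 G"
  "kos v\<^sub>1 v\<^sub>2 (F - G) = kos v\<^sub>1 v\<^sub>2 F - kos v\<^sub>1 v\<^sub>2 G" "kos v\<^sub>1 v\<^sub>2 (- F) = - kos v\<^sub>1 v\<^sub>2 F"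
  "kos v\<^sub>1 v\<^sub>2 (scale_poly c F) = scale_poly c (kos v\<^sub>1 v\<^sub>2 F)"
  "con v\<^sub>1 v\<^sub>2 0 = 0" "con v\<^sub>1 v\<^sub>2 (F + G) = con v\<^sub>1 v\<^sub>2 F + con v\<^sub>1 v\<^sub>2 G"
  "con v\<^sub>1 v\<^sub>2 (F - G) = con v\<^sub>1 v\<^sub>2 F - con v\<^sub>1 v\<^sub>2 G" "con v\<^sub>1 v\<^sub>2 (- F) = - con v\<^sub>1 v\<^sub>2 F"
  "con v\<^sub>1 v\<^sub>2 (scale_poly c F) = scale_poly c (con v\<^sub>1 v\<^sub>2 F)"
  "num u\<^sub>1 u\<^sub>2 v\<^sub>1 v\<^sub>2 0 = 0" "num u\<^sub>1 u\<^sub>2 v\<^sub>1 v\<^sub>2 (F + G) = num u\<^sub>1 u\<^sub>2 v\<^sub>1 v\<^sub>2 F + num u\<^sub>1 u\<^sub>2 v\<^sub>1 v\<^sub>2 G"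
  "num u\<^sub>1 u\<^sub>2 v\<^sub>1 v\<^sub>2 (F - G) = num u\<^sub>1 u\<^sub>2 v\<^sub>1 v\<^sub>2 F - num u\<^sub>1 u\<^sub>2 v\<^sub>1 v\<^sub>2 G"
  "num u\<^sub>1 u\<^sub>2 v\<^sub>1 v\<^sub>2 (- F) = - num u\<^sub>1 u\<^sub>2 v\<^sub>1 v\<^sub>2 F"
  "num u\<^sub>1 u\<^sub>2 v\<^sub>1 v\<^sub>2 (scale_poly c F) = scale_poly c (num u\<^sub>1 u\<^sub>2 v\<^sub>1 v\<^sub>2 F)"
  by (simp_all add: op_defs op_lin)

lemma d0_con:
  assumes F: "F \<in> form_polys p q"
  shows "d0 (x, y) (con x y F) = scale_poly (of_nat q) (iota x (iota y F))"
    and "con x y (d0 (x, y) F) = scale_poly (- of_nat (q + 2)) (iota x (iota y F))"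
  using form_polys_alternating[OF F]
  by (simp_all add: d0_eq op_defs op_lin op_comm iota_same iota_swap[of _ y x] euler[OF F])
     (simp_all add: scale_poly_def fun_eq_iff algebra_simps)

lemma d0_d0:
  assumes F: "alternating_poly F"
  shows "d0 (x, y) (d0 (x, y) F) = 0"
  using F by (simp add: d0_eq op_defs op_lin op_comm iota_same iota_swap[of _ y x])

text \<open>
  Write \<open>C\<close>, \<open>D\<close>, \<open>L\<close> for \<open>con\<close>, \<open>exd\<close>, \<open>lef\<close>. On an isotropic plane \<open>C\<^sup>2 = D\<^sup>2 = 0\<close>, \<open>C L = L C + D\<close>,
  \<open>C D = - D C\<close> and \<open>D L = L D\<close>, whence \<open>(b L C + D) (a L C + D) = (b a - b + a) L D C\<close>. The coefficient
  vanishes if \<open>1 / a = 1 / b + 1\<close>.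
\<close>

lemma horizontal_square_zero:
  assumes F: "F \<in> form_polys p q" and q: "q \<ge> 2" and isotropic: "\<omega> x y = 0"
  defines "H \<equiv> \<lambda>k F. scale_poly (1 / of_nat (k + 1)) (d1 (x, y) F) + d2 (x, y) F"
  shows "H (q - 1) (H q F) = 0"
proof -
  have alt: "alternating_poly F" by (rule form_polys_alternating[OF F])
  define a b :: 'k where "a = 1 / of_nat (q + 1)" and "b = 1 / of_nat q"
  have ab: "b * a - b + a = 0"
    using q by (simp add: a_def b_def divide_simps) (metis of_nat_Suc of_nat_eq_0_iff nat.distinct(1))
  have H: "H q G = scale_poly a (d1 (x, y) G) + d2 (x, y) G" "H (q - 1) G = scale_poly b (d1 (x, y) G) + d2 (x, y) G" for G
    using q by (simp_all add: H_def a_def b_def)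
  have "H (q - 1) (H q F) = scale_poly (b * a - b + a) (lef (exd x y (con x y F)))"
    unfolding H by (simp add: d1_eq d2_eq op_lin_1 op_lin con_lef con_con alt con_exd isotropic exd_lef exd_exd)
      (simp add: scale_poly_def fun_eq_iff algebra_simps)
  then show ?thesis by (simp add: ab)
qed

lemma d0_lef: "d0 (x, y) (lef F) = lef (d0 (x, y) F) + (eps x (mult_e2 F) - eps y (mult_e1 F))"
  by (simp add: d0_eq op_lin op_comm)

text \<open>
  With \<open>J = iota x iota y\<close> on polynomials of degree \<open>q\<close>, the weights \<open>1 / (q (q + 1))\<close> absorb the factors
  in \<open>d\<^sub>0 C = q J\<close> and \<open>C d\<^sub>0 = - (q + 2) J\<close>, and the terms without \<open>L J\<close> cancel by
  \<open>[d\<^sub>0, L] C + (q + 1) d\<^sub>0 D + q D d\<^sub>0 = 0\<close>, a consequence of Euler's identity.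
\<close>

lemma horizontal_vertical_commute:
  assumes F: "F \<in> form_polys p q" and q: "q \<ge> 1" and isotropic: "\<omega> x y = 0"
  defines "H \<equiv> \<lambda>k F. scale_poly (1 / of_nat k) (scale_poly (1 / of_nat (k + 1)) (d1 (x, y) F) + d2 (x, y) F)"
  shows "H (q + 1) (d0 (x, y) F) = - d0 (x, y) (H q F)"
proof -
  have alt: "alternating_poly F" by (rule form_polys_alternating[OF F])
  have d0_lin: "d0 (x, y) (F + G) = d0 (x, y) F + d0 (x, y) G" "d0 (x, y) (scale_poly c F) = scale_poly c (d0 (x, y) F)" for F G c
    by (simp_all add: d0_eq op_lin)
  let ?P = "eps x (mult_e2 (con x y F)) - eps y (mult_e1 (con x y F))"
  have 1: "?P + scale_poly (of_nat (q + 1)) (d0 (x, y) (exd x y F)) + scale_poly (of_nat q) (exd x y (d0 (x, y) F)) = 0"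
    using alt isotropic \<omega>_skew[of x y]
    by (simp add: d0_eq op_defs op_lin op_comm euler[OF F] alternating)
      (simp add: scale_poly_def fun_eq_iff algebra_simps)
  then have 2: "?P = - scale_poly (of_nat (q + 1)) (d0 (x, y) (exd x y F)) - scale_poly (of_nat q) (exd x y (d0 (x, y) F))"
    by (simp add: algebra_simps eq_neg_iff_add_eq_0)
  define Q a b c :: 'k where "Q = of_nat q" and "a = 1 / of_nat q" and "b = 1 / of_nat (q + 1)" and "c = 1 / of_nat (q + 2)"
  have nz: "a * Q = 1" "b * (Q + 1) = 1" "c * (Q + 2) = 1"
    using q of_nat_neq_0[of "q", where 'a = 'k] of_nat_neq_0[of "Suc q", where 'a = 'k]
    by (simp_all add: a_def b_def c_def Q_def divide_simps add_ac)
  have H: "H q G = scale_poly a (scale_poly b (d1 (x, y) G) + d2 (x, y) G)"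
    "H (q + 1) G = scale_poly b (scale_poly c (d1 (x, y) G) + d2 (x, y) G)" for G
    by (simp_all add: H_def a_def b_def c_def add_ac)
  have q_eqs: "of_nat (q + 1) = Q + 1" "- of_nat (q + 2) = - (Q + 2)" "of_nat q = Q" by (simp_all add: Q_def)
  have "H (q + 1) (d0 (x, y) F) + d0 (x, y) (H q F) =
      scale_poly (b * (a * Q) - b * (c * (Q + 2))) (lef (iota x (iota y F))) +
      scale_poly (b - b * (a * Q)) (exd x y (d0 (x, y) F)) +
      scale_poly (a - a * (b * (Q + 1))) (d0 (x, y) (exd x y F))"
    unfolding H d1_eq d2_eq op_lin_1 op_lin d0_lin d0_lef d0_con[OF F] 2 q_eqs
    by (simp add: scale_poly_def fun_eq_iff algebra_simps)
  then show ?thesis by (simp add: nz eq_neg_iff_add_eq_0)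
qed

context
  fixes u\<^sub>1 u\<^sub>2 v\<^sub>1 v\<^sub>2
  assumes dual: "\<omega> v\<^sub>1 u\<^sub>1 = 1" "\<omega> v\<^sub>1 u\<^sub>2 = 0" "\<omega> v\<^sub>2 u\<^sub>1 = 0" "\<omega> v\<^sub>2 u\<^sub>2 = 1"
begin

text \<open>
  Cartan's formula for the Lie derivative along the Euler vector field: it counts polynomial degree
  and factors \<open>\<omega>(-, u\<^sub>i)\<close>.
\<close>

lemma kos_exd:
  assumes F: "F \<in> form_polys p q"
  shows "kos v\<^sub>1 v\<^sub>2 (exd u\<^sub>1 u\<^sub>2 F) + exd u\<^sub>1 u\<^sub>2 (kos v\<^sub>1 v\<^sub>2 F) = scale_poly (of_nat q) F + num u\<^sub>1 u\<^sub>2 v\<^sub>1 v\<^sub>2 F"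
  by (simp add: dual op_defs op_lin op_comm euler[OF F])

lemma kos_num: "alternating_poly F \<Longrightarrow> kos v\<^sub>1 v\<^sub>2 (num u\<^sub>1 u\<^sub>2 v\<^sub>1 v\<^sub>2 F) = num u\<^sub>1 u\<^sub>2 v\<^sub>1 v\<^sub>2 (kos v\<^sub>1 v\<^sub>2 F) + kos v\<^sub>1 v\<^sub>2 F"
  by (simp add: dual op_defs op_lin op_comm iota_swap[of _ v\<^sub>2 v\<^sub>1] iota_same)

lemma exd_num: "exd u\<^sub>1 u\<^sub>2 (num u\<^sub>1 u\<^sub>2 v\<^sub>1 v\<^sub>2 F) = num u\<^sub>1 u\<^sub>2 v\<^sub>1 v\<^sub>2 (exd u\<^sub>1 u\<^sub>2 F) - exd u\<^sub>1 u\<^sub>2 F"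
  by (simp add: dual op_defs op_lin op_comm eps_swap[of u\<^sub>2 u\<^sub>1])

text \<open>\<open>num\<close> is a sum of two commuting idempotents.\<close>

lemma num_cubic:
  assumes "alternating_poly F"
  shows "num u\<^sub>1 u\<^sub>2 v\<^sub>1 v\<^sub>2 (num u\<^sub>1 u\<^sub>2 v\<^sub>1 v\<^sub>2 (num u\<^sub>1 u\<^sub>2 v\<^sub>1 v\<^sub>2 F)) =
    scale_poly 3 (num u\<^sub>1 u\<^sub>2 v\<^sub>1 v\<^sub>2 (num u\<^sub>1 u\<^sub>2 v\<^sub>1 v\<^sub>2 F)) - scale_poly 2 (num u\<^sub>1 u\<^sub>2 v\<^sub>1 v\<^sub>2 F)"
  using assms
  by (simp add: dual num_def op_lin op_comm eps_swap[of u\<^sub>2 u\<^sub>1] iota_swap[of _ v\<^sub>2 v\<^sub>1] iota_same numeral_mult_poly)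
    (simp add: scale_poly_def fun_eq_iff algebra_simps)

end

end

context symplectic_char_0
begin

lemma form_polys_exd: "F \<in> form_polys p q \<Longrightarrow> exd u\<^sub>1 u\<^sub>2 F \<in> form_polys (Suc p) (q - 1)"
  unfolding exd_def by (intro form_polys_add form_polys_eps form_polys_deriv)

lemma form_polys_kos: "F \<in> form_polys p q \<Longrightarrow> kos v\<^sub>1 v\<^sub>2 F \<in> form_polys (p - 1) (Suc q)"
  unfolding kos_def by (intro form_polys_add form_polys_iota form_polys_mult)

lemma form_polys_con: "F \<in> form_polys p q \<Longrightarrow> con v\<^sub>1 v\<^sub>2 F \<in> form_polys (p - 1) (q - 1)"
  unfolding con_def by (intro form_polys_add form_polys_iota form_polys_deriv)

lemma form_polys_num: assumes "F \<in> form_polys p q" shows "num u\<^sub>1 u\<^sub>2 v\<^sub>1 v\<^sub>2 F \<in> form_polys p q"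
proof (cases p)
  case 0
  then show ?thesis using assms by (simp add: num_def iota_degree_0 eps_lin)
next
  case (Suc p')
  then have "iota v F \<in> form_polys p' q" for v using form_polys_iota[OF assms] by simp
  then show ?thesis by (simp add: Suc num_def form_polys_add form_polys_eps)
qed

text \<open>
  On the kernel of one of two adjoint operators with \<open>kos exd + exd kos = q + num\<close> the map
  \<open>q + num\<close> is a composite of both. It is inverted by dividing \<open>x (x - 1) (x - 2)\<close>, which
  annihilates \<open>num\<close>, by \<open>x + q\<close>: the quotient is \<open>resolvent\<close>, the remainder is
  \<open>- q (q + 1) (q + 2)\<close>.
\<close>

definition resolvent :: "nat \<Rightarrow> 'v \<Rightarrow> 'v \<Rightarrow> 'v \<Rightarrow> 'v \<Rightarrow> ('k, 'v) form_poly \<Rightarrow> ('k, 'v) form_poly" where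
  "resolvent q u\<^sub>1 u\<^sub>2 v\<^sub>1 v\<^sub>2 F =
    num u\<^sub>1 u\<^sub>2 v\<^sub>1 v\<^sub>2 (num u\<^sub>1 u\<^sub>2 v\<^sub>1 v\<^sub>2 F) - scale_poly (of_nat (q + 3)) (num u\<^sub>1 u\<^sub>2 v\<^sub>1 v\<^sub>2 F) +
    scale_poly (of_nat ((q + 1) * (q + 2))) F"

lemma form_polys_resolvent: "F \<in> form_polys p q \<Longrightarrow> resolvent k u\<^sub>1 u\<^sub>2 v\<^sub>1 v\<^sub>2 F \<in> form_polys p q"
  unfolding resolvent_def by (intro form_polys_add form_polys_diff form_polys_scale form_polys_num)

context
  fixes u\<^sub>1 u\<^sub>2 v\<^sub>1 v\<^sub>2
  assumes dual: "\<omega> v\<^sub>1 u\<^sub>1 = 1" "\<omega> v\<^sub>1 u\<^sub>2 = 0" "\<omega> v\<^sub>2 u\<^sub>1 = 0" "\<omega> v\<^sub>2 u\<^sub>2 = 1"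
begin

lemma num_resolvent:
  assumes "alternating_poly F"
  shows "scale_poly (of_nat q) (resolvent q u\<^sub>1 u\<^sub>2 v\<^sub>1 v\<^sub>2 F) + num u\<^sub>1 u\<^sub>2 v\<^sub>1 v\<^sub>2 (resolvent q u\<^sub>1 u\<^sub>2 v\<^sub>1 v\<^sub>2 F) =
    scale_poly (of_nat (q * (q + 1) * (q + 2))) F"
  by (simp add: resolvent_def op_lin_1 num_cubic[OF dual assms])
    (simp add: scale_poly_def fun_eq_iff algebra_simps)

lemma kos_exact:
  assumes F: "F \<in> form_polys p q" and zero: "kos v\<^sub>1 v\<^sub>2 F = 0"
  shows "kos v\<^sub>1 v\<^sub>2 (exd u\<^sub>1 u\<^sub>2 (resolvent q u\<^sub>1 u\<^sub>2 v\<^sub>1 v\<^sub>2 F)) = scale_poly (of_nat (q * (q + 1) * (q + 2))) F"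
proof -
  have alt: "alternating_poly F" "alternating_poly (num u\<^sub>1 u\<^sub>2 v\<^sub>1 v\<^sub>2 F)"
    using F form_polys_num[OF F] by (blast intro: form_polys_alternating)+
  have "kos v\<^sub>1 v\<^sub>2 (resolvent q u\<^sub>1 u\<^sub>2 v\<^sub>1 v\<^sub>2 F) = 0"
    by (simp add: resolvent_def op_lin_1 kos_num[OF dual] alt zero)
  then show ?thesis
    using kos_exd[OF dual form_polys_resolvent[OF F, of q u\<^sub>1 u\<^sub>2 v\<^sub>1 v\<^sub>2]] num_resolvent[OF alt(1), of q]
    by (simp add: op_lin_1 del: of_nat_mult of_nat_add)
qed

lemma exd_exact:
  assumes F: "F \<in> form_polys p q" and zero: "exd u\<^sub>1 u\<^sub>2 F = 0"
  shows "exd u\<^sub>1 u\<^sub>2 (kos v\<^sub>1 v\<^sub>2 (resolvent q u\<^sub>1 u\<^sub>2 v\<^sub>1 v\<^sub>2 F)) = scale_poly (of_nat (q * (q + 1) * (q + 2))) F"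
proof -
  have alt: "alternating_poly F" using F by (rule form_polys_alternating)
  have "exd u\<^sub>1 u\<^sub>2 (resolvent q u\<^sub>1 u\<^sub>2 v\<^sub>1 v\<^sub>2 F) = 0"
    by (simp add: resolvent_def op_lin_1 exd_num[OF dual] zero)
  then show ?thesis
    using kos_exd[OF dual form_polys_resolvent[OF F, of q u\<^sub>1 u\<^sub>2 v\<^sub>1 v\<^sub>2]] num_resolvent[OF alt, of q]
    by (simp add: op_lin_1 del: of_nat_mult of_nat_add)
qed

end

subsection \<open>Splitting off the isotropic plane\<close>

text \<open>
  Here \<open>x, y\<close> span \<open>U\<close>, and \<open>g, h\<close> span a second isotropic plane \<open>U'\<close>, in which they are dual to \<open>x, y\<close>. The
  orthogonal complement \<open>W\<close> of the four vectors represents \<open>U\<^sup>\<bottom>/U\<close>. The linear forms \<open>f\<^sub>1, f\<^sub>2\<close> that are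
  dual to \<open>x, y\<close> and vanish on \<open>g, h\<close> and \<open>W\<close> are \<open>- \<omega>(-, g)\<close> and \<open>- \<omega>(-, h)\<close>, so \<open>theta\<close> multiplies by
  \<open>f\<^sub>1 e\<^sub>1 + f\<^sub>2 e\<^sub>2\<close>. Subtracting from \<open>\<omega>\<close> its part on \<open>U + U'\<close> leaves the restriction to \<open>W\<close>, by which
  \<open>lefW\<close> multiplies. Finally \<open>projW = (num - 1) (num - 2) / 2\<close> projects to the eigenvalue \<open>0\<close> of \<open>num\<close>,
  that is, it removes all terms with a factor \<open>\<omega>(-, x)\<close> or \<open>\<omega>(-, y)\<close>.
\<close>

definition dual_frame :: "'v \<Rightarrow> 'v \<Rightarrow> 'v \<Rightarrow> 'v \<Rightarrow> bool" where
  "dual_frame x y g h \<longleftrightarrow> \<omega> x y = 0 \<and> \<omega> g h = 0 \<and> \<omega> g x = 1 \<and> \<omega> g y = 0 \<and> \<omega> h x = 0 \<and> \<omega> h y = 1"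

definition lefW :: "'v \<Rightarrow> 'v \<Rightarrow> 'v \<Rightarrow> 'v \<Rightarrow> ('k, 'v) form_poly \<Rightarrow> ('k, 'v) form_poly" where
  "lefW x y g h F = lef F - eps x (eps g F) - eps y (eps h F)"

definition theta :: "'v \<Rightarrow> 'v \<Rightarrow> ('k, 'v) form_poly \<Rightarrow> ('k, 'v) form_poly" where
  "theta g h F = - eps g (mult_e1 F) - eps h (mult_e2 F)"

definition projW :: "'v \<Rightarrow> 'v \<Rightarrow> 'v \<Rightarrow> 'v \<Rightarrow> ('k, 'v) form_poly \<Rightarrow> ('k, 'v) form_poly" where
  "projW x y g h F = F - scale_poly (1 / 2) (scale_poly 3 (num x y g h F) - num x y g h (num x y g h F))"

lemma form_polys_lefW: "F \<in> form_polys p q \<Longrightarrow> lefW x y g h F \<in> form_polys (Suc (Suc p)) q"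
  by (simp add: lefW_def form_polys_diff form_polys_eps form_polys_lef)

lemma form_polys_theta: assumes "F \<in> form_polys p q" shows "theta g h F \<in> form_polys (Suc p) (Suc q)"
proof -
  have "theta g h F = 0 - eps g (mult_e1 F) - eps h (mult_e2 F)" by (simp add: theta_def)
  then show ?thesis using assms by (metis form_polys_diff form_polys_zero form_polys_eps form_polys_mult)
qed

lemma form_polys_projW: "F \<in> form_polys p q \<Longrightarrow> projW x y g h F \<in> form_polys p q"
  by (simp add: projW_def form_polys_diff form_polys_scale form_polys_num)

lemma op_lin_2:
  "lefW x y g h 0 = 0" "lefW x y g h (F + G) = lefW x y g h F + lefW x y g h G"
  "lefW x y g h (F - G) = lefW x y g h F - lefW x y g h G" "lefW x y g h (- F) = - lefW x y g h F"
  "lefW x y g h (scale_poly c F) = scale_poly c (lefW x y g h F)"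
  "theta g h 0 = 0" "theta g h (F + G) = theta g h F + theta g h G"
  "theta g h (F - G) = theta g h F - theta g h G" "theta g h (- F) = - theta g h F"
  "theta g h (scale_poly c F) = scale_poly c (theta g h F)"
  by (simp_all add: lefW_def theta_def op_lin)

context
  fixes x y g h
  assumes dual_frame: "dual_frame x y g h"
begin

lemma dual_frame_\<omega>:
  "\<omega> x x = 0" "\<omega> x y = 0" "\<omega> y x = 0" "\<omega> y y = 0" "\<omega> g g = 0" "\<omega> g h = 0" "\<omega> h g = 0" "\<omega> h h = 0"
  "\<omega> g x = 1" "\<omega> g y = 0" "\<omega> h x = 0" "\<omega> h y = 1" "\<omega> x g = - 1" "\<omega> y g = 0" "\<omega> x h = 0" "\<omega> y h = - 1"
  using dual_frame unfolding dual_frame_def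
  by (simp_all add: alternating \<omega>_skew[of y x] \<omega>_skew[of h g] \<omega>_skew[of x g] \<omega>_skew[of y g]
      \<omega>_skew[of x h] \<omega>_skew[of y h])

lemma iota_lefW:
  "iota x (lefW x y g h F) = lefW x y g h (iota x F)" "iota y (lefW x y g h F) = lefW x y g h (iota y F)"
  "iota g (lefW x y g h F) = lefW x y g h (iota g F)" "iota h (lefW x y g h F) = lefW x y g h (iota h F)"
  by (simp_all add: lefW_def op_lin op_comm dual_frame_\<omega> scale_poly_minus_1)

lemma exd_lefW: "exd x y (lefW x y g h F) = lefW x y g h (exd x y F)"
  by (simp add: lefW_def exd_def op_lin op_comm)
    (simp add: eps_swap[of y x] eps_swap[of g x] eps_swap[of h x] eps_swap[of g y] eps_swap[of h y] op_lin)

lemma iota_theta: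
  "iota x (theta g h F) = mult_e1 F - theta g h (iota x F)"
  "iota y (theta g h F) = mult_e2 F - theta g h (iota y F)"
  by (simp_all add: theta_def op_lin op_comm dual_frame_\<omega> scale_poly_minus_1)

lemma con_theta:
  assumes F: "F \<in> form_polys p q" and zero: "iota x F = 0" "iota y F = 0"
  shows "con x y (theta g h F) = scale_poly (of_nat (q + 2)) F"
  using zero
  by (simp add: con_def theta_def op_lin op_comm dual_frame_\<omega> scale_poly_minus_1 euler[OF F]
      flip: form_ops_past_poly_ops)
    (simp add: scale_poly_def fun_eq_iff algebra_simps)

lemma d0_theta: "iota x F = 0 \<Longrightarrow> iota y F = 0 \<Longrightarrow> d0 (x, y) (theta g h F) = 0"
  by (simp add: d0_eq form_ops_past_poly_ops(1,2)[symmetric] iota_theta op_lin op_lin_2 weyl)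

text \<open>
  Moving \<open>D\<close> past \<open>\<theta>\<close> produces the part of \<open>- \<omega>\<close> on \<open>U + U'\<close>; adding \<open>lef\<close>, which is what \<open>d\<^sub>1\<close>
  contributes on \<open>\<theta> F\<close>, leaves \<open>lefW\<close>.
\<close>

lemma twisted_de_rham:
  assumes zero: "iota x F = 0" "iota y F = 0"
  shows "exd x y (theta g h F) + lef F = lefW x y g h F - theta g h (exd x y F)"
  by (simp add: exd_def theta_def lefW_def op_lin op_comm)
    (simp add: eps_swap[of g x] eps_swap[of h x] eps_swap[of g y] eps_swap[of h y] op_lin)

text \<open>
  An element of the kernel of \<open>d\<^sub>0\<close> is to be written as \<open>Z\<^sub>0 + \<theta> Z\<^sub>1\<close> with \<open>Z\<^sub>0\<close>, \<open>Z\<^sub>1\<close> annihilated by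
  contraction with the plane. Such a \<open>Z\<^sub>0\<close> is annihilated by \<open>con\<close>, and \<open>con\<close> inverts \<open>\<theta>\<close> up to a scalar
  (\<open>con_theta\<close>), so \<open>Z\<^sub>1\<close> must be a multiple of the image under \<open>con\<close>. This choice works.
\<close>

lemma iota_con_eq_0:
  assumes F: "F \<in> form_polys p q" and zero: "d0 (x, y) F = 0"
  shows "iota x (con x y F) = 0" "iota y (con x y F) = 0"
proof -
  have alt: "alternating_poly F" by (rule form_polys_alternating[OF F])
  have "scale_poly (- of_nat (q + 2)) (iota x (iota y F)) = 0"
    using d0_con(2)[OF F, of x y] zero by (simp add: op_lin_1)
  then have J: "iota x (iota y F) = 0"
    by (rule scale_poly_eq_0D) (metis neg_equal_0_iff_equal of_nat_eq_0_iff add_is_0 zero_neq_numeral)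
  have "iota x (con x y F) = deriv_e2 (iota x (iota y F))" "iota y (con x y F) = - deriv_e1 (iota x (iota y F))"
    using alt by (simp_all add: con_def op_lin op_comm iota_same iota_swap[of _ y x])
  then show "iota x (con x y F) = 0" "iota y (con x y F) = 0" by (simp_all add: J op_lin)
qed

lemma iota_remainder_eq_0:
  assumes F: "F \<in> form_polys p q" and zero: "d0 (x, y) F = 0"
  defines "Z \<equiv> F - theta g h (scale_poly (1 / of_nat (q + 1)) (con x y F))"
  shows "iota x Z = 0" "iota y Z = 0"
proof -
  have A: "iota x (mult_e2 F) = iota y (mult_e1 F)" using zero by (simp add: d0_eq)
  note C = iota_con_eq_0[OF F zero]
  have nz: "(of_nat (q + 1) :: 'k) \<noteq> 0" by (metis of_nat_eq_0_iff Suc_eq_plus1 nat.distinct(1))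
  have 1: "mult_e1 (con x y F) = scale_poly (of_nat (q + 1)) (iota x F)"
  proof -
    have "mult_e1 (con x y F) = iota x (mult_e1 (deriv_e1 F)) + deriv_e2 (iota y (mult_e1 F))"
      by (simp add: con_def op_lin op_comm)
    also have "\<dots> = iota x (mult_e1 (deriv_e1 F)) + deriv_e2 (iota x (mult_e2 F))" by (simp only: A)
    also have "\<dots> = scale_poly (of_nat (q + 1)) (iota x F)"
      by (simp add: op_lin op_comm euler[OF F]) (simp add: scale_poly_def fun_eq_iff algebra_simps)
    finally show ?thesis .
  qed
  have 2: "mult_e2 (con x y F) = scale_poly (of_nat (q + 1)) (iota y F)"
  proof -
    have "mult_e2 (con x y F) = deriv_e1 (iota x (mult_e2 F)) + iota y (mult_e2 (deriv_e2 F))"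
      by (simp add: con_def op_lin op_comm)
    also have "\<dots> = deriv_e1 (iota y (mult_e1 F)) + iota y (mult_e2 (deriv_e2 F))" by (simp only: A)
    also have "\<dots> = scale_poly (of_nat (q + 1)) (iota y F)"
      by (simp add: op_lin op_comm euler[OF F]) (simp add: scale_poly_def fun_eq_iff algebra_simps)
    finally show ?thesis .
  qed
  show "iota x Z = 0" "iota y Z = 0"
    using nz by (simp_all add: Z_def iota_lin iota_theta C op_lin op_lin_2 1 2 del: of_nat_add of_nat_Suc)
qed

lemma projW_iota:
  assumes "alternating_poly F"
  shows "iota g (projW x y g h F) = 0" "iota h (projW x y g h F) = 0"
    "iota x (projW x y g h F) = projW x y g h (iota x F)" "iota y (projW x y g h F) = projW x y g h (iota y F)"
  using assms
  by (simp_all add: projW_def num_def op_lin op_comm dual_frame_\<omega> eps_swap[of y x] iota_swap[of _ h g]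
      iota_swap[of _ x g] iota_swap[of _ x h] iota_swap[of _ y g] iota_swap[of _ y h] iota_same numeral_mult_poly)
    (simp_all add: scale_poly_def fun_eq_iff algebra_simps)

lemma projW_exd: "projW x y g h (exd x y F) = 0"
  by (simp add: projW_def num_def exd_def op_lin op_comm dual_frame_\<omega> eps_swap[of y x] numeral_mult_poly)
    (simp add: scale_poly_def fun_eq_iff algebra_simps)

lemma num_lefW: "num x y g h (lefW x y g h F) = lefW x y g h (num x y g h F)"
proof -
  have "eps x (lefW x y g h G) = lefW x y g h (eps x G)" "eps y (lefW x y g h G) = lefW x y g h (eps y G)" for G
    by (simp_all add: lefW_def op_lin op_comm eps_swap[of y x])
      (simp_all add: eps_swap[of g x] eps_swap[of h x] eps_swap[of g y] eps_swap[of h y] eps_swap[of y x] op_lin)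
  then show ?thesis by (simp add: num_def iota_lefW op_lin_2)
qed

lemma projW_lefW: "projW x y g h (lefW x y g h F) = lefW x y g h (projW x y g h F)"
  by (simp add: projW_def num_lefW op_lin_2)

lemma projW_idem: "iota g F = 0 \<Longrightarrow> iota h F = 0 \<Longrightarrow> projW x y g h F = F"
  by (simp add: projW_def num_def op_lin)

text \<open>
  In polynomial degree \<open>0\<close> the operator \<open>q + num\<close> is not invertible. Here \<open>exd kos = num\<close>, and
  \<open>1 - projW\<close> is divisible by \<open>num\<close> with quotient \<open>(3 - num) / 2\<close>.
\<close>

lemma exd_exact_degree_0:
  assumes F: "F \<in> form_polys p 0"
  shows "exd x y (kos g h (scale_poly (1 / 2) (scale_poly 3 F - num x y g h F))) = F - projW x y g h F"
proof -
  have "exd x y (kos g h G) = num x y g h G" if "G \<in> form_polys p 0" for G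
    using kos_exd[OF _ _ _ _ that, of g x y h] deriv_degree_0[OF that] by (simp add: dual_frame_\<omega> exd_def op_lin op_lin_1)
  from this[OF form_polys_scale[OF form_polys_diff[OF form_polys_scale[OF F] form_polys_num[OF F]]]]
  show ?thesis by (simp add: projW_def op_lin_1)
qed

end

end

section \<open>Dual bases and the Lefschetz isomorphism\<close>

context symplectic_space
begin

lemma \<omega>_zero [simp]: "\<omega> 0 y = 0" "\<omega> x 0 = 0"
  using \<omega>_scale_left[of 0 0 y] \<omega>_scale_right[of x 0 0] by simp_all

lemma \<omega>_sum_left: "\<omega> (\<Sum>a\<in>A. f a) y = (\<Sum>a\<in>A. \<omega> (f a) y)"
  and \<omega>_sum_right: "\<omega> y (\<Sum>a\<in>A. f a) = (\<Sum>a\<in>A. \<omega> y (f a))"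
  by (induction A rule: infinite_finite_induct) (simp_all add: \<omega>_linear)

lemma \<omega>_diff_left: "\<omega> (x - y) z = \<omega> x z - \<omega> y z"
  and \<omega>_diff_right: "\<omega> z (x - y) = \<omega> z x - \<omega> z y"
  using \<omega>_add_left[of "x - y" y z] \<omega>_add_right[of z "x - y" y] by simp_all

text \<open>Gram--Schmidt: a functional that vanishes on the common kernel of \<open>\<omega>(-, s)\<close>, \<open>s \<in> S\<close>, would be \<open>\<omega>(-, e)\<close> with \<open>e\<close> in the span of \<open>S\<close>.\<close>

lemma dual_family_exists:
  assumes "finite S" "independent S"
  shows "\<exists>\<gamma>. \<forall>s\<in>S. \<forall>s'\<in>S. \<omega> (\<gamma> s) s' = (if s = s' then 1 else 0)"
  using assms
proof (induction S)
  case empty then show ?case by simp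
next
  case (insert e S)
  then have "independent S" and e: "e \<notin> span S" by (auto simp: independent_insert split: if_splits)
  with insert obtain \<gamma> where \<gamma>: "\<And>s s'. s \<in> S \<Longrightarrow> s' \<in> S \<Longrightarrow> \<omega> (\<gamma> s) s' = (if s = s' then 1 else 0)" by blast
  have "\<exists>z. (\<forall>s\<in>S. \<omega> z s = 0) \<and> \<omega> z e \<noteq> 0"
  proof (rule ccontr)
    assume H: "\<not> ?thesis"
    have "\<omega> (e - (\<Sum>s\<in>S. \<omega> (\<gamma> s) e *s s)) x = 0" for x
    proof -
      let ?z = "x - (\<Sum>s\<in>S. \<omega> x s *s \<gamma> s)"
      have "\<omega> ?z s' = 0" if "s' \<in> S" for s'
        using that insert.hyps(1) by (simp add: \<omega>_diff_left \<omega>_sum_left \<omega>_linear \<gamma> if_distrib[of "(*) _"] cong: if_cong)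
      with H have "\<omega> ?z e = 0" by blast
      then have "\<omega> x e = (\<Sum>s\<in>S. \<omega> x s * \<omega> (\<gamma> s) e)" by (simp add: \<omega>_diff_left \<omega>_sum_left \<omega>_linear)
      then show ?thesis
        by (simp add: \<omega>_diff_left \<omega>_sum_left \<omega>_linear \<omega>_skew[of x] sum_negf mult.commute)
    qed
    from nondegenerate[OF this] have "e = (\<Sum>s\<in>S. \<omega> (\<gamma> s) e *s s)" by simp
    also have "\<dots> \<in> span S" by (intro span_sum span_scale span_base)
    finally show False using e by simp
  qed
  then obtain z where z: "\<And>s. s \<in> S \<Longrightarrow> \<omega> z s = 0" "\<omega> z e \<noteq> 0" by blast
  define z' where "z' = (1 / \<omega> z e) *s z"
  have z': "\<And>s. s \<in> S \<Longrightarrow> \<omega> z' s = 0" "\<omega> z' e = 1" using z by (simp_all add: z'_def \<omega>_linear)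
  show ?case
    by (rule exI[of _ "\<lambda>s. if s = e then z' else \<gamma> s - \<omega> (\<gamma> s) e *s z'"])
      (use z' \<gamma> insert.hyps(2) in \<open>auto simp: \<omega>_diff_left \<omega>_linear\<close>)
qed

end

locale finite_symplectic_space = symplectic_char_0 scale \<omega>
  for scale :: "'k::field_char_0 \<Rightarrow> 'v::ab_group_add \<Rightarrow> 'v" (infixr \<open>*s\<close> 75)
    and \<omega> :: "'v \<Rightarrow> 'v \<Rightarrow> 'k" +
  fixes Bs :: "'v set" and bd :: "'v \<Rightarrow> 'v" and n :: nat
  assumes finite_Bs: "finite Bs" and card_Bs: "card Bs = 2 * n" and span_Bs: "span Bs = UNIV"
    and bd: "\<And>b c. b \<in> Bs \<Longrightarrow> c \<in> Bs \<Longrightarrow> \<omega> (bd b) c = (if b = c then 1 else 0)"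
begin

lemma sum_delta_Bs: "b \<in> Bs \<Longrightarrow> (\<Sum>c\<in>Bs. f c * (if b = c then 1 else 0)) = (f b :: 'k)"
  "b \<in> Bs \<Longrightarrow> (\<Sum>c\<in>Bs. f c * (if c = b then 1 else 0)) = (f b :: 'k)"
  using finite_Bs by (simp_all add: if_distrib[of "(*) _"] cong: if_cong)

lemma expand_Bs: "(\<Sum>b\<in>Bs. \<omega> (bd b) x *s b) = x"
proof -
  have "x \<in> span Bs" by (simp add: span_Bs)
  then obtain u where x: "x = (\<Sum>b\<in>Bs. u b *s b)" using span_finite[OF finite_Bs] by auto
  have "\<omega> (bd b) x = u b" if "b \<in> Bs" for b
    unfolding x using that by (simp add: \<omega>_sum_right \<omega>_linear bd sum_delta_Bs)
  then show ?thesis using x by simp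
qed

lemma expand_dual: "(\<Sum>b\<in>Bs. \<omega> x b *s bd b) = x"
proof -
  have "\<omega> (x - (\<Sum>b\<in>Bs. \<omega> x b *s bd b)) y = 0" for y
  proof -
    have "\<omega> (x - (\<Sum>b\<in>Bs. \<omega> x b *s bd b)) c = 0" if "c \<in> Bs" for c
      using that by (simp add: \<omega>_diff_left \<omega>_sum_left \<omega>_linear bd sum_delta_Bs)
    then show ?thesis by (subst expand_Bs[symmetric]) (simp add: \<omega>_sum_right \<omega>_linear)
  qed
  from nondegenerate[OF this] show ?thesis by simp
qed

lemma op_sum:
  fixes f :: "'a \<Rightarrow> ('k, 'v) form_poly"
  shows
  "iota x (\<Sum>a\<in>A. f a) = (\<Sum>a\<in>A. iota x (f a))" "eps x (\<Sum>a\<in>A. f a) = (\<Sum>a\<in>A. eps x (f a))"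
  "lef (\<Sum>a\<in>A. f a) = (\<Sum>a\<in>A. lef (f a))" "scale_poly c (\<Sum>a\<in>A. f a) = (\<Sum>a\<in>A. scale_poly c (f a))"
  using sum_comp_morphism[of "iota x" f A] sum_comp_morphism[of "eps x" f A] sum_comp_morphism[of lef f A]
    sum_comp_morphism[of "scale_poly c" f A]
  by (simp_all add: op_lin o_def)

lemma sum_constant_poly: "finite A \<Longrightarrow> (\<Sum>a\<in>A. F :: ('k, 'v) form_poly) = scale_poly (of_nat (card A)) F"
  by (induction A rule: finite_induct) (simp_all add: scale_poly_def fun_eq_iff algebra_simps)

lemma iota_vec_sum:
  assumes F: "alternating_poly F"
  shows "iota (\<Sum>a\<in>A. c a *s f a) F = (\<Sum>a\<in>A. scale_poly (c a) (iota (f a) F))"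
proof -
  have "iota (\<Sum>a\<in>A. c a *s f a) F = (\<Sum>a\<in>A. iota (c a *s f a) F)"
    using sum_comp_morphism[of "\<lambda>v. iota v F" "\<lambda>a. c a *s f a" A] iota_vec_scale[OF F, of 0 0]
    by (simp add: iota_vec_add[OF F] o_def)
  then show ?thesis by (simp add: iota_vec_scale[OF F])
qed

lemma form_poly_eq_by_iota:
  assumes "\<And>i j. F i j [] = G i j []" and "\<And>z. iota z F = iota z G"
  shows "F = G"
proof -
  have "F i j = G i j" for i j
  proof (rule form_eq_by_contract)
    show "contract z (F i j) = contract z (G i j)" for z
      using fun_cong[OF fun_cong[OF assms(2)[of z], of i], of j] by (simp add: iota_def map_form_def)
  qed (rule assms(1))
  then show ?thesis by blast
qed

text \<open>
  The commutator of the sum with a contraction \<open>iota z\<close> is \<open>c iota z\<close>, so each degree of a form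
  contributes \<open>c\<close>.
\<close>

lemma degree_operator:
  assumes F: "F \<in> form_polys p q"
    and expand: "\<And>z G. alternating_poly G \<Longrightarrow> (\<Sum>b\<in>Bs. scale_poly (\<omega> z (f b)) (iota (g b) G)) = scale_poly c (iota z G)"
  shows "(\<Sum>b\<in>Bs. eps (f b) (iota (g b) F)) = scale_poly (c * of_nat p) F"
  using F
proof (induction p arbitrary: F)
  case (0 F)
  have "iota z F = 0" for z by (rule iota_degree_0[OF 0])
  then show ?case by (simp only: eps_lin sum.neutral_const of_nat_0 mult_zero_right scale_poly_0)
next
  case (Suc p)
  have alt: "alternating_poly F" by (rule form_polys_alternating[OF Suc.prems])
  show ?case
  proof (rule form_poly_eq_by_iota)
    fix z
    have "iota z (\<Sum>b\<in>Bs. eps (f b) (iota (g b) F)) =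
        (\<Sum>b\<in>Bs. scale_poly (\<omega> z (f b)) (iota (g b) F)) + (\<Sum>b\<in>Bs. eps (f b) (iota (g b) (iota z F)))"
      by (simp add: op_sum iota_eps sum.distrib[symmetric] iota_swap[OF alt, of z] op_lin)
    also have "(\<Sum>b\<in>Bs. scale_poly (\<omega> z (f b)) (iota (g b) F)) = scale_poly c (iota z F)" by (rule expand[OF alt])
    also have "(\<Sum>b\<in>Bs. eps (f b) (iota (g b) (iota z F))) = scale_poly (c * of_nat p) (iota z F)"
      by (rule Suc.IH) (use form_polys_iota[OF Suc.prems] in simp)
    finally show "iota z (\<Sum>b\<in>Bs. eps (f b) (iota (g b) F)) = iota z (scale_poly (c * of_nat (Suc p)) F)"
      by (simp add: op_lin) (simp add: scale_poly_def fun_eq_iff algebra_simps)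
    show "(\<Sum>b\<in>Bs. eps (f b) (iota (g b) F)) i j [] = scale_poly (c * of_nat (Suc p)) F i j []" for i j
    proof -
      have "(\<Sum>b\<in>A. eps (f b) (iota (g b) F)) i j [] = 0" for A
        by (induction A rule: infinite_finite_induct) (simp_all add: eps_def map_form_def)
      moreover have "F i j [] = 0" using Suc.prems alt_forms_length[of "F i j" "Suc p" "[]"] by (simp add: form_polys_def)
      ultimately show ?thesis by (simp add: scale_poly_def)
    qed
  qed
qed

lemma expand_iota:
  assumes F: "alternating_poly F"
  shows "(\<Sum>b\<in>Bs. scale_poly (\<omega> z b) (iota (bd b) F)) = iota z F"
    and "(\<Sum>b\<in>Bs. scale_poly (\<omega> (bd b) z) (iota b F)) = iota z F"
    and "(\<Sum>b\<in>Bs. scale_poly (\<omega> z (bd b)) (iota b F)) = scale_poly (- 1) (iota z F)"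
proof -
  show "(\<Sum>b\<in>Bs. scale_poly (\<omega> z b) (iota (bd b) F)) = iota z F"
    by (subst iota_vec_sum[OF F, symmetric]) (simp add: expand_dual)
  show 2: "(\<Sum>b\<in>Bs. scale_poly (\<omega> (bd b) z) (iota b F)) = iota z F"
    by (subst iota_vec_sum[OF F, symmetric]) (simp add: expand_Bs)
  have "(\<Sum>b\<in>Bs. scale_poly (\<omega> z (bd b)) (iota b F)) = scale_poly (- 1) (\<Sum>b\<in>Bs. scale_poly (\<omega> (bd b) z) (iota b F))"
    unfolding op_sum by (intro sum.cong refl) (simp add: \<omega>_skew[of z "bd _"] scale_poly_scale_poly)
  then show "(\<Sum>b\<in>Bs. scale_poly (\<omega> z (bd b)) (iota b F)) = scale_poly (- 1) (iota z F)" by (simp only: 2)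
qed

lemma iota_degree_operator:
  assumes F: "F \<in> form_polys p q"
  shows "(\<Sum>b\<in>Bs. eps b (iota (bd b) F)) = scale_poly (of_nat p) F"
    and "(\<Sum>b\<in>Bs. eps (bd b) (iota b F)) = scale_poly (- of_nat p) F"
  using degree_operator[OF F, of "\<lambda>b. b" bd 1] degree_operator[OF F, of bd "\<lambda>b. b" "- 1"] expand_iota
  by simp_all

text \<open>
  Contraction with the bivector dual to \<open>\<omega>\<close>.
\<close>

definition Lam :: "('k, 'v) form_poly \<Rightarrow> ('k, 'v) form_poly" where
  "Lam F = scale_poly (1 / 2) (\<Sum>b\<in>Bs. iota (bd b) (iota b F))"

lemma Lam_lin: "Lam 0 = 0" "Lam (F + G) = Lam F + Lam G" "Lam (F - G) = Lam F - Lam G"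
  "Lam (- F) = - Lam F" "Lam (scale_poly c F) = scale_poly c (Lam F)"
  by (simp_all add: Lam_def op_lin op_sum sum.distrib sum_subtractf sum_negf scale_poly_add scale_poly_diff scale_poly_minus mult.commute)

lemma form_polys_sum:
  fixes f :: "'a \<Rightarrow> ('k, 'v) form_poly"
  shows "(\<And>a. a \<in> A \<Longrightarrow> f a \<in> form_polys p q) \<Longrightarrow> (\<Sum>a\<in>A. f a) \<in> form_polys p q"
  by (induction A rule: infinite_finite_induct) (simp_all add: form_polys_add)

lemma form_polys_Lam: "F \<in> form_polys p q \<Longrightarrow> Lam F \<in> form_polys (p - 2) q"
proof -
  assume "F \<in> form_polys p q"
  then have "iota (bd b) (iota b F) \<in> form_polys (p - 1 - 1) q" for b by (intro form_polys_iota)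
  then show ?thesis unfolding Lam_def by (intro form_polys_scale form_polys_sum) (simp add: numeral_2_eq_2)
qed

lemma Lam_low_degree: "F \<in> form_polys p q \<Longrightarrow> p < 2 \<Longrightarrow> Lam F = 0"
proof -
  assume F: "F \<in> form_polys p q" and p: "p < 2"
  have "iota b F \<in> form_polys 0 q" for b using form_polys_iota[OF F, of b] p by (cases p) auto
  then have "iota c (iota b F) = 0" for b c by (intro iota_degree_0)
  then show ?thesis by (simp add: Lam_def)
qed

lemma iota_Lam: "alternating_poly F \<Longrightarrow> iota z (Lam F) = Lam (iota z F)"
proof -
  assume F: "alternating_poly F"
  have "iota z (iota (bd b) (iota b F)) = iota (bd b) (iota b (iota z F))" for b
    using F by (simp add: iota_swap[of _ z] op_lin)
  then show ?thesis by (simp add: Lam_def op_lin op_sum)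
qed

lemma Lam_lef:
  assumes F: "F \<in> form_polys p q"
  shows "Lam (lef F) = lef (Lam F) + scale_poly (of_nat n - of_nat p) F"
proof -
  have 1: "iota (bd b) (iota b (lef F)) = lef (iota (bd b) (iota b F)) + (eps (bd b) (iota b F) + F - eps b (iota (bd b) F))"
    if "b \<in> Bs" for b using that by (simp add: op_comm op_lin bd)
  have "(\<Sum>b\<in>Bs. iota (bd b) (iota b (lef F))) = (\<Sum>b\<in>Bs. lef (iota (bd b) (iota b F))) +
      ((\<Sum>b\<in>Bs. eps (bd b) (iota b F)) + (\<Sum>b\<in>Bs. F) - (\<Sum>b\<in>Bs. eps b (iota (bd b) F)))"
    by (simp add: 1 sum.distrib sum_subtractf)
  also have "(\<Sum>b\<in>Bs. F) = scale_poly (of_nat (2 * n)) F"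
    using finite_Bs by (simp only: sum_constant_poly card_Bs)
  finally have "(\<Sum>b\<in>Bs. iota (bd b) (iota b (lef F))) = lef (\<Sum>b\<in>Bs. iota (bd b) (iota b F)) +
      (scale_poly (- of_nat p) F + scale_poly (of_nat (2 * n)) F - scale_poly (of_nat p) F)"
    by (simp only: iota_degree_operator[OF F] op_sum(3))
  then show ?thesis
    unfolding Lam_def by (simp add: op_lin) (simp add: scale_poly_def fun_eq_iff field_simps)
qed


lemma Lam_eps:
  assumes F: "alternating_poly F"
  shows "Lam (eps z F) = eps z (Lam F) - iota z F"
proof -
  have 1: "iota (bd b) (iota b (eps z F)) = eps z (iota (bd b) (iota b F)) +
      (scale_poly (- 1) (scale_poly (\<omega> z b) (iota (bd b) F)) - scale_poly (\<omega> (bd b) z) (iota b F))" for b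
    by (simp add: op_comm op_lin \<omega>_skew[of b z])
  have "(\<Sum>b\<in>Bs. iota (bd b) (iota b (eps z F))) = (\<Sum>b\<in>Bs. eps z (iota (bd b) (iota b F))) +
      (scale_poly (- 1) (\<Sum>b\<in>Bs. scale_poly (\<omega> z b) (iota (bd b) F)) - (\<Sum>b\<in>Bs. scale_poly (\<omega> (bd b) z) (iota b F)))"
    by (simp only: 1 sum.distrib sum_subtractf op_sum)
  then have "(\<Sum>b\<in>Bs. iota (bd b) (iota b (eps z F))) = eps z (\<Sum>b\<in>Bs. iota (bd b) (iota b F)) +
      (scale_poly (- 1) (iota z F) - iota z F)"
    by (simp only: op_sum(2) expand_iota[OF F])
  then show ?thesis
    unfolding Lam_def by (simp add: op_lin) (simp add: scale_poly_def fun_eq_iff field_simps)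
qed

text \<open>
  Expanding the arguments in the basis leaves only values on lists of more than \<open>2 n\<close> basis vectors,
  which have repetitions.
\<close>

lemma alt_forms_above_dimension:
  assumes \<alpha>: "\<alpha> \<in> alt_forms p" and p: "p > 2 * n"
  shows "\<alpha> = 0"
proof -
  have "\<alpha> (us @ vs) = 0" if "set vs \<subseteq> Bs" "length us + length vs = p" for us vs
    using that
  proof (induction us arbitrary: vs rule: rev_induct)
    case Nil
    have "\<not> distinct vs"
      using Nil p card_Bs card_mono[OF finite_Bs, of "set vs"] distinct_card[of vs] by auto
    then show ?case using alt_forms_distinct[OF \<alpha>] by simp
  next
    case (snoc x us)
    let ?l = "\<lambda>z. \<alpha> (us @ [z] @ vs)"
    have upd: "us @ [z] @ vs = (us @ [0] @ vs)[length us := z]" for z by simp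
    have i: "length (us @ [0] @ vs) = p" "length us < p" using snoc.prems by auto
    have add: "?l (a + b) = ?l a + ?l b" and scl: "?l (c *s a) = c * ?l a" for a b c
      unfolding upd[of "a + b"] upd[of a] upd[of b] upd[of "c *s a"]
      by (rule alt_forms_slot_add[OF \<alpha> i] alt_forms_slot_scale[OF \<alpha> i])+
    have "?l (\<Sum>b\<in>A. c b *s b) = (\<Sum>b\<in>A. c b * ?l b)" for c A
    proof (induction A rule: infinite_finite_induct)
      case (insert a A) then show ?case by (simp only: sum.insert add scl not_False_eq_True)
    qed (use scl[of 0 0] in simp_all)
    then have "?l x = (\<Sum>b\<in>Bs. \<omega> (bd b) x * ?l b)" by (metis expand_Bs)
    also have "\<dots> = 0" using snoc.IH[of "_ # vs"] snoc.prems by (intro sum.neutral) auto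
    finally show ?case by simp
  qed
  from this[of "[]"] have "\<alpha> vs = 0" if "length vs = p" for vs
    using that \<open>\<And>vs us. set vs \<subseteq> Bs \<Longrightarrow> length us + length vs = p \<Longrightarrow> \<alpha> (us @ vs) = 0\<close>[of "[]" vs] by simp
  then show ?thesis using alt_forms_length[OF \<alpha>] by (auto simp: fun_eq_iff)
qed

lemma form_polys_above_dimension:
  assumes "F \<in> form_polys p q" "p > 2 * n" shows "F = 0"
proof -
  have "F i j = 0" for i j
    using assms alt_forms_above_dimension[of "F i j" p] by (simp add: form_polys_def)
  then show ?thesis by (simp add: fun_eq_iff)
qed

text \<open>
  The forms pulled back along the projection of \<open>V\<close> to \<open>W\<close>.
\<close>

definition basic :: "'v \<Rightarrow> 'v \<Rightarrow> 'v \<Rightarrow> 'v \<Rightarrow> ('k, 'v) form_poly \<Rightarrow> bool" where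
  "basic x y g h F \<longleftrightarrow> iota x F = 0 \<and> iota y F = 0 \<and> iota g F = 0 \<and> iota h F = 0"

lemma basic_Lam: "basic x y g h F \<Longrightarrow> alternating_poly F \<Longrightarrow> basic x y g h (Lam F)"
  by (simp add: basic_def iota_Lam Lam_lin)

lemma basic_lefW: "dual_frame x y g h \<Longrightarrow> basic x y g h F \<Longrightarrow> basic x y g h (lefW x y g h F)"
  by (simp add: basic_def iota_lefW op_lin_2)

text \<open>
  The contraction \<open>Lam\<close> with the bivector of \<open>\<omega>\<close> and the wedge product with the form induced by
  \<open>\<omega>\<close> on \<open>U\<^sup>\<bottom>/U\<close>, which has dimension \<open>2 (n - 2)\<close>, generate a representation of \<open>sl\<^sub>2\<close> on forms on \<open>U\<^sup>\<bottom>/U\<close>.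
\<close>

lemma Lam_lefW:
  assumes fr: "dual_frame x y g h" and F: "F \<in> form_polys p q" and b: "basic x y g h F"
  shows "Lam (lefW x y g h F) = lefW x y g h (Lam F) + scale_poly (of_nat n - 2 - of_nat p) F"
proof -
  have alt: "alternating_poly F" by (rule form_polys_alternating[OF F])
  have 1: "Lam (eps x (eps g F)) = eps x (eps g (Lam F)) + F" "Lam (eps y (eps h F)) = eps y (eps h (Lam F)) + F"
    using b alt by (simp_all add: Lam_eps basic_def op_lin op_comm dual_frame_\<omega>[OF fr] scale_poly_minus_1)
  show ?thesis
    by (simp add: lefW_def Lam_lin 1 Lam_lef[OF F]) (simp add: scale_poly_def fun_eq_iff algebra_simps)
qed

lemma form_polys_Lam_pow: "F \<in> form_polys p q \<Longrightarrow> (Lam ^^ k) F \<in> form_polys (p - 2 * k) q"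
proof (induction k)
  case (Suc k)
  then have "Lam ((Lam ^^ k) F) \<in> form_polys (p - 2 * k - 2) q" by (intro form_polys_Lam)
  then show ?case by (simp add: diff_diff_left add.commute)
qed simp

lemma Lam_pow_low_degree: "F \<in> form_polys p q \<Longrightarrow> p < 2 * k \<Longrightarrow> (Lam ^^ k) F = 0"
proof (induction k)
  case (Suc k)
  show ?case
  proof (cases "p < 2 * k")
    case False
    then show ?thesis using Lam_low_degree[OF form_polys_Lam_pow[OF Suc.prems(1), of k]] Suc.prems(2) by simp
  next
    case True
    then have "(Lam ^^ k) F = 0" using Suc by blast
    then show ?thesis by (simp only: funpow.simps o_apply Lam_lin)
  qed
qed simp

lemma basic_Lam_pow: "F \<in> form_polys p q \<Longrightarrow> basic x y g h F \<Longrightarrow> basic x y g h ((Lam ^^ k) F)"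
  by (induction k) (simp_all add: basic_Lam form_polys_alternating[OF form_polys_Lam_pow])

text \<open>
  Commuting \<open>lefW\<close> past the factors \<open>Lam\<close> one by one collects the weights \<open>n - 2 - p + 2 i\<close> of
  \<open>Lam\<^sup>i F\<close> for \<open>i \<le> k\<close>; the scalar is their sum.
\<close>

lemma lefW_Lam_pow:
  assumes fr: "dual_frame x y g h" and F: "F \<in> form_polys p q" and b: "basic x y g h F"
  shows "lefW x y g h ((Lam ^^ Suc k) F) = (Lam ^^ Suc k) (lefW x y g h F) -
    scale_poly (of_nat (Suc k) * (of_nat n - 2 - of_nat p + of_nat k)) ((Lam ^^ k) F)"
proof (induction k)
  case 0
  show ?case by (simp add: Lam_lefW[OF fr F b])
next
  case (Suc k)
  let ?G = "(Lam ^^ Suc k) F"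
  have G: "?G \<in> form_polys (p - 2 * Suc k) q" by (rule form_polys_Lam_pow[OF F])
  have bG: "basic x y g h ?G" by (rule basic_Lam_pow[OF F b])
  have deg: "scale_poly (of_nat n - 2 - of_nat (p - 2 * Suc k)) ?G = scale_poly (of_nat n - 2 - of_nat p + 2 * of_nat (Suc k)) ?G"
  proof (cases "2 * Suc k \<le> p")
    case True
    then have "(of_nat (p - 2 * Suc k) :: 'k) = of_nat p - 2 * of_nat (Suc k)" by (simp add: of_nat_diff)
    then have "of_nat n - 2 - of_nat (p - 2 * Suc k) = (of_nat n - 2 - of_nat p + 2 * of_nat (Suc k) :: 'k)"
      by (simp only: diff_diff_eq2 diff_add_eq)
    then show ?thesis by (simp only:)
  next
    case False
    then have "?G = 0" by (intro Lam_pow_low_degree[OF F]) simp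
    then show ?thesis by (simp only: scale_poly_0)
  qed
  have "lefW x y g h ((Lam ^^ Suc (Suc k)) F) = Lam (lefW x y g h ?G) - scale_poly (of_nat n - 2 - of_nat (p - 2 * Suc k)) ?G"
    using Lam_lefW[OF fr G bG] by simp
  also have "Lam (lefW x y g h ?G) = (Lam ^^ Suc (Suc k)) (lefW x y g h F) -
      scale_poly (of_nat (Suc k) * (of_nat n - 2 - of_nat p + of_nat k)) ?G"
    unfolding Suc.IH by (simp add: Lam_lin)
  finally show ?case
    unfolding deg by (simp add: scale_poly_def fun_eq_iff algebra_simps)
qed

text \<open>
  In degree \<open>n - 3\<close>, one below the middle degree \<open>n - 2\<close> of \<open>W\<close>, the scalars in \<open>lefW_Lam_pow\<close> are
  \<open>(k + 1)\<^sup>2\<close>. So if \<open>lefW F = 0\<close>, the vanishing of a high power \<open>Lam\<^sup>k F\<close> propagates down to \<open>F\<close>.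
\<close>

lemma lefW_injective:
  assumes fr: "dual_frame x y g h" and F: "F \<in> form_polys p q" and b: "basic x y g h F"
    and p: "p + 3 = n" and zero: "lefW x y g h F = 0"
  shows "F = 0"
proof -
  have step: "(Lam ^^ k) F = 0" if "(Lam ^^ Suc k) F = 0" for k
  proof -
    have c: "of_nat n - 2 - of_nat p + of_nat k = (of_nat (Suc k) :: 'k)" using p by (auto simp: algebra_simps)
    have "(Lam ^^ Suc k) (0 :: ('k, 'v) form_poly) = 0"
      by (induction k) (simp_all only: funpow.simps o_apply id_apply Lam_lin)
    then have "scale_poly (of_nat (Suc k) * of_nat (Suc k)) ((Lam ^^ k) F) = 0"
      using lefW_Lam_pow[OF fr F b, of k] unfolding that zero c by (simp add: op_lin_2 del: of_nat_Suc funpow.simps)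
    then show ?thesis by (rule scale_poly_eq_0D) (simp del: of_nat_Suc)
  qed
  have "(Lam ^^ (p + 1 - k)) F = 0" if "k \<le> p + 1" for k
    using that
  proof (induction k)
    case 0 show ?case using Lam_pow_low_degree[OF F, of "p + 1"] by simp
  next
    case (Suc k)
    then have "p + 1 - k = Suc (p + 1 - Suc k)" by simp
    moreover have "(Lam ^^ (p + 1 - k)) F = 0" using Suc by linarith
    ultimately have "(Lam ^^ Suc (p + 1 - Suc k)) F = 0" by (simp only:)
    then show ?case by (rule step)
  qed
  from this[of "p + 1"] show ?thesis by simp
qed

end

section \<open>Regular functions and equivariance\<close>

context symplectic_space
begin

lemma poly_funs_uminus: "g \<in> poly_funs \<Longrightarrow> (\<lambda>e. - g e) \<in> poly_funs"
  using poly_funs.times[OF poly_funs.const[of "-1"]] by force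

lemma poly_funs_\<omega>: "(\<lambda>e. \<omega> c (fst e)) \<in> poly_funs" "(\<lambda>e. \<omega> c (snd e)) \<in> poly_funs"
  by (rule poly_funs.linear_fst poly_funs.linear_snd, rule linear_right)+

lemma regular_on_poly: "g \<in> poly_funs \<Longrightarrow> regular_on A g"
  unfolding regular_on_def by (intro ballI bexI[of _ g] bexI[of _ "\<lambda>_. 1"] poly_funs.const) auto

lemma regular_on_const [simp]: "regular_on A (\<lambda>_. c)"
  by (intro regular_on_poly poly_funs.const)

lemma regular_on_E:
  assumes "regular_on A f" "e \<in> A"
  obtains g h where "g \<in> poly_funs" "h \<in> poly_funs" "h e \<noteq> 0" "\<And>e'. e' \<in> A \<Longrightarrow> h e' \<noteq> 0 \<Longrightarrow> f e' = g e' / h e'"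
  using assms(1)[unfolded regular_on_def, rule_format, OF assms(2)] that by blast

lemma regular_on_subset: assumes "regular_on A f" "B \<subseteq> A" shows "regular_on B f"
  unfolding regular_on_def
proof
  fix e assume "e \<in> B"
  then have "e \<in> A" using assms(2) by blast
  from assms(1) this obtain g h where "g \<in> poly_funs" "h \<in> poly_funs" "h e \<noteq> 0" "\<And>e'. e' \<in> A \<Longrightarrow> h e' \<noteq> 0 \<Longrightarrow> f e' = g e' / h e'"
    by (rule regular_on_E) (rule that)
  then show "\<exists>g\<in>poly_funs. \<exists>h\<in>poly_funs. h e \<noteq> 0 \<and> (\<forall>e'\<in>B. h e' \<noteq> 0 \<longrightarrow> f e' = g e' / h e')"
    using assms(2) by (intro bexI[of _ g] bexI[of _ h]) auto
qed

lemma regular_on_cong: "(\<And>e. e \<in> A \<Longrightarrow> f e = f' e) \<Longrightarrow> regular_on A f \<longleftrightarrow> regular_on A f'"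
  by (simp add: regular_on_def)

lemma regular_on_add: assumes "regular_on A f" "regular_on A f'" shows "regular_on A (\<lambda>e. f e + f' e)"
  unfolding regular_on_def
proof
  fix e assume e: "e \<in> A"
  from assms(1) e obtain g h where 1: "g \<in> poly_funs" "h \<in> poly_funs" "h e \<noteq> 0" "\<And>e'. e' \<in> A \<Longrightarrow> h e' \<noteq> 0 \<Longrightarrow> f e' = g e' / h e'"
    by (rule regular_on_E) (rule that)
  from assms(2) e obtain g' h' where 2: "g' \<in> poly_funs" "h' \<in> poly_funs" "h' e \<noteq> 0" "\<And>e'. e' \<in> A \<Longrightarrow> h' e' \<noteq> 0 \<Longrightarrow> f' e' = g' e' / h' e'"
    by (rule regular_on_E) (rule that)
  show "\<exists>g\<in>poly_funs. \<exists>h\<in>poly_funs. h e \<noteq> 0 \<and> (\<forall>e'\<in>A. h e' \<noteq> 0 \<longrightarrow> f e' + f' e' = g e' / h e')"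
    by (rule bexI[OF _ poly_funs.plus[OF poly_funs.times[OF 1(1) 2(2)] poly_funs.times[OF 2(1) 1(2)]]],
        rule bexI[OF _ poly_funs.times[OF 1(2) 2(2)]])
      (use 1 2 in \<open>simp add: field_simps\<close>)
qed

lemma regular_on_mult: assumes "regular_on A f" "regular_on A f'" shows "regular_on A (\<lambda>e. f e * f' e)"
  unfolding regular_on_def
proof
  fix e assume e: "e \<in> A"
  from assms(1) e obtain g h where 1: "g \<in> poly_funs" "h \<in> poly_funs" "h e \<noteq> 0" "\<And>e'. e' \<in> A \<Longrightarrow> h e' \<noteq> 0 \<Longrightarrow> f e' = g e' / h e'"
    by (rule regular_on_E) (rule that)
  from assms(2) e obtain g' h' where 2: "g' \<in> poly_funs" "h' \<in> poly_funs" "h' e \<noteq> 0" "\<And>e'. e' \<in> A \<Longrightarrow> h' e' \<noteq> 0 \<Longrightarrow> f' e' = g' e' / h' e'"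
    by (rule regular_on_E) (rule that)
  show "\<exists>g\<in>poly_funs. \<exists>h\<in>poly_funs. h e \<noteq> 0 \<and> (\<forall>e'\<in>A. h e' \<noteq> 0 \<longrightarrow> f e' * f' e' = g e' / h e')"
    by (rule bexI[OF _ poly_funs.times[OF 1(1) 2(1)]], rule bexI[OF _ poly_funs.times[OF 1(2) 2(2)]])
      (use 1 2 in simp)
qed

lemma regular_on_diff: "regular_on A f \<Longrightarrow> regular_on A f' \<Longrightarrow> regular_on A (\<lambda>e. f e - f' e)"
  using regular_on_add[of A f "\<lambda>e. (-1) * f' e"] regular_on_mult[of A "\<lambda>_. -1" f'] by simp

lemma regular_on_sum: "(\<And>a. a \<in> I \<Longrightarrow> regular_on A (f a)) \<Longrightarrow> regular_on A (\<lambda>e. \<Sum>a\<in>I. f a e)"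
  by (induction I rule: infinite_finite_induct) (simp_all add: regular_on_add)

lemma regular_on_inverse:
  assumes "g \<in> poly_funs" "\<And>e. e \<in> A \<Longrightarrow> g e \<noteq> 0"
  shows "regular_on A (\<lambda>e. inverse (g e))"
  unfolding regular_on_def
  by (intro ballI bexI[of _ "\<lambda>_. 1"] bexI[of _ g] poly_funs.const assms(1)) (auto simp: assms(2) field_simps)

text \<open>\<open>V\<close> carries no coordinates, so regularity of a vector-valued function is tested by linear functionals.\<close>

definition regular_vec :: "('v \<times> 'v) set \<Rightarrow> ('v \<times> 'v \<Rightarrow> 'v) \<Rightarrow> bool" where
  "regular_vec A X \<longleftrightarrow> (\<forall>f. Vector_Spaces.linear scale (*) f \<longrightarrow> regular_on A (\<lambda>e. f (X e)))"

lemma regular_vec_fst [simp]: "regular_vec A fst" and regular_vec_snd [simp]: "regular_vec A snd"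
  and regular_vec_const [simp]: "regular_vec A (\<lambda>_. c)"
  by (simp_all add: regular_vec_def regular_on_poly poly_funs.linear_fst poly_funs.linear_snd)

lemma regular_vec_scale: "regular_on A r \<Longrightarrow> regular_vec A X \<Longrightarrow> regular_vec A (\<lambda>e. r e *s X e)"
  and regular_vec_add: "regular_vec A X \<Longrightarrow> regular_vec A Y \<Longrightarrow> regular_vec A (\<lambda>e. X e + Y e)"
  by (simp_all add: regular_vec_def Vector_Spaces.linear_iff regular_on_mult regular_on_add)

lemma regular_vec_\<omega>: "regular_vec A X \<Longrightarrow> regular_on A (\<lambda>e. \<omega> c (X e))"
  using linear_right[of c] by (auto simp: regular_vec_def)

definition regular_coeffs :: "('v \<times> 'v) set \<Rightarrow> ('v \<times> 'v \<Rightarrow> ('k, 'v) form_poly) \<Rightarrow> bool" where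
  "regular_coeffs A s \<longleftrightarrow> (\<forall>i j vs. regular_on A (\<lambda>e. s e i j vs))"

lemma regular_coeffs_subset: "regular_coeffs A s \<Longrightarrow> B \<subseteq> A \<Longrightarrow> regular_coeffs B s"
  unfolding regular_coeffs_def by (blast intro: regular_on_subset)

lemma regular_coeffs_cong: "(\<And>e. e \<in> A \<Longrightarrow> s e = s' e) \<Longrightarrow> regular_coeffs A s \<longleftrightarrow> regular_coeffs A s'"
  unfolding regular_coeffs_def by (simp cong: regular_on_cong)

lemma regular_coeffs_add: "regular_coeffs A s \<Longrightarrow> regular_coeffs A s' \<Longrightarrow> regular_coeffs A (\<lambda>e. s e + s' e)"
  and regular_coeffs_diff: "regular_coeffs A s \<Longrightarrow> regular_coeffs A s' \<Longrightarrow> regular_coeffs A (\<lambda>e. s e - s' e)"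
  and regular_coeffs_scale: "regular_on A r \<Longrightarrow> regular_coeffs A s \<Longrightarrow> regular_coeffs A (\<lambda>e. scale_poly (r e) (s e))"
  by (simp_all add: regular_coeffs_def regular_on_add regular_on_diff scale_poly_def regular_on_mult)

lemma regular_coeffs_mult:
  assumes "regular_coeffs A s"
  shows "regular_coeffs A (\<lambda>e. mult_e1 (s e))" "regular_coeffs A (\<lambda>e. mult_e2 (s e))"
    "regular_coeffs A (\<lambda>e. deriv_e1 (s e))" "regular_coeffs A (\<lambda>e. deriv_e2 (s e))"
proof -
  have r: "regular_on A (\<lambda>e. s e i j vs)" for i j vs using assms by (simp add: regular_coeffs_def)
  have "regular_on A (\<lambda>e. mult_e1 (s e) i j vs)" "regular_on A (\<lambda>e. mult_e2 (s e) i j vs)" for i j vs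
    by (cases i; cases j; simp add: mult_e1_def mult_e2_def r)+
  moreover have "regular_on A (\<lambda>e. deriv_e1 (s e) i j vs)" "regular_on A (\<lambda>e. deriv_e2 (s e) i j vs)" for i j vs
    unfolding deriv_e1_def deriv_e2_def by (intro regular_on_mult r regular_on_const)+
  ultimately show "regular_coeffs A (\<lambda>e. mult_e1 (s e))" "regular_coeffs A (\<lambda>e. mult_e2 (s e))"
    "regular_coeffs A (\<lambda>e. deriv_e1 (s e))" "regular_coeffs A (\<lambda>e. deriv_e2 (s e))"
    by (simp_all add: regular_coeffs_def)
qed

lemma regular_coeffs_lef: "regular_coeffs A s \<Longrightarrow> regular_coeffs A (\<lambda>e. lef (s e))"
  unfolding regular_coeffs_def lef_def map_form_def wedge_\<omega>_def wedge_def
  by (intro allI regular_on_sum regular_on_mult regular_on_const) blast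

lemma regular_coeffs_eps:
  assumes X: "regular_vec A X" and "regular_coeffs A s"
  shows "regular_coeffs A (\<lambda>e. eps (X e) (s e))"
proof -
  have "regular_on A (\<lambda>e. contract (X e) \<omega>_form vs)" for vs
    using regular_vec_\<omega>[OF X] by (cases "length vs = 1") (simp_all add: contract_def \<omega>_form_def nth_append)
  then show ?thesis
    using assms(2) unfolding regular_coeffs_def eps_def map_form_def wedge_vec_def wedge_def
    by (intro allI regular_on_sum regular_on_mult regular_on_const) blast+
qed

subsection \<open>Change of frame\<close>

text \<open>\<open>transforms q a b c d k F F'\<close>: the polynomials \<open>F\<close> and \<open>F'\<close> are the coefficients of a section at a frame and at the frame transformed by the matrix \<open>(a, b; c, d)\<close>, up to the factor \<open>k\<close>.\<close>

definition transforms :: "nat \<Rightarrow> 'k \<Rightarrow> 'k \<Rightarrow> 'k \<Rightarrow> 'k \<Rightarrow> 'k \<Rightarrow> ('k, 'v) form_poly \<Rightarrow> ('k, 'v) form_poly \<Rightarrow> bool" where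
  "transforms q a b c d k F F' \<longleftrightarrow> (\<forall>X Y. eval_form_poly q F' (a * X + b * Y) (c * X + d * Y) =
     (\<lambda>vs. k * eval_form_poly q F X Y vs))"

lemma eval_add: "eval_form_poly q (F + G) X Y = eval_form_poly q F X Y + eval_form_poly q G X Y"
  and eval_diff: "eval_form_poly q (F - G) X Y = eval_form_poly q F X Y - eval_form_poly q G X Y"
  and eval_scale: "eval_form_poly q (scale_poly c F) X Y = (\<lambda>vs. c * eval_form_poly q F X Y vs)"
  by (simp_all add: eval_form_poly_def scale_poly_def fun_eq_iff algebra_simps sum.distrib
      sum_subtractf sum_distrib_left)

lemma eval_mult_e1: "eval_form_poly (Suc q) (mult_e1 F) X Y = (\<lambda>vs. X * eval_form_poly q F X Y vs)"
  unfolding eval_form_poly_def by (subst sum.atMost_Suc_shift) (simp add: mult_e1_def sum_distrib_left mult_ac)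

lemma eval_mult_e2: "eval_form_poly (Suc q) (mult_e2 F) X Y = (\<lambda>vs. Y * eval_form_poly q F X Y vs)"
  unfolding eval_form_poly_def
  by (simp add: mult_e2_def sum_distrib_left mult_ac) (auto intro!: ext sum.cong simp: Suc_diff_le mult_ac)

lemma transforms_add: "transforms q a b c d k F F' \<Longrightarrow> transforms q a b c d k G G' \<Longrightarrow> transforms q a b c d k (F + G) (F' + G')"
  and transforms_diff: "transforms q a b c d k F F' \<Longrightarrow> transforms q a b c d k G G' \<Longrightarrow> transforms q a b c d k (F - G) (F' - G')"
  and transforms_scale: "transforms q a b c d k F F' \<Longrightarrow> transforms q a b c d k (scale_poly r F) (scale_poly r F')"
  by (simp_all add: transforms_def eval_add eval_diff eval_scale fun_eq_iff algebra_simps)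

lemma transforms_scale_left: "transforms q a b c d k (scale_poly r F) F' \<longleftrightarrow> transforms q a b c d (k * r) F F'"
  by (simp add: transforms_def eval_scale mult_ac)

lemma transforms_mult_e1:
  "transforms q a b c d k F F' \<Longrightarrow> transforms (Suc q) a b c d k (scale_poly a (mult_e1 F) + scale_poly b (mult_e2 F)) (mult_e1 F')"
  and transforms_mult_e2:
  "transforms q a b c d k F F' \<Longrightarrow> transforms (Suc q) a b c d k (scale_poly c (mult_e1 F) + scale_poly d (mult_e2 F)) (mult_e2 F')"
  by (simp_all add: transforms_def eval_mult_e1 eval_mult_e2 eval_add eval_scale fun_eq_iff algebra_simps)

lemma transforms_map_form:
  assumes t: "transforms q a b c d k F F'"
    and add: "\<And>\<alpha> \<beta>. \<phi> (\<alpha> + \<beta>) = \<phi> \<alpha> + \<phi> \<beta>" and scl: "\<And>r \<alpha>. \<phi> (\<lambda>vs. r * \<alpha> vs) = (\<lambda>vs. r * \<phi> \<alpha> vs)"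
  shows "transforms q a b c d k (map_form \<phi> F) (map_form \<phi> F')"
proof -
  have zero: "\<phi> 0 = 0" using add[of 0 0] by simp
  have "\<phi> (eval_form_poly q G X Y) = eval_form_poly q (map_form \<phi> G) X Y" for G X Y
  proof -
    have ev: "eval_form_poly q G X Y = (\<Sum>i\<le>q. (\<lambda>vs. (X ^ i * Y ^ (q - i)) * G i (q - i) vs))" for G
    proof
      have "(\<Sum>i\<in>I. (\<lambda>vs. (X ^ i * Y ^ (q - i)) * G i (q - i) vs)) vs = (\<Sum>i\<in>I. (X ^ i * Y ^ (q - i)) * G i (q - i) vs)" for I vs
        by (induction I rule: infinite_finite_induct) simp_all
      then show "eval_form_poly q G X Y vs = (\<Sum>i\<le>q. (\<lambda>vs. (X ^ i * Y ^ (q - i)) * G i (q - i) vs)) vs" for vs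
        by (simp add: eval_form_poly_def mult_ac)
    qed
    show ?thesis
      unfolding ev using sum_comp_morphism[of \<phi>, OF zero add, of "\<lambda>i vs. (X ^ i * Y ^ (q - i)) * G i (q - i) vs" "{..q}"]
      by (simp add: o_def scl map_form_def)
  qed
  then show ?thesis using t by (simp add: transforms_def scl flip: \<open>\<And>G X Y. _ = eval_form_poly q (map_form \<phi> G) X Y\<close>)
qed

lemma transforms_iota: "transforms q a b c d k F F' \<Longrightarrow> transforms q a b c d k (iota z F) (iota z F')"
  and transforms_eps: "transforms q a b c d k F F' \<Longrightarrow> transforms q a b c d k (eps z F) (eps z F')"
  and transforms_lef: "transforms q a b c d k F F' \<Longrightarrow> transforms q a b c d k (lef F) (lef F')"
  unfolding iota_def eps_def lef_def
  by (rule transforms_map_form; simp add: contract_add contract_scale wedge_vec_add wedge_vec_scale wedge_\<omega>_add wedge_\<omega>_scale)+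

end

context symplectic_char_0
begin

text \<open>Restricting an identity of homogeneous polynomials to a line and differentiating along it gives the chain rule.\<close>

lemma transforms_deriv:
  assumes t: "transforms (Suc r) a b c d k F F'"
  shows "transforms r a b c d k (deriv_e1 F) (scale_poly a (deriv_e1 F') + scale_poly c (deriv_e2 F'))"
    and "transforms r a b c d k (deriv_e2 F) (scale_poly b (deriv_e1 F') + scale_poly d (deriv_e2 F'))"
proof -
  define line where "line G X Y U V vs = (\<Sum>i\<le>Suc r. Polynomial.smult (G i (Suc r - i) vs) ([:X, U:] ^ i * [:Y, V:] ^ (Suc r - i)))"
    for G :: "('k, 'v) form_poly" and X Y U V :: 'k and vs
  have poly_line: "poly (line G X Y U V vs) T = eval_form_poly (Suc r) G (X + T * U) (Y + T * V) vs" for G X Y U V vs T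
    by (simp add: line_def eval_form_poly_def poly_sum mult_ac del: power_Suc)
  have pderiv_line: "poly (pderiv (line G X Y U V vs)) 0 =
      U * eval_form_poly r (deriv_e1 G) X Y vs + V * eval_form_poly r (deriv_e2 G) X Y vs" for G X Y U V vs
  proof -
    have at_0: "poly [:Z, W:] 0 = Z" for Z W :: 'k by simp
    have pderiv_sum: "pderiv (\<Sum>i\<in>I. f i) = (\<Sum>i\<in>I. pderiv (f i))" for I and f :: "nat \<Rightarrow> 'k poly"
      using sum_comp_morphism[of pderiv f I] by (simp add: pderiv_add o_def)
    have 1: "pderiv (line G X Y U V vs) = (\<Sum>i\<le>Suc r. Polynomial.smult (G i (Suc r - i) vs)
        (pderiv ([:X, U:] ^ i) * [:Y, V:] ^ (Suc r - i) + [:X, U:] ^ i * pderiv ([:Y, V:] ^ (Suc r - i))))"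
      unfolding line_def pderiv_sum pderiv_smult pderiv_mult by (simp add: add.commute mult.commute)
    have "poly (pderiv (line G X Y U V vs)) 0 = (\<Sum>i\<le>Suc r. G i (Suc r - i) vs * (poly (pderiv ([:X, U:] ^ i)) 0 * Y ^ (Suc r - i))) +
        (\<Sum>i\<le>Suc r. G i (Suc r - i) vs * (X ^ i * poly (pderiv ([:Y, V:] ^ (Suc r - i))) 0))"
      by (simp only: 1 poly_sum poly_smult poly_add poly_mult poly_power at_0 distrib_left sum.distrib)
    also have "(\<Sum>i\<le>Suc r. G i (Suc r - i) vs * (poly (pderiv ([:X, U:] ^ i)) 0 * Y ^ (Suc r - i))) =
        U * eval_form_poly r (deriv_e1 G) X Y vs"
      unfolding eval_form_poly_def sum_distrib_left
      by (subst sum.atMost_Suc_shift) (simp add: pderiv_power_Suc pderiv_pCons deriv_e1_def mult_ac del: of_nat_Suc power_Suc)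
    also have "(\<Sum>i\<le>Suc r. G i (Suc r - i) vs * (X ^ i * poly (pderiv ([:Y, V:] ^ (Suc r - i))) 0)) =
        V * eval_form_poly r (deriv_e2 G) X Y vs"
      unfolding eval_form_poly_def sum_distrib_left sum.atMost_Suc
      by (auto intro!: sum.cong simp: Suc_diff_le pderiv_power_Suc pderiv_pCons deriv_e2_def mult_ac simp del: of_nat_Suc power_Suc)
    finally show ?thesis .
  qed
  have chain: "(a * U + b * V) * eval_form_poly r (deriv_e1 F') (a * X + b * Y) (c * X + d * Y) vs +
      (c * U + d * V) * eval_form_poly r (deriv_e2 F') (a * X + b * Y) (c * X + d * Y) vs =
      k * (U * eval_form_poly r (deriv_e1 F) X Y vs + V * eval_form_poly r (deriv_e2 F) X Y vs)" for U V X Y vs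
  proof -
    have "poly (line F' (a * X + b * Y) (c * X + d * Y) (a * U + b * V) (c * U + d * V) vs) T =
        poly (Polynomial.smult k (line F X Y U V vs)) T" for T
    proof -
      have e: "a * X + b * Y + T * (a * U + b * V) = a * (X + T * U) + b * (Y + T * V)"
        "c * X + d * Y + T * (c * U + d * V) = c * (X + T * U) + d * (Y + T * V)"
        by (simp_all add: algebra_simps)
      show ?thesis using t by (simp add: poly_line e transforms_def)
    qed
    then have "line F' (a * X + b * Y) (c * X + d * Y) (a * U + b * V) (c * U + d * V) vs = Polynomial.smult k (line F X Y U V vs)"
      by (simp add: fun_eq_iff flip: poly_eq_poly_eq_iff)
    then have "poly (pderiv (line F' (a * X + b * Y) (c * X + d * Y) (a * U + b * V) (c * U + d * V) vs)) 0 = k * poly (pderiv (line F X Y U V vs)) 0"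
      by (simp add: pderiv_smult)
    then show ?thesis by (simp only: pderiv_line)
  qed
  show "transforms r a b c d k (deriv_e1 F) (scale_poly a (deriv_e1 F') + scale_poly c (deriv_e2 F'))"
    using chain[of 1 0] by (simp add: transforms_def eval_add eval_scale fun_eq_iff)
  show "transforms r a b c d k (deriv_e2 F) (scale_poly b (deriv_e1 F') + scale_poly d (deriv_e2 F'))"
    using chain[of 0 1] by (simp add: transforms_def eval_add eval_scale fun_eq_iff)
qed

end

section \<open>Sections of the bundles and operators on them\<close>

context symplectic_space
begin

lemma zero_form_poly_eta [simp]: "(\<lambda>(i :: nat) (j :: nat) (vs :: 'v list). (0 :: 'k)) = 0"
  by (simp add: fun_eq_iff)

lemma independent_pair_iff:
  "x \<noteq> y \<and> independent {x, y} \<longleftrightarrow> (\<forall>s t. s *s x + t *s y = 0 \<longrightarrow> s = 0 \<and> t = 0)"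
proof
  assume L: "x \<noteq> y \<and> independent {x, y}"
  then have x: "x \<notin> span {y}" and y: "y \<noteq> 0" by (auto simp: independent_insert split: if_splits)
  show "\<forall>s t. s *s x + t *s y = 0 \<longrightarrow> s = 0 \<and> t = 0"
  proof (intro allI impI)
    fix s t assume st: "s *s x + t *s y = 0"
    have "s = 0"
    proof (rule ccontr)
      assume s: "s \<noteq> 0"
      have "s *s x = (- t) *s y" using st by (simp add: eq_neg_iff_add_eq_0)
      then have "(1 / s) *s (s *s x) = (1 / s) *s ((- t) *s y)" by simp
      then have "x = (- t / s) *s y" using s by simp
      then show False using x by (metis span_base span_scale insertI1)
    qed
    then show "s = 0 \<and> t = 0" using st y by auto
  qed
next
  assume R: "\<forall>s t. s *s x + t *s y = 0 \<longrightarrow> s = 0 \<and> t = 0"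
  have y: "y \<noteq> 0" using R[rule_format, of 0 1] by auto
  have ne: "x \<noteq> y" using R[rule_format, of 1 "-1"] by auto
  have "x \<notin> span {y}"
  proof
    assume "x \<in> span {y}"
    then obtain k where "x = k *s y" by (auto simp: span_singleton)
    then show False using R[rule_format, of 1 "- k"] by simp
  qed
  then show "x \<noteq> y \<and> independent {x, y}" using y ne by (auto simp: independent_insert)
qed

lemma span_pair: "span {x, y} = {s *s x + t *s y |s t. True}"
proof (intro equalityI subsetI)
  fix z assume "z \<in> span {x, y}"
  then obtain k where "z - k *s x \<in> span {y}" by (auto simp: span_insert)
  then obtain l where "z - k *s x = l *s y" by (auto simp: span_singleton)
  then have "z = k *s x + l *s y" by (simp add: algebra_simps)
  then show "z \<in> {s *s x + t *s y |s t. True}" by blast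
qed (auto intro: span_add span_scale span_base)

lemma frames_change:
  assumes det: "a * d - b * c \<noteq> 0" and e: "(x, y) \<in> frames W"
  shows "(a *s x + b *s y, c *s x + d *s y) \<in> frames W"
    and "frame_span (a *s x + b *s y, c *s x + d *s y) = frame_span (x, y)"
proof -
  let ?x = "a *s x + b *s y" and ?y = "c *s x + d *s y" and ?D = "a * d - b * c"
  have ind: "s = 0 \<and> t = 0" if "s *s x + t *s y = 0" for s t
    using e that independent_pair_iff[of x y] by (auto simp: frames_def)
  have comb: "s *s ?x + t *s ?y = (s * a + t * c) *s x + (s * b + t * d) *s y" for s t
    by (simp add: scale_right_distrib scale_left_distrib algebra_simps)
  have "s = 0 \<and> t = 0" if "s *s ?x + t *s ?y = 0" for s t
  proof -
    have 1: "s * a + t * c = 0" "s * b + t * d = 0" using ind that unfolding comb by blast+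
    have "s * ?D = d * (s * a + t * c) - c * (s * b + t * d)" "t * ?D = a * (s * b + t * d) - b * (s * a + t * c)"
      by (simp_all add: algebra_simps)
    then have "s * ?D = 0" "t * ?D = 0" unfolding 1 by simp_all
    then show ?thesis using det by simp
  qed
  then have indep: "?x \<noteq> ?y \<and> independent {?x, ?y}" by (simp add: independent_pair_iff)
  have sp: "span {?x, ?y} = span {x, y}"
  proof (rule span_eq[THEN iffD2], intro conjI subsetI)
    fix z assume "z \<in> {?x, ?y}" then show "z \<in> span {x, y}" by (auto simp: span_pair)
  next
    have "x = (d / ?D) *s ?x + (- b / ?D) *s ?y"
    proof -
      have "(d / ?D) * a + (- b / ?D) * c = ?D / ?D" "(d / ?D) * b + (- b / ?D) * d = 0"
        by (simp_all only: diff_divide_distrib) (simp_all add: mult.commute)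
      then show ?thesis unfolding comb using det by simp
    qed
    moreover have "y = (- c / ?D) *s ?x + (a / ?D) *s ?y"
    proof -
      have "(- c / ?D) * a + (a / ?D) * c = 0" "(- c / ?D) * b + (a / ?D) * d = ?D / ?D"
        by (simp_all only: diff_divide_distrib) (simp_all add: mult.commute)
      then show ?thesis unfolding comb using det by simp
    qed
    moreover fix z assume "z \<in> {x, y}"
    ultimately show "z \<in> span {?x, ?y}" unfolding span_pair by blast
  qed
  show "(?x, ?y) \<in> frames W" using e indep sp by (simp add: frames_def)
  show "frame_span (?x, ?y) = frame_span (x, y)" using sp by (simp add: frame_span_def)
qed

lemma frame_span_frames: "e \<in> frames W \<Longrightarrow> frame_span e \<in> W"
  by (cases e) (simp add: frames_def frame_span_def)

lemma frames_isotropic: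
  assumes "W \<subseteq> IGr" "(x, y) \<in> frames W" shows "\<omega> x y = 0"
proof -
  have "span {x, y} \<in> IGr" using assms by (auto simp: frames_def)
  then show ?thesis by (auto simp: IGr_def span_base)
qed

lemma frames_mono: "W \<subseteq> W' \<Longrightarrow> frames W \<subseteq> frames W'"
  by (auto simp: frames_def)

lemma sec_form_bundle_iff:
  "s \<in> sec (form_bundle p q m) W \<longleftrightarrow>
    (\<forall>e. e \<notin> frames W \<longrightarrow> s e = 0) \<and> (\<forall>e\<in>frames W. s e \<in> form_polys p q) \<and> regular_coeffs (frames W) s \<and>
    (\<forall>x y a b c d. (x, y) \<in> frames W \<longrightarrow> a * d - b * c \<noteq> 0 \<longrightarrow>
       transforms q a b c d ((a * d - b * c) ^ m) (s (x, y)) (s (a *s x + b *s y, c *s x + d *s y)))"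
  by (auto simp: form_bundle_def form_polys_def regular_coeffs_def transforms_def)

lemma sec_form_bundleI:
  assumes "\<And>e. e \<notin> frames W \<Longrightarrow> s e = 0" "\<And>e. e \<in> frames W \<Longrightarrow> s e \<in> form_polys p q"
    "regular_coeffs (frames W) s"
    "\<And>x y a b c d. (x, y) \<in> frames W \<Longrightarrow> (a *s x + b *s y, c *s x + d *s y) \<in> frames W \<Longrightarrow> a * d - b * c \<noteq> 0 \<Longrightarrow>
       transforms q a b c d ((a * d - b * c) ^ m) (s (x, y)) (s (a *s x + b *s y, c *s x + d *s y))"
  shows "s \<in> sec (form_bundle p q m) W"
  using assms frames_change(1) unfolding sec_form_bundle_iff by blast

lemma sec_outside: "s \<in> sec (form_bundle p q m) W \<Longrightarrow> e \<notin> frames W \<Longrightarrow> s e = 0"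
  and sec_form_polys: "s \<in> sec (form_bundle p q m) W \<Longrightarrow> e \<in> frames W \<Longrightarrow> s e \<in> form_polys p q"
  and sec_regular: "s \<in> sec (form_bundle p q m) W \<Longrightarrow> regular_coeffs (frames W) s"
  and sec_transforms: "s \<in> sec (form_bundle p q m) W \<Longrightarrow> (x, y) \<in> frames W \<Longrightarrow> a * d - b * c \<noteq> 0 \<Longrightarrow>
    transforms q a b c d ((a * d - b * c) ^ m) (s (x, y)) (s (a *s x + b *s y, c *s x + d *s y))"
  unfolding sec_form_bundle_iff by blast+

lemma transforms_zero: "transforms q a b c d k 0 0"
  by (simp add: transforms_def eval_form_poly_def fun_eq_iff)

lemma sec_zero: "0 \<in> sec (form_bundle p q m) W"
  by (rule sec_form_bundleI) (auto simp: transforms_zero regular_coeffs_def)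

lemma sec_add: "s \<in> sec (form_bundle p q m) W \<Longrightarrow> s' \<in> sec (form_bundle p q m) W \<Longrightarrow> (\<lambda>e. s e + s' e) \<in> sec (form_bundle p q m) W"
  by (rule sec_form_bundleI) (simp_all add: sec_outside sec_form_polys form_polys_add regular_coeffs_add sec_regular transforms_add sec_transforms)

lemma sec_diff: "s \<in> sec (form_bundle p q m) W \<Longrightarrow> s' \<in> sec (form_bundle p q m) W \<Longrightarrow> (\<lambda>e. s e - s' e) \<in> sec (form_bundle p q m) W"
  by (rule sec_form_bundleI) (simp_all add: sec_outside sec_form_polys form_polys_diff regular_coeffs_diff sec_regular transforms_diff sec_transforms)

lemma sec_scale: "s \<in> sec (form_bundle p q m) W \<Longrightarrow> (\<lambda>e. scale_poly r (s e)) \<in> sec (form_bundle p q m) W"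
  by (rule sec_form_bundleI) (simp_all add: sec_outside sec_form_polys form_polys_scale regular_coeffs_scale sec_regular transforms_scale sec_transforms)

lemma sec_lef: "s \<in> sec (form_bundle p q m) W \<Longrightarrow> (\<lambda>e. lef (s e)) \<in> sec (form_bundle (Suc (Suc p)) q m) W"
  by (rule sec_form_bundleI) (simp_all add: sec_outside sec_form_polys form_polys_lef lef_lin regular_coeffs_lef sec_regular transforms_lef sec_transforms)

end

context finite_symplectic_space
begin

text \<open>
  Contraction with a regular vector field is a combination, with regular coefficients, of the
  contractions with the finitely many vectors of a basis.
\<close>

lemma regular_coeffs_iota:
  assumes X: "regular_vec A X" and s: "regular_coeffs A s" and alt: "\<And>e. e \<in> A \<Longrightarrow> alternating_poly (s e)"
  shows "regular_coeffs A (\<lambda>e. iota (X e) (s e))"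
  unfolding regular_coeffs_def
proof (intro allI)
  fix i j vs
  have "iota (X e) (s e) i j vs = (\<Sum>b\<in>Bs. \<omega> (bd b) (X e) * s e i j (vs @ [b]))" if "e \<in> A" for e
  proof -
    have eval: "(\<Sum>b\<in>I. scale_poly (c b) (iota b (s e))) i j vs = (\<Sum>b\<in>I. c b * s e i j (vs @ [b]))" for I c
      by (induction I rule: infinite_finite_induct) (simp_all add: scale_poly_def iota_def map_form_def contract_def)
    have "iota (X e) (s e) = (\<Sum>b\<in>Bs. scale_poly (\<omega> (bd b) (X e)) (iota b (s e)))"
      by (subst iota_vec_sum[OF alt[OF that], symmetric]) (simp add: expand_Bs)
    then show ?thesis by (simp add: eval)
  qed
  moreover have "regular_on A (\<lambda>e. \<Sum>b\<in>Bs. \<omega> (bd b) (X e) * s e i j (vs @ [b]))"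
    using s by (intro regular_on_sum regular_on_mult regular_vec_\<omega>[OF X]) (simp add: regular_coeffs_def)
  ultimately show "regular_on A (\<lambda>e. iota (X e) (s e) i j vs)" by (simp cong: regular_on_cong)
qed

lemma regular_coeffs_Lam:
  assumes s: "regular_coeffs A s" and alt: "\<And>e. e \<in> A \<Longrightarrow> alternating_poly (s e)"
  shows "regular_coeffs A (\<lambda>e. Lam (s e))"
proof -
  have "regular_coeffs A (\<lambda>e. \<Sum>b\<in>I. iota (bd b) (iota b (s e)))" for I
  proof (induction I rule: infinite_finite_induct)
    case (insert b I)
    show ?case
      unfolding sum.insert[OF insert.hyps]
      by (intro regular_coeffs_add regular_coeffs_iota s regular_vec_const insert.IH) (simp_all add: alt)
  qed (simp_all add: regular_coeffs_def)
  then show ?thesis unfolding Lam_def by (intro regular_coeffs_scale regular_on_const)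
qed

lemma transforms_Lam:
  assumes "transforms q a b c d k F F'" shows "transforms q a b c d k (Lam F) (Lam F')"
proof -
  have "transforms q a b c d k (\<Sum>b\<in>I. iota (bd b) (iota b F)) (\<Sum>b\<in>I. iota (bd b) (iota b F'))" for I
  proof (induction I rule: infinite_finite_induct)
    case (insert b I)
    show ?case
      unfolding sum.insert[OF insert.hyps] by (intro transforms_add transforms_iota assms insert.IH)
  qed (simp_all add: transforms_zero)
  then show ?thesis unfolding Lam_def by (rule transforms_scale)
qed

lemma sec_alternating: "s \<in> sec (form_bundle p q m) W \<Longrightarrow> e \<in> frames W \<Longrightarrow> alternating_poly (s e)"
  by (rule form_polys_alternating[OF sec_form_polys])

lemma sec_Lam:
  assumes s: "s \<in> sec (form_bundle p q m) W" shows "(\<lambda>e. Lam (s e)) \<in> sec (form_bundle (p - 2) q m) W"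
  by (rule sec_form_bundleI)
    (use s in \<open>simp_all add: sec_outside sec_form_polys form_polys_Lam Lam_lin regular_coeffs_Lam sec_alternating sec_regular transforms_Lam sec_transforms\<close>)

lemma exd_frame:
  "exd (a *s x + b *s y) (c *s x + d *s y) F =
    eps x (scale_poly a (deriv_e1 F) + scale_poly c (deriv_e2 F)) + eps y (scale_poly b (deriv_e1 F) + scale_poly d (deriv_e2 F))"
  by (simp add: exd_def eps_vec_add eps_vec_scale op_lin)

lemma con_frame:
  "alternating_poly F \<Longrightarrow> con (a *s x + b *s y) (c *s x + d *s y) F =
    iota x (scale_poly a (deriv_e1 F) + scale_poly c (deriv_e2 F)) + iota y (scale_poly b (deriv_e1 F) + scale_poly d (deriv_e2 F))"
  by (simp add: con_def iota_vec_add iota_vec_scale op_lin)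

lemma d0_frame:
  "alternating_poly F \<Longrightarrow> d0 (a *s x + b *s y, c *s x + d *s y) F =
    iota x (scale_poly a (mult_e2 F) - scale_poly c (mult_e1 F)) + iota y (scale_poly b (mult_e2 F) - scale_poly d (mult_e1 F))"
  by (simp add: d0_eq iota_vec_add iota_vec_scale op_lin)

lemma d0_lin: "d0 e 0 = 0" "d0 e (F + G) = d0 e F + d0 e G" "d0 e (F - G) = d0 e F - d0 e G"
  "d0 e (- F) = - d0 e F" "d0 e (scale_poly c F) = scale_poly c (d0 e F)"
  by (cases e; simp add: d0_eq op_lin)+

lemma transforms_exd:
  assumes t: "transforms q a b c d k F F'" and F: "F \<in> form_polys p q" "F' \<in> form_polys p q"
  shows "transforms (q - 1) a b c d k (exd x y F) (exd (a *s x + b *s y) (c *s x + d *s y) F')"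
proof (cases q)
  case 0
  then show ?thesis using F deriv_degree_0 by (simp add: exd_def eps_lin transforms_zero)
next
  case (Suc r)
  show ?thesis
    unfolding exd_frame using transforms_deriv[OF t[unfolded Suc]]
    by (simp add: Suc exd_def[of x y F] transforms_add transforms_eps)
qed

lemma transforms_con:
  assumes t: "transforms q a b c d k F F'" and F: "F \<in> form_polys p q" "F' \<in> form_polys p q"
  shows "transforms (q - 1) a b c d k (con x y F) (con (a *s x + b *s y) (c *s x + d *s y) F')"
proof (cases q)
  case 0
  then show ?thesis using F deriv_degree_0 by (simp add: con_def iota_lin transforms_zero)
next
  case (Suc r)
  show ?thesis
    unfolding con_frame[OF form_polys_alternating[OF F(2)]] using transforms_deriv[OF t[unfolded Suc]]
    by (simp add: Suc con_def[of x y F] transforms_add transforms_iota)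
qed

lemma transforms_d0:
  assumes t: "transforms q a b c d k F F'" and F: "alternating_poly F'"
  shows "transforms (Suc q) a b c d (k * (a * d - b * c)) (d0 (x, y) F) (d0 (a *s x + b *s y, c *s x + d *s y) F')"
proof -
  note m1 = transforms_mult_e1[OF t] and m2 = transforms_mult_e2[OF t]
  have "transforms (Suc q) a b c d k
     (iota x (scale_poly a (scale_poly c (mult_e1 F) + scale_poly d (mult_e2 F)) - scale_poly c (scale_poly a (mult_e1 F) + scale_poly b (mult_e2 F))) +
      iota y (scale_poly b (scale_poly c (mult_e1 F) + scale_poly d (mult_e2 F)) - scale_poly d (scale_poly a (mult_e1 F) + scale_poly b (mult_e2 F))))
     (d0 (a *s x + b *s y, c *s x + d *s y) F')"
    unfolding d0_frame[OF F]
    by (intro transforms_add transforms_iota transforms_diff transforms_scale m1 m2)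
  also have "scale_poly a (scale_poly c (mult_e1 F) + scale_poly d (mult_e2 F)) - scale_poly c (scale_poly a (mult_e1 F) + scale_poly b (mult_e2 F)) =
      scale_poly (a * d - b * c) (mult_e2 F)"
    by (simp add: scale_poly_def fun_eq_iff algebra_simps)
  also have "scale_poly b (scale_poly c (mult_e1 F) + scale_poly d (mult_e2 F)) - scale_poly d (scale_poly a (mult_e1 F) + scale_poly b (mult_e2 F)) =
      scale_poly (- (a * d - b * c)) (mult_e1 F)"
    by (simp add: scale_poly_def fun_eq_iff algebra_simps)
  also have "iota x (scale_poly (a * d - b * c) (mult_e2 F)) + iota y (scale_poly (- (a * d - b * c)) (mult_e1 F)) =
      scale_poly (a * d - b * c) (d0 (x, y) F)"
    by (simp add: d0_eq op_lin) (simp add: scale_poly_def fun_eq_iff algebra_simps)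
  finally show ?thesis by (simp only: transforms_scale_left)
qed

lemma sec_d0:
  assumes s: "s \<in> sec (form_bundle p q m) W"
  shows "(\<lambda>e. d0 e (s e)) \<in> sec (form_bundle (p - 1) (Suc q) (Suc m)) W"
proof (rule sec_form_bundleI)
  show "d0 e (s e) = 0" if "e \<notin> frames W" for e using that s by (simp add: sec_outside d0_lin)
  show "d0 e (s e) \<in> form_polys (p - 1) (Suc q)" if "e \<in> frames W" for e
    using sec_form_polys[OF s that] by (cases e) (auto simp: d0_eq simp del: One_nat_def intro!: form_polys_diff form_polys_iota form_polys_mult)
  have "(\<lambda>e. d0 e (s e)) = (\<lambda>e. iota (fst e) (mult_e2 (s e)) - iota (snd e) (mult_e1 (s e)))"
    by (rule ext) (metis d0_eq prod.collapse)
  then show "regular_coeffs (frames W) (\<lambda>e. d0 e (s e))"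
    by (auto intro!: regular_coeffs_diff regular_coeffs_iota regular_coeffs_mult sec_regular[OF s] alternating_poly_ops sec_alternating[OF s])
qed (use transforms_d0[OF sec_transforms[OF s] sec_alternating[OF s]] in \<open>simp add: mult.commute\<close>)

lemma sec_exd:
  assumes s: "s \<in> sec (form_bundle p q m) W"
  shows "(\<lambda>e. exd (fst e) (snd e) (s e)) \<in> sec (form_bundle (Suc p) (q - 1) m) W"
proof (rule sec_form_bundleI)
  show "exd (fst e) (snd e) (s e) = 0" if "e \<notin> frames W" for e using that s by (simp add: sec_outside op_lin_1)
  show "exd (fst e) (snd e) (s e) \<in> form_polys (Suc p) (q - 1)" if "e \<in> frames W" for e
    using sec_form_polys[OF s that] by (rule form_polys_exd)
  show "regular_coeffs (frames W) (\<lambda>e. exd (fst e) (snd e) (s e))"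
    unfolding exd_def
    by (intro regular_coeffs_add regular_coeffs_eps regular_coeffs_mult sec_regular[OF s] regular_vec_fst regular_vec_snd)
qed (use transforms_exd[OF sec_transforms[OF s] sec_form_polys[OF s] sec_form_polys[OF s]] in simp)

lemma sec_con:
  assumes s: "s \<in> sec (form_bundle p q m) W"
  shows "(\<lambda>e. con (fst e) (snd e) (s e)) \<in> sec (form_bundle (p - 1) (q - 1) m) W"
proof (rule sec_form_bundleI)
  show "con (fst e) (snd e) (s e) = 0" if "e \<notin> frames W" for e using that s by (simp add: sec_outside op_lin_1)
  show "con (fst e) (snd e) (s e) \<in> form_polys (p - 1) (q - 1)" if "e \<in> frames W" for e
    using sec_form_polys[OF s that] by (rule form_polys_con)
  show "regular_coeffs (frames W) (\<lambda>e. con (fst e) (snd e) (s e))"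
    unfolding con_def
    by (intro regular_coeffs_add regular_coeffs_iota regular_coeffs_mult sec_regular[OF s] regular_vec_fst regular_vec_snd)
      (simp_all add: sec_alternating[OF s])
qed (use transforms_con[OF sec_transforms[OF s] sec_form_polys[OF s] sec_form_polys[OF s]] in simp)

end

section \<open>Homotopies over an open set with a complementary isotropic plane\<close>

context finite_symplectic_space
begin

context
  fixes a b c d :: 'k and x y g h g' h' :: 'v and F F' :: "('k, 'v) form_poly"
  assumes g: "g = a *s g' + c *s h'" and h: "h = b *s g' + d *s h'"
    and alt: "alternating_poly F" "alternating_poly F'"
begin

lemma transforms_kos:
  assumes t: "transforms q a b c d k F F'"
  shows "transforms (Suc q) a b c d k (kos g h F) (kos g' h' F')"
proof -
  have "transforms (Suc q) a b c d k
     (iota g' (scale_poly a (mult_e1 F) + scale_poly b (mult_e2 F)) + iota h' (scale_poly c (mult_e1 F) + scale_poly d (mult_e2 F)))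
     (kos g' h' F')"
    unfolding kos_def by (intro transforms_add transforms_iota transforms_mult_e1 transforms_mult_e2 t)
  moreover have "iota g' (scale_poly a (mult_e1 F) + scale_poly b (mult_e2 F)) + iota h' (scale_poly c (mult_e1 F) + scale_poly d (mult_e2 F)) = kos g h F"
    using alt by (simp add: kos_def g h iota_vec_add iota_vec_scale op_lin)
  ultimately show ?thesis by simp
qed

lemma transforms_theta:
  assumes t: "transforms q a b c d k F F'"
  shows "transforms (Suc q) a b c d k (theta g h F) (theta g' h' F')"
proof -
  have th: "theta g h F = scale_poly (- 1) (eps g (mult_e1 F) + eps h (mult_e2 F))" for g h F
    by (simp add: theta_def scale_poly_minus_1)
  have "transforms (Suc q) a b c d k
     (scale_poly (- 1) (eps g' (scale_poly a (mult_e1 F) + scale_poly b (mult_e2 F)) + eps h' (scale_poly c (mult_e1 F) + scale_poly d (mult_e2 F))))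
     (theta g' h' F')"
    unfolding th by (intro transforms_scale transforms_add transforms_eps transforms_mult_e1 transforms_mult_e2 t)
  moreover have "eps g' (scale_poly a (mult_e1 F) + scale_poly b (mult_e2 F)) + eps h' (scale_poly c (mult_e1 F) + scale_poly d (mult_e2 F)) =
      eps g (mult_e1 F) + eps h (mult_e2 F)"
    by (simp add: g h eps_vec_add eps_vec_scale op_lin)
  ultimately show ?thesis by (simp add: th)
qed

lemma num_frame: "num (a *s x + b *s y) (c *s x + d *s y) g' h' F' = num x y g h F'"
  using alt by (simp add: num_def g h eps_vec_add eps_vec_scale iota_vec_add iota_vec_scale op_lin)

lemma num_frame': "num h' (- g') (- (c *s x + d *s y)) (a *s x + b *s y) F' = num h (- g) (- y) x F'"
  unfolding num_def eps_vec_minus iota_vec_minus[OF alt(1)] iota_vec_minus[OF alt(2)]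
  using alt by (simp add: g h eps_vec_add eps_vec_scale iota_vec_add iota_vec_scale op_lin)

lemma lefW_frame: "lefW (a *s x + b *s y) (c *s x + d *s y) g' h' F' = lefW x y g h F'"
  by (simp add: lefW_def g h eps_vec_add eps_vec_scale op_lin)

lemma transforms_num: "transforms q a b c d k F F' \<Longrightarrow> transforms q a b c d k (num u\<^sub>1 u\<^sub>2 v\<^sub>1 v\<^sub>2 F) (num u\<^sub>1 u\<^sub>2 v\<^sub>1 v\<^sub>2 F')"
  unfolding num_def by (intro transforms_add transforms_eps transforms_iota)

lemma transforms_lefW: "transforms q a b c d k F F' \<Longrightarrow> transforms q a b c d k (lefW x y g h F) (lefW x y g h F')"
  unfolding lefW_def by (intro transforms_diff transforms_eps transforms_lef)

text \<open>
  The homotopy for \<open>d\<^sub>0\<close> pairs the derivations with the dual basis through the area form of \<open>U\<close>. This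
  costs one power of the determinant and is why it lowers the twist by one.
\<close>

lemma transforms_homotopy:
  assumes t: "transforms q a b c d k F F'" and FP: "F \<in> form_polys p q" "F' \<in> form_polys p q"
  shows "transforms (q - 1) a b c d k (exd h (- g) F) (scale_poly (a * d - b * c) (exd h' (- g') F'))"
proof (cases q)
  case 0
  then show ?thesis using FP deriv_degree_0 by (simp add: exd_def eps_lin transforms_zero)
next
  case (Suc r)
  note D = transforms_deriv[OF t[unfolded Suc]]
  have ex: "exd h (- g) F = eps h (deriv_e1 F) - eps g (deriv_e2 F)" for g h F
    by (simp add: exd_def eps_vec_minus)
  have "transforms r a b c d k
      (eps h' (scale_poly d (deriv_e1 F) - scale_poly c (deriv_e2 F)) - eps g' (scale_poly a (deriv_e2 F) - scale_poly b (deriv_e1 F)))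
      (eps h' (scale_poly d (scale_poly a (deriv_e1 F') + scale_poly c (deriv_e2 F')) - scale_poly c (scale_poly b (deriv_e1 F') + scale_poly d (deriv_e2 F'))) -
       eps g' (scale_poly a (scale_poly b (deriv_e1 F') + scale_poly d (deriv_e2 F')) - scale_poly b (scale_poly a (deriv_e1 F') + scale_poly c (deriv_e2 F'))))"
    by (intro transforms_diff transforms_eps transforms_scale D)
  moreover have "eps h' (scale_poly d (deriv_e1 F) - scale_poly c (deriv_e2 F)) - eps g' (scale_poly a (deriv_e2 F) - scale_poly b (deriv_e1 F)) = exd h (- g) F"
    unfolding ex[of h g F] by (simp add: g h eps_vec_add eps_vec_scale op_lin)
  moreover have "scale_poly d (scale_poly a (deriv_e1 F') + scale_poly c (deriv_e2 F')) - scale_poly c (scale_poly b (deriv_e1 F') + scale_poly d (deriv_e2 F')) = scale_poly (a * d - b * c) (deriv_e1 F')"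
    by (simp add: scale_poly_def fun_eq_iff algebra_simps)
  moreover have "scale_poly a (scale_poly b (deriv_e1 F') + scale_poly d (deriv_e2 F')) - scale_poly b (scale_poly a (deriv_e1 F') + scale_poly c (deriv_e2 F')) = scale_poly (a * d - b * c) (deriv_e2 F')"
    by (simp add: scale_poly_def fun_eq_iff algebra_simps)
  ultimately show ?thesis by (simp add: Suc ex eps_lin scale_poly_diff)
qed

end

end

text \<open>
  The operators of the preceding sections depend on a dual frame. Over an open set of planes that \<open>\<omega>\<close>
  pairs perfectly with a fixed isotropic plane \<open>\<langle>\<gamma>\<^sub>1, \<gamma>\<^sub>2\<rangle>\<close>, the dual basis in the latter is a regular
  function of the frame and is carried along by base changes, so that the operators act on sections.
\<close>

locale adapted_open = finite_symplectic_space scale \<omega> Bs bd n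
  for scale :: "'k::field_char_0 \<Rightarrow> 'v::ab_group_add \<Rightarrow> 'v" (infixr \<open>*s\<close> 75)
    and \<omega> :: "'v \<Rightarrow> 'v \<Rightarrow> 'k" and Bs bd n +
  fixes \<gamma>\<^sub>1 \<gamma>\<^sub>2 :: 'v and W :: "'v set set"
  assumes \<gamma>_isotropic: "\<omega> \<gamma>\<^sub>1 \<gamma>\<^sub>2 = 0" and W_IGr: "W \<subseteq> IGr"
    and nondegenerate_pairing: "\<And>e. e \<in> frames W \<Longrightarrow> \<omega> \<gamma>\<^sub>1 (fst e) * \<omega> \<gamma>\<^sub>2 (snd e) - \<omega> \<gamma>\<^sub>1 (snd e) * \<omega> \<gamma>\<^sub>2 (fst e) \<noteq> 0"
begin

definition disc :: "'v \<times> 'v \<Rightarrow> 'k" where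
  "disc e = \<omega> \<gamma>\<^sub>1 (fst e) * \<omega> \<gamma>\<^sub>2 (snd e) - \<omega> \<gamma>\<^sub>1 (snd e) * \<omega> \<gamma>\<^sub>2 (fst e)"

definition dual1 :: "'v \<times> 'v \<Rightarrow> 'v" where
  "dual1 e = (\<omega> \<gamma>\<^sub>2 (snd e) * inverse (disc e)) *s \<gamma>\<^sub>1 + (- 1 * \<omega> \<gamma>\<^sub>1 (snd e) * inverse (disc e)) *s \<gamma>\<^sub>2"

definition dual2 :: "'v \<times> 'v \<Rightarrow> 'v" where
  "dual2 e = (- 1 * \<omega> \<gamma>\<^sub>2 (fst e) * inverse (disc e)) *s \<gamma>\<^sub>1 + (\<omega> \<gamma>\<^sub>1 (fst e) * inverse (disc e)) *s \<gamma>\<^sub>2"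

lemma disc_nonzero: "e \<in> frames W \<Longrightarrow> disc e \<noteq> 0"
  using nondegenerate_pairing by (simp add: disc_def)

lemma dual_frame_dual: assumes "e \<in> frames W" shows "dual_frame (fst e) (snd e) (dual1 e) (dual2 e)"
proof -
  have iso: "\<omega> (fst e) (snd e) = 0" using frames_isotropic[OF W_IGr] assms by (metis prod.collapse)
  have \<gamma>: "\<omega> \<gamma>\<^sub>2 \<gamma>\<^sub>1 = 0" using \<omega>_skew[of \<gamma>\<^sub>2 \<gamma>\<^sub>1] \<gamma>_isotropic by simp
  have "\<omega> (dual1 e) (fst e) = disc e * inverse (disc e)" "\<omega> (dual2 e) (snd e) = disc e * inverse (disc e)"
    by (simp_all only: dual1_def dual2_def \<omega>_linear) (simp_all add: disc_def algebra_simps)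
  then have "\<omega> (dual1 e) (fst e) = 1" "\<omega> (dual2 e) (snd e) = 1" using disc_nonzero[OF assms] by simp_all
  moreover have "\<omega> (dual1 e) (snd e) = 0" "\<omega> (dual2 e) (fst e) = 0"
    by (simp_all only: dual1_def dual2_def \<omega>_linear) (simp_all add: algebra_simps)
  moreover have "\<omega> (dual1 e) (dual2 e) = 0"
    unfolding dual1_def dual2_def \<omega>_linear by (simp add: alternating \<gamma> \<gamma>_isotropic)
  ultimately show ?thesis using iso by (simp add: dual_frame_def)
qed

lemma regular_vec_dual: "regular_vec (frames W) dual1" "regular_vec (frames W) dual2"
proof -
  have poly: "disc \<in> poly_funs"
  proof -
    have "(\<lambda>e. \<omega> \<gamma>\<^sub>1 (fst e) * \<omega> \<gamma>\<^sub>2 (snd e) + - (\<omega> \<gamma>\<^sub>1 (snd e) * \<omega> \<gamma>\<^sub>2 (fst e))) \<in> poly_funs"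
      by (intro poly_funs.plus poly_funs.times poly_funs_uminus poly_funs_\<omega>)
    then show ?thesis by (simp add: disc_def[abs_def])
  qed
  have inv: "regular_on (frames W) (\<lambda>e. inverse (disc e))"
    by (rule regular_on_inverse[OF poly disc_nonzero])
  have \<omega>: "regular_on (frames W) (\<lambda>e. \<omega> c (fst e))" "regular_on (frames W) (\<lambda>e. \<omega> c (snd e))" for c
    by (rule regular_on_poly[OF poly_funs_\<omega>(1)] regular_on_poly[OF poly_funs_\<omega>(2)])+
  show "regular_vec (frames W) dual1" "regular_vec (frames W) dual2"
    unfolding dual1_def[abs_def] dual2_def[abs_def]
    by (intro regular_vec_add regular_vec_scale regular_vec_const regular_on_mult regular_on_const \<omega> inv)+
qed

lemma dual_change:
  assumes e: "(x, y) \<in> frames W" and det: "a * d - b * c \<noteq> 0"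
  defines "e' \<equiv> (a *s x + b *s y, c *s x + d *s y)"
  shows "dual1 (x, y) = a *s dual1 e' + c *s dual2 e'" "dual2 (x, y) = b *s dual1 e' + d *s dual2 e'"
proof -
  have D: "disc e' = (a * d - b * c) * disc (x, y)"
    by (simp add: disc_def e'_def \<omega>_linear algebra_simps)
  have nz: "disc (x, y) \<noteq> 0" by (rule disc_nonzero[OF e])
  have inv: "(a * d - b * c) * inverse (disc e') = inverse (disc (x, y))"
    using det nz by (simp add: D)
  have comb: "r *s (u *s \<gamma>\<^sub>1 + v *s \<gamma>\<^sub>2) + s *s (u' *s \<gamma>\<^sub>1 + v' *s \<gamma>\<^sub>2) = (r * u + s * u') *s \<gamma>\<^sub>1 + (r * v + s * v') *s \<gamma>\<^sub>2" for r s u v u' v'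
    by (simp add: scale_right_distrib scale_left_distrib algebra_simps)
  have 1: "\<omega> \<gamma>\<^sub>2 y * inverse (disc (x, y)) = a * (\<omega> \<gamma>\<^sub>2 (snd e') * inverse (disc e')) + c * (- 1 * \<omega> \<gamma>\<^sub>2 (fst e') * inverse (disc e'))"
    "- 1 * \<omega> \<gamma>\<^sub>1 y * inverse (disc (x, y)) = a * (- 1 * \<omega> \<gamma>\<^sub>1 (snd e') * inverse (disc e')) + c * (\<omega> \<gamma>\<^sub>1 (fst e') * inverse (disc e'))"
    "- 1 * \<omega> \<gamma>\<^sub>2 x * inverse (disc (x, y)) = b * (\<omega> \<gamma>\<^sub>2 (snd e') * inverse (disc e')) + d * (- 1 * \<omega> \<gamma>\<^sub>2 (fst e') * inverse (disc e'))"
    "\<omega> \<gamma>\<^sub>1 x * inverse (disc (x, y)) = b * (- 1 * \<omega> \<gamma>\<^sub>1 (snd e') * inverse (disc e')) + d * (\<omega> \<gamma>\<^sub>1 (fst e') * inverse (disc e'))"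
    unfolding inv[symmetric] by (simp_all add: e'_def \<omega>_linear algebra_simps)
  show "dual1 (x, y) = a *s dual1 e' + c *s dual2 e'" "dual2 (x, y) = b *s dual1 e' + d *s dual2 e'"
    unfolding dual1_def dual2_def comb by (simp_all only: 1 fst_conv snd_conv)
qed

lemma sec_kos:
  assumes s: "s \<in> sec (form_bundle p q m) W"
  shows "(\<lambda>e. kos (dual1 e) (dual2 e) (s e)) \<in> sec (form_bundle (p - 1) (Suc q) m) W"
proof (rule sec_form_bundleI)
  show "kos (dual1 e) (dual2 e) (s e) = 0" if "e \<notin> frames W" for e using that s by (simp add: sec_outside op_lin_1)
  show "kos (dual1 e) (dual2 e) (s e) \<in> form_polys (p - 1) (Suc q)" if "e \<in> frames W" for e
    by (rule form_polys_kos[OF sec_form_polys[OF s that]])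
  show "regular_coeffs (frames W) (\<lambda>e. kos (dual1 e) (dual2 e) (s e))"
    unfolding kos_def
    by (intro regular_coeffs_add regular_coeffs_iota regular_coeffs_mult sec_regular[OF s] regular_vec_dual)
      (simp_all add: sec_alternating[OF s])
qed (intro transforms_kos dual_change sec_alternating[OF s] sec_transforms[OF s])

lemma sec_theta:
  assumes s: "s \<in> sec (form_bundle p q m) W"
  shows "(\<lambda>e. theta (dual1 e) (dual2 e) (s e)) \<in> sec (form_bundle (Suc p) (Suc q) m) W"
proof (rule sec_form_bundleI)
  show "theta (dual1 e) (dual2 e) (s e) = 0" if "e \<notin> frames W" for e using that s by (simp add: sec_outside op_lin_2)
  show "theta (dual1 e) (dual2 e) (s e) \<in> form_polys (Suc p) (Suc q)" if "e \<in> frames W" for e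
    by (rule form_polys_theta[OF sec_form_polys[OF s that]])
  have "theta g h F = scale_poly (- 1) (eps g (mult_e1 F) + eps h (mult_e2 F))" for g h F
    by (simp add: theta_def scale_poly_minus_1)
  then show "regular_coeffs (frames W) (\<lambda>e. theta (dual1 e) (dual2 e) (s e))"
    by (simp only:) (intro regular_coeffs_scale regular_coeffs_add regular_coeffs_eps regular_coeffs_mult sec_regular[OF s] regular_vec_dual regular_on_const)
qed (intro transforms_theta dual_change sec_alternating[OF s] sec_transforms[OF s])

lemma sec_num:
  assumes s: "s \<in> sec (form_bundle p q m) W"
  shows "(\<lambda>e. num (fst e) (snd e) (dual1 e) (dual2 e) (s e)) \<in> sec (form_bundle p q m) W"
proof (rule sec_form_bundleI)
  show "num (fst e) (snd e) (dual1 e) (dual2 e) (s e) = 0" if "e \<notin> frames W" for e using that s by (simp add: sec_outside op_lin_1)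
  show "num (fst e) (snd e) (dual1 e) (dual2 e) (s e) \<in> form_polys p q" if "e \<in> frames W" for e
    by (rule form_polys_num[OF sec_form_polys[OF s that]])
  show "regular_coeffs (frames W) (\<lambda>e. num (fst e) (snd e) (dual1 e) (dual2 e) (s e))"
    unfolding num_def
    by (intro regular_coeffs_add regular_coeffs_eps regular_coeffs_iota sec_regular[OF s] regular_vec_dual regular_vec_fst regular_vec_snd)
      (simp_all add: sec_alternating[OF s])
  fix x y a b c d assume e: "(x, y) \<in> frames W" "(a *s x + b *s y, c *s x + d *s y) \<in> frames W" "a * d - b * c \<noteq> 0"
  show "transforms q a b c d ((a * d - b * c) ^ m) (num (fst (x, y)) (snd (x, y)) (dual1 (x, y)) (dual2 (x, y)) (s (x, y)))
     (num (fst (a *s x + b *s y, c *s x + d *s y)) (snd (a *s x + b *s y, c *s x + d *s y))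
       (dual1 (a *s x + b *s y, c *s x + d *s y)) (dual2 (a *s x + b *s y, c *s x + d *s y)) (s (a *s x + b *s y, c *s x + d *s y)))"
    unfolding fst_conv snd_conv num_frame[OF dual_change[OF e(1,3)] sec_alternating[OF s e(1)] sec_alternating[OF s e(2)]]
    by (rule transforms_num[OF dual_change[OF e(1,3)] sec_alternating[OF s e(1)] sec_alternating[OF s e(2)]], rule sec_transforms[OF s e(1,3)])
qed

lemma sec_num':
  assumes s: "s \<in> sec (form_bundle p q m) W"
  shows "(\<lambda>e. num (dual2 e) (- dual1 e) (- snd e) (fst e) (s e)) \<in> sec (form_bundle p q m) W"
proof (rule sec_form_bundleI)
  show "num (dual2 e) (- dual1 e) (- snd e) (fst e) (s e) = 0" if "e \<notin> frames W" for e using that s by (simp add: sec_outside op_lin_1)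
  show "num (dual2 e) (- dual1 e) (- snd e) (fst e) (s e) \<in> form_polys p q" if "e \<in> frames W" for e
    by (rule form_polys_num[OF sec_form_polys[OF s that]])
  have minus: "regular_vec A (\<lambda>e. - X e)" if "regular_vec A X" for A X
    using regular_vec_scale[OF regular_on_const[of A "- 1"] that] by simp
  show "regular_coeffs (frames W) (\<lambda>e. num (dual2 e) (- dual1 e) (- snd e) (fst e) (s e))"
    unfolding num_def
    by (intro regular_coeffs_add regular_coeffs_eps regular_coeffs_iota sec_regular[OF s] minus regular_vec_dual regular_vec_fst regular_vec_snd)
      (simp_all add: sec_alternating[OF s])
  fix x y a b c d assume e: "(x, y) \<in> frames W" "(a *s x + b *s y, c *s x + d *s y) \<in> frames W" "a * d - b * c \<noteq> 0"
  let ?e = "(a *s x + b *s y, c *s x + d *s y)"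
  show "transforms q a b c d ((a * d - b * c) ^ m) (num (dual2 (x, y)) (- dual1 (x, y)) (- snd (x, y)) (fst (x, y)) (s (x, y)))
     (num (dual2 ?e) (- dual1 ?e) (- snd ?e) (fst ?e) (s ?e))"
    unfolding fst_conv snd_conv num_frame'[OF dual_change[OF e(1,3)] sec_alternating[OF s e(1)] sec_alternating[OF s e(2)]]
    by (rule transforms_num[OF dual_change[OF e(1,3)] sec_alternating[OF s e(1)] sec_alternating[OF s e(2)]], rule sec_transforms[OF s e(1,3)])
qed

lemma sec_lefW:
  assumes s: "s \<in> sec (form_bundle p q m) W"
  shows "(\<lambda>e. lefW (fst e) (snd e) (dual1 e) (dual2 e) (s e)) \<in> sec (form_bundle (Suc (Suc p)) q m) W"
proof (rule sec_form_bundleI)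
  show "lefW (fst e) (snd e) (dual1 e) (dual2 e) (s e) = 0" if "e \<notin> frames W" for e using that s by (simp add: sec_outside op_lin_2)
  show "lefW (fst e) (snd e) (dual1 e) (dual2 e) (s e) \<in> form_polys (Suc (Suc p)) q" if "e \<in> frames W" for e
    by (rule form_polys_lefW[OF sec_form_polys[OF s that]])
  show "regular_coeffs (frames W) (\<lambda>e. lefW (fst e) (snd e) (dual1 e) (dual2 e) (s e))"
    unfolding lefW_def
    by (intro regular_coeffs_diff regular_coeffs_lef regular_coeffs_eps sec_regular[OF s] regular_vec_dual regular_vec_fst regular_vec_snd)
  fix x y a b c d assume e: "(x, y) \<in> frames W" "(a *s x + b *s y, c *s x + d *s y) \<in> frames W" "a * d - b * c \<noteq> 0"
  let ?e = "(a *s x + b *s y, c *s x + d *s y)"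
  show "transforms q a b c d ((a * d - b * c) ^ m) (lefW (fst (x, y)) (snd (x, y)) (dual1 (x, y)) (dual2 (x, y)) (s (x, y)))
     (lefW (fst ?e) (snd ?e) (dual1 ?e) (dual2 ?e) (s ?e))"
    unfolding fst_conv snd_conv lefW_frame[OF dual_change[OF e(1,3)] sec_alternating[OF s e(1)] sec_alternating[OF s e(2)]]
    by (rule transforms_lefW[OF dual_change[OF e(1,3)] sec_alternating[OF s e(1)] sec_alternating[OF s e(2)]], rule sec_transforms[OF s e(1,3)])
qed

lemma sec_homotopy:
  assumes s: "s \<in> sec (form_bundle p q (Suc m)) W"
  shows "(\<lambda>e. exd (dual2 e) (- dual1 e) (s e)) \<in> sec (form_bundle (Suc p) (q - 1) m) W"
proof (rule sec_form_bundleI)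
  show "exd (dual2 e) (- dual1 e) (s e) = 0" if "e \<notin> frames W" for e using that s by (simp add: sec_outside op_lin_1)
  show "exd (dual2 e) (- dual1 e) (s e) \<in> form_polys (Suc p) (q - 1)" if "e \<in> frames W" for e
    by (rule form_polys_exd[OF sec_form_polys[OF s that]])
  have minus: "regular_vec A (\<lambda>e. - X e)" if "regular_vec A X" for A X
    using regular_vec_scale[OF regular_on_const[of A "- 1"] that] by simp
  show "regular_coeffs (frames W) (\<lambda>e. exd (dual2 e) (- dual1 e) (s e))"
    unfolding exd_def
    by (intro regular_coeffs_add regular_coeffs_eps regular_coeffs_mult sec_regular[OF s] regular_vec_dual minus)
  fix x y a b c d assume e: "(x, y) \<in> frames W" "(a *s x + b *s y, c *s x + d *s y) \<in> frames W" "a * d - b * c \<noteq> 0"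
  let ?e = "(a *s x + b *s y, c *s x + d *s y)" and ?D = "a * d - b * c"
  have "transforms (q - 1) a b c d (?D ^ Suc m) (exd (dual2 (x, y)) (- dual1 (x, y)) (s (x, y))) (scale_poly ?D (exd (dual2 ?e) (- dual1 ?e) (s ?e)))"
    by (rule transforms_homotopy[OF dual_change[OF e(1,3)] sec_alternating[OF s e(1)] sec_alternating[OF s e(2)] sec_transforms[OF s e(1,3)]
          sec_form_polys[OF s e(1)] sec_form_polys[OF s e(2)]])
  then show "transforms (q - 1) a b c d (?D ^ m) (exd (dual2 (x, y)) (- dual1 (x, y)) (s (x, y))) (exd (dual2 ?e) (- dual1 ?e) (s ?e))"
    using e(3) by (simp add: transforms_def eval_scale fun_eq_iff mult.assoc)
qed

text \<open>
  As \<open>q\<close> is positive, \<open>q + num\<close> is invertible and the homotopy applies. The columns of the bicomplex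
  are thus exact away from their first term, and not only on stalks but for sections over \<open>W\<close>.
\<close>

lemma vertical_exact:
  assumes s: "s \<in> sec (form_bundle p q (Suc m)) W" and q: "q \<ge> 1" and zero: "vert W s = 0"
  shows "\<exists>u\<in>sec (form_bundle (Suc p) (q - 1) m) W. vert W u = s"
proof -
  let ?num = "\<lambda>e. num (dual2 e) (- dual1 e) (- snd e) (fst e)"
  let ?r = "\<lambda>e. resolvent q (dual2 e) (- dual1 e) (- snd e) (fst e) (s e)"
  let ?u = "\<lambda>e. scale_poly (1 / of_nat (q * (q + 1) * (q + 2))) (exd (dual2 e) (- dual1 e) (?r e))"
  have nz: "of_nat (q * (q + 1) * (q + 2)) \<noteq> (0 :: 'k)" using q by (simp only: of_nat_eq_0_iff) simp
  have "?r \<in> sec (form_bundle p q (Suc m)) W"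
    unfolding resolvent_def by (intro sec_add sec_diff sec_scale sec_num' s)
  then have u: "?u \<in> sec (form_bundle (Suc p) (q - 1) m) W"
    by (intro sec_scale sec_homotopy)
  moreover have "vert W ?u = s"
  proof
    fix e show "vert W ?u e = s e"
    proof (cases "e \<in> frames W")
      case False
      then show ?thesis using sec_outside[OF u] sec_outside[OF s] by (simp add: vert_def d0_lin(1))
    next
      case True
      have fr: "dual_frame (fst e) (snd e) (dual1 e) (dual2 e)" by (rule dual_frame_dual[OF True])
      have dual: "\<omega> (- snd e) (dual2 e) = 1" "\<omega> (- snd e) (- dual1 e) = 0" "\<omega> (fst e) (dual2 e) = 0" "\<omega> (fst e) (- dual1 e) = 1"
        using \<omega>_diff_left[of 0] \<omega>_diff_right[of _ 0] by (simp_all add: dual_frame_\<omega>[OF fr])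
      have F: "s e \<in> form_polys p q" by (rule sec_form_polys[OF s True])
      have "d0 (fst e, snd e) (s e) = 0" using fun_cong[OF zero, of e] by (simp add: vert_def)
      then have k0: "kos (- snd e) (fst e) (s e) = 0" by (simp only: d0_kos[OF form_polys_alternating[OF F]])
      have alt: "alternating_poly (?u e)" by (rule sec_alternating[OF u True])
      have "d0 (fst e, snd e) (?u e) = kos (- snd e) (fst e) (?u e)" by (rule d0_kos[OF alt])
      also have "\<dots> = s e"
        using nz by (simp only: op_lin_1 kos_exact[OF dual F k0] scale_poly_scale_poly) simp
      finally show ?thesis by (simp add: vert_def)
    qed
  qed
  ultimately show ?thesis by blast
qed

end

section \<open>Acyclicity over an adapted open set\<close>

context finite_symplectic_space
begin

definition annihilated :: "'v \<times> 'v \<Rightarrow> ('k, 'v) form_poly \<Rightarrow> bool" where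
  "annihilated e F \<longleftrightarrow> iota (fst e) F = 0 \<and> iota (snd e) F = 0"

lemma annihilated_lin:
  "annihilated e 0" "annihilated e F \<Longrightarrow> annihilated e G \<Longrightarrow> annihilated e (F + G)"
  "annihilated e F \<Longrightarrow> annihilated e G \<Longrightarrow> annihilated e (F - G)" "annihilated e F \<Longrightarrow> annihilated e (scale_poly c F)"
  by (simp_all add: annihilated_def op_lin)

lemma annihilated_d0: "annihilated e F \<Longrightarrow> d0 e F = 0"
  by (cases e) (simp add: annihilated_def d0_eq op_lin flip: form_ops_past_poly_ops(1,2))

lemma annihilated_con: "annihilated e F \<Longrightarrow> con (fst e) (snd e) F = 0"
  by (simp add: annihilated_def con_def op_lin flip: form_ops_past_poly_ops(3,4))

context
  fixes e :: "'v \<times> 'v" and g h :: 'v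
  assumes fr: "dual_frame (fst e) (snd e) g h"
begin

lemma annihilated_exd: "annihilated e F \<Longrightarrow> annihilated e (exd (fst e) (snd e) F)"
  by (simp add: annihilated_def exd_def op_lin iota_eps dual_frame_\<omega>[OF fr] flip: form_ops_past_poly_ops(3,4))

lemma annihilated_kos: "annihilated e F \<Longrightarrow> alternating_poly F \<Longrightarrow> annihilated e (kos g h F)"
  by (simp add: annihilated_def kos_def op_lin iota_swap[of _ _ g] iota_swap[of _ _ h] flip: form_ops_past_poly_ops(1,2))

lemma annihilated_num: "annihilated e F \<Longrightarrow> alternating_poly F \<Longrightarrow> annihilated e (num (fst e) (snd e) g h F)"
  by (simp add: annihilated_def num_def op_lin iota_eps dual_frame_\<omega>[OF fr] iota_swap[of _ _ g] iota_swap[of _ _ h])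

lemma annihilated_lefW: "annihilated e F \<Longrightarrow> annihilated e (lefW (fst e) (snd e) g h F)"
  by (simp add: annihilated_def iota_lefW[OF fr] op_lin_2)

lemma basic_projW: "annihilated e F \<Longrightarrow> alternating_poly F \<Longrightarrow> basic (fst e) (snd e) g h (projW (fst e) (snd e) g h F)"
  by (simp add: basic_def annihilated_def projW_iota[OF fr]) (simp add: projW_def op_lin_1)

text \<open>
  The differential of the complex of kernels becomes that of a cone of \<open>lefW\<close>: \<open>d\<^sub>1\<close> vanishes on the
  annihilated part \<open>F0\<close>, and its weight \<open>1 / (b + 1)\<close> cancels the scalar in \<open>con_theta\<close>.
\<close>

lemma twisted_differential:
  assumes F0: "annihilated e F0" and F1: "annihilated e F1" and deg: "F1 \<in> form_polys p r" "F1 = 0 \<or> b = Suc r"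
  shows "scale_poly (1 / of_nat (b + 1)) (lef (con (fst e) (snd e) (F0 + theta g h F1))) + exd (fst e) (snd e) (F0 + theta g h F1) =
    exd (fst e) (snd e) F0 + (lefW (fst e) (snd e) g h F1 - theta g h (exd (fst e) (snd e) F1))"
proof (cases "F1 = 0")
  case True
  then show ?thesis by (simp add: op_lin_1 op_lin_2 annihilated_con[OF F0] lef_lin)
next
  case False
  then have b: "b = Suc r" using deg by blast
  have z: "iota (fst e) F1 = 0" "iota (snd e) F1 = 0" using F1 by (simp_all add: annihilated_def)
  have nz: "of_nat (r + 2) \<noteq> (0 :: 'k)" by (simp only: of_nat_eq_0_iff)
  have "con (fst e) (snd e) (F0 + theta g h F1) = scale_poly (of_nat (r + 2)) F1"
    by (simp only: op_lin_1 annihilated_con[OF F0] con_theta[OF fr deg(1) z] add_0_left)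
  then have "scale_poly (1 / of_nat (b + 1)) (lef (con (fst e) (snd e) (F0 + theta g h F1))) = lef F1"
    using nz by (simp add: b lef_lin scale_poly_scale_poly)
  then show ?thesis using twisted_de_rham[OF fr z] by (simp add: op_lin_1 algebra_simps)
qed

end

end

context adapted_open
begin

text \<open>
  The Koszul operator for the dual frame inverts \<open>exd\<close> on closed sections; in polynomial degree \<open>0\<close>
  only the component on \<open>W\<close> is an obstruction. The primitive stays annihilated by the plane, hence in
  the same half of the cone.
\<close>

lemma poincare:
  assumes s: "s \<in> sec (form_bundle p q m) W"
    and closed: "\<And>e. e \<in> frames W \<Longrightarrow> exd (fst e) (snd e) (s e) = 0"
    and no_obstruction: "\<And>e. q = 0 \<Longrightarrow> e \<in> frames W \<Longrightarrow> projW (fst e) (snd e) (dual1 e) (dual2 e) (s e) = 0"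
    and ann: "\<And>e. e \<in> frames W \<Longrightarrow> annihilated e (s e)"
  shows "\<exists>w\<in>sec (form_bundle (p - 1) (Suc q) m) W. (\<forall>e\<in>frames W. exd (fst e) (snd e) (w e) = s e \<and> annihilated e (w e)) \<and> (p = 0 \<longrightarrow> w = 0)"
proof -
  define num' where "num' e = num (fst e) (snd e) (dual1 e) (dual2 e)" for e
  define r where "r e = (if q = 0 then scale_poly (1 / 2) (scale_poly 3 (s e) - num' e (s e))
    else scale_poly (1 / of_nat (q * (q + 1) * (q + 2))) (resolvent q (fst e) (snd e) (dual1 e) (dual2 e) (s e)))" for e
  define w where "w e = kos (dual1 e) (dual2 e) (r e)" for e
  have r: "r \<in> sec (form_bundle p q m) W"
  proof (cases "q = 0")
    case True
    have "(\<lambda>e. scale_poly (1 / 2) (scale_poly 3 (s e) - num' e (s e))) \<in> sec (form_bundle p q m) W"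
      unfolding num'_def by (intro sec_scale sec_diff sec_num s)
    then show ?thesis using True by (simp add: r_def[abs_def])
  next
    case False
    have "(\<lambda>e. scale_poly (1 / of_nat (q * (q + 1) * (q + 2))) (resolvent q (fst e) (snd e) (dual1 e) (dual2 e) (s e))) \<in> sec (form_bundle p q m) W"
      unfolding resolvent_def by (intro sec_scale sec_diff sec_add sec_num s)
    then show ?thesis using False by (simp add: r_def[abs_def] del: of_nat_mult of_nat_add)
  qed
  have w: "w \<in> sec (form_bundle (p - 1) (Suc q) m) W"
    unfolding w_def[abs_def] by (rule sec_kos[OF r])
  have exact: "exd (fst e) (snd e) (w e) = s e" if e: "e \<in> frames W" for e
  proof -
    have F: "s e \<in> form_polys p q" by (rule sec_form_polys[OF s e])
    have fr: "dual_frame (fst e) (snd e) (dual1 e) (dual2 e)" by (rule dual_frame_dual[OF e])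
    show ?thesis
    proof (cases "q = 0")
      case True
      have "exd (fst e) (snd e) (w e) = s e - projW (fst e) (snd e) (dual1 e) (dual2 e) (s e)"
        using exd_exact_degree_0[OF fr F[unfolded True]] True by (simp add: w_def r_def num'_def)
      then show ?thesis using no_obstruction[OF True e] by simp
    next
      case False
      then have nz: "of_nat (q * (q + 1) * (q + 2)) \<noteq> (0 :: 'k)" by (simp only: of_nat_eq_0_iff) simp
      have "exd (fst e) (snd e) (w e) = scale_poly (1 / of_nat (q * (q + 1) * (q + 2))) (scale_poly (of_nat (q * (q + 1) * (q + 2))) (s e))"
        using False by (simp only: w_def r_def if_False op_lin_1 exd_exact[OF dual_frame_\<omega>(9,10,11,12)[OF fr] F closed[OF e]])
      then show ?thesis using nz by (simp only: scale_poly_scale_poly) simp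
    qed
  qed
  have ann_w: "annihilated e (w e)" if e: "e \<in> frames W" for e
  proof -
    note fr = dual_frame_dual[OF e] and F = sec_form_polys[OF s e]
    note num = annihilated_num[OF fr, OF _ form_polys_alternating] form_polys_num
    have "annihilated e (r e)"
      unfolding r_def num'_def resolvent_def
      by (simp only: split: if_split) (intro conjI impI annihilated_lin num ann[OF e], (rule F)+)
    then show ?thesis unfolding w_def by (rule annihilated_kos[OF fr _ sec_alternating[OF r e]])
  qed
  have "w = 0" if "p = 0"
  proof
    fix e show "w e = 0 e"
    proof (cases "e \<in> frames W")
      case True
      have "r e \<in> form_polys 0 q" using sec_form_polys[OF r True] that by simp
      then show ?thesis using iota_degree_0[OF form_polys_mult(1)] iota_degree_0[OF form_polys_mult(2)] by (simp add: w_def kos_def)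
    qed (use sec_outside[OF w] in simp)
  qed
  with w exact ann_w show ?thesis by blast
qed

lemma sec_pow_Lam: "s \<in> sec (form_bundle p q m) W \<Longrightarrow> (\<lambda>e. (Lam ^^ k) (s e)) \<in> sec (form_bundle (p - 2 * k) q m) W"
proof (induction k)
  case (Suc k)
  have "(\<lambda>e. Lam ((Lam ^^ k) (s e))) \<in> sec (form_bundle (p - 2 * k - 2) q m) W"
    by (rule sec_Lam[OF Suc.IH[OF Suc.prems]])
  then show ?case by (simp add: diff_diff_left add.commute)
qed simp

lemma sec_pow_lefW:
  assumes "s \<in> sec (form_bundle p q m) W"
  shows "(\<lambda>e. (lefW (fst e) (snd e) (dual1 e) (dual2 e) ^^ k) (s e)) \<in> sec (form_bundle (p + 2 * k) q m) W"
proof (induction k)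
  case (Suc k)
  from sec_lefW[OF Suc] show ?case by simp
qed (use assms in simp)

text \<open>
  In degree \<open>n - 1\<close>, one above the middle, the sections \<open>T j = Lam\<^sup>j lefW\<^sup>j s\<close> vanish for large \<open>j\<close>, and
  \<open>lefW (Lam\<^bsup>j+1\<^esup> lefW\<^sup>j s) = T (j + 1) + (j + 1)\<^sup>2 T j\<close> turns a preimage of \<open>T (j + 1)\<close> into one of \<open>T j\<close>.
  Descending to \<open>T 0 = s\<close> produces a preimage that is again a section, which a count of dimensions in
  the fibers would not give.
\<close>

lemma lefschetz_surjective:
  assumes s: "s \<in> sec (form_bundle p q m) W" and p: "p + 1 = n"
    and basic: "\<And>e. e \<in> frames W \<Longrightarrow> basic (fst e) (snd e) (dual1 e) (dual2 e) (s e)"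
  shows "\<exists>w\<in>sec (form_bundle (p - 2) q m) W.
    (\<forall>e\<in>frames W. lefW (fst e) (snd e) (dual1 e) (dual2 e) (w e) = s e \<and> basic (fst e) (snd e) (dual1 e) (dual2 e) (w e)) \<and> (p < 2 \<longrightarrow> w = 0)"
proof -
  define L where "L e = lefW (fst e) (snd e) (dual1 e) (dual2 e)" for e
  define bas where "bas e = basic (fst e) (snd e) (dual1 e) (dual2 e)" for e
  define T where "T j e = (Lam ^^ j) ((L e ^^ j) (s e))" for j e
  have G: "(\<lambda>e. (L e ^^ j) (s e)) \<in> sec (form_bundle (p + 2 * j) q m) W" for j
    unfolding L_def by (rule sec_pow_lefW[OF s])
  have basG: "bas e ((L e ^^ j) (s e))" if "e \<in> frames W" for e j
    using basic[OF that] basic_lefW[OF dual_frame_dual[OF that]] by (induction j) (simp_all add: bas_def L_def)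
  have "\<exists>w\<in>sec (form_bundle (p - 2) q m) W. (\<forall>e\<in>frames W. L e (w e) = T j e \<and> bas e (w e)) \<and> (p < 2 \<longrightarrow> w = 0)" if "j \<le> n + 1" for j
    using that
  proof (induction rule: inc_induct)
    case base
    have "(L e ^^ (n + 1)) (s e) = 0" if "e \<in> frames W" for e
      by (rule form_polys_above_dimension[OF sec_form_polys[OF G that]]) simp
    moreover have "(Lam ^^ j) (0 :: ('k, 'v) form_poly) = 0" for j
      by (induction j) (simp_all only: funpow.simps o_apply id_apply Lam_lin)
    ultimately have "L e 0 = T (n + 1) e \<and> bas e 0" if "e \<in> frames W" for e
      using that by (simp only: T_def) (simp add: L_def op_lin_2 bas_def basic_def iota_lin)
    then show ?case by (intro bexI[of _ 0] sec_zero) simp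
  next
    case (step j)
    then obtain w where w: "w \<in> sec (form_bundle (p - 2) q m) W" "\<And>e. e \<in> frames W \<Longrightarrow> L e (w e) = T (Suc j) e \<and> bas e (w e)" "p < 2 \<Longrightarrow> w = 0"
      by blast
    define v where "v e = (Lam ^^ Suc j) ((L e ^^ j) (s e))" for e
    define u where "u e = scale_poly (1 / of_nat (Suc j * Suc j)) (v e - w e)" for e
    have v: "v \<in> sec (form_bundle (p - 2) q m) W"
    proof -
      have "v \<in> sec (form_bundle (p + 2 * j - 2 * Suc j) q m) W" unfolding v_def by (rule sec_pow_Lam[OF G])
      moreover have "p + 2 * j - 2 * Suc j = p - 2" by simp
      ultimately show ?thesis by (simp only:)
    qed
    then have u: "u \<in> sec (form_bundle (p - 2) q m) W"
      unfolding u_def by (intro sec_scale sec_diff w(1))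
    have "L e (u e) = T j e \<and> bas e (u e)" if e: "e \<in> frames W" for e
    proof
      let ?G = "(L e ^^ j) (s e)"
      have nz: "of_nat (Suc j * Suc j) \<noteq> (0 :: 'k)" by (simp only: of_nat_eq_0_iff) simp
      have c: "of_nat (Suc j) * (of_nat n - 2 - of_nat (p + 2 * j) + of_nat j) = (- of_nat (Suc j * Suc j) :: 'k)"
        by (simp add: p[symmetric] algebra_simps)
      have "L e (v e) = T (Suc j) e - scale_poly (- of_nat (Suc j * Suc j)) (T j e)"
        using lefW_Lam_pow[OF dual_frame_dual[OF e] sec_form_polys[OF G[of j] e] basG[OF e, of j, unfolded bas_def], of j]
        unfolding c by (simp only: v_def T_def L_def[of e, symmetric] funpow.simps o_apply)
      then have "L e (v e - w e) = scale_poly (of_nat (Suc j * Suc j)) (T j e)"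
        using w(2)[OF e] by (simp add: L_def op_lin_2 scale_poly_def fun_eq_iff del: of_nat_Suc of_nat_mult mult_Suc)
      then show "L e (u e) = T j e"
        using nz by (simp only: u_def L_def op_lin_2 scale_poly_scale_poly) simp
      have "bas e (v e)" unfolding v_def bas_def
        by (rule basic_Lam_pow[OF sec_form_polys[OF G e] basG[OF e, unfolded bas_def]])
      then show "bas e (u e)" using w(2)[OF e] by (simp add: u_def bas_def basic_def op_lin)
    qed
    moreover have "u = 0" if p2: "p < 2"
    proof
      fix e show "u e = 0 e"
      proof (cases "e \<in> frames W")
        case True
        have "v e = 0" unfolding v_def by (rule Lam_pow_low_degree[OF sec_form_polys[OF G True]]) (use p2 in simp)
        then show ?thesis using w(3)[OF p2] by (simp add: u_def)
      qed (use sec_outside[OF u] in simp)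
    qed
    ultimately show ?case using u by blast
  qed
  from this[of 0] show ?thesis by (simp add: T_def L_def bas_def)
qed

lemma E_diff_eq: "E_diff b W' s = (\<lambda>e. scale_poly (1 / of_nat (b + 1)) (lef (con (fst e) (snd e) (s e))) + exd (fst e) (snd e) (s e))"
proof -
  have "d1 e F = lef (con (fst e) (snd e) F)" "d2 e F = exd (fst e) (snd e) F" for e F
    by (metis d1_eq prod.collapse, metis d2_eq prod.collapse)
  then show ?thesis by (simp add: E_diff_def scale_poly_def fun_eq_iff)
qed

text \<open>
  Write \<open>z = z0 + \<theta> z1\<close>, so that closedness means \<open>D z1 = 0\<close> and \<open>D z0 = - L z1\<close>. A primitive
  \<open>w0 + \<theta> w1\<close> must satisfy \<open>D w1 = - z1\<close> and \<open>D w0 = z0 - L w1\<close>. The two equations are solved in this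
  order by \<open>poincare\<close>. Obstructions live in polynomial degree \<open>0\<close>: that of \<open>z1\<close>, for \<open>b = 1\<close>, is
  killed by \<open>L\<close> and vanishes as \<open>L\<close> is injective; that of \<open>z0 - L w1\<close>, for \<open>b = 0\<close>, is removed by
  the choice of \<open>w1\<close>, as \<open>L\<close> is surjective.
\<close>

lemma E_exact:
  assumes z: "z \<in> sec (form_bundle a b 0) W" and ab: "a + b + 1 = n" and vert: "vert W z = 0"
    and closed: "b \<ge> 1 \<Longrightarrow> E_diff b W z = 0"
  shows "\<exists>w\<in>sec (form_bundle (a - 1) (Suc b) 0) W. vert W w = 0 \<and> E_diff (Suc b) W w = z \<and> (a = 0 \<longrightarrow> w = 0)"
proof -
  define L where "L e = lefW (fst e) (snd e) (dual1 e) (dual2 e)" for e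
  define P where "P e = projW (fst e) (snd e) (dual1 e) (dual2 e)" for e
  define D where "D e = exd (fst e) (snd e)" for e
  define \<theta> where "\<theta> e = theta (dual1 e) (dual2 e)" for e
  define z1 where "z1 e = scale_poly (1 / of_nat (b + 1)) (con (fst e) (snd e) (z e))" for e
  define z0 where "z0 e = z e - \<theta> e (z1 e)" for e
  note fr = dual_frame_dual
  have z1: "z1 \<in> sec (form_bundle (a - 1) (b - 1) 0) W"
    unfolding z1_def by (intro sec_scale sec_con z)
  have z1_0: "z1 = 0" if "a = 0 \<or> b = 0"
  proof
    fix e show "z1 e = 0 e"
    proof (cases "e \<in> frames W")
      case True
      have F: "z e \<in> form_polys a b" by (rule sec_form_polys[OF z True])
      have "con (fst e) (snd e) (z e) = 0"
      proof (cases "b = 0")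
        case True then show ?thesis using F deriv_degree_0 by (simp add: con_def iota_lin)
      next
        case False
        then have "a = 0" using that by simp
        then show ?thesis using iota_degree_0[OF form_polys_deriv(1)] iota_degree_0[OF form_polys_deriv(2)] F by (simp add: con_def)
      qed
      then show ?thesis by (simp add: z1_def)
    qed (use sec_outside[OF z1] in simp)
  qed
  have z0: "z0 \<in> sec (form_bundle a b 0) W"
  proof (cases "a = 0 \<or> b = 0")
    case True
    then have "z0 = z" by (intro ext) (simp add: z0_def z1_0 \<theta>_def op_lin_2)
    then show ?thesis using z by simp
  next
    case False
    have "(\<lambda>e. \<theta> e (z1 e)) \<in> sec (form_bundle (Suc (a - 1)) (Suc (b - 1)) 0) W"
      unfolding \<theta>_def by (rule sec_theta[OF z1])
    then show ?thesis unfolding z0_def using False by (intro sec_diff z) simp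
  qed
  have ann: "annihilated e (z0 e)" "annihilated e (z1 e)" if e: "e \<in> frames W" for e
  proof -
    have "d0 (fst e, snd e) (z e) = 0" using fun_cong[OF vert, of e] by (simp add: vert_def)
    note * = iota_remainder_eq_0[OF fr[OF e] sec_form_polys[OF z e] this] iota_con_eq_0[OF fr[OF e] sec_form_polys[OF z e] this]
    show "annihilated e (z0 e)" using *(1,2) by (simp add: annihilated_def z0_def z1_def \<theta>_def)
    show "annihilated e (z1 e)" using *(3,4) by (simp add: annihilated_def z1_def op_lin)
  qed
  have dz: "D e (z1 e) = 0" "D e (z0 e) = - L e (z1 e)" if e: "e \<in> frames W" for e
  proof -
    have both: "D e (z1 e) = 0 \<and> D e (z0 e) = - L e (z1 e)"
    proof (cases "b = 0")
      case True
      have "z0 e \<in> form_polys a 0" using sec_form_polys[OF z0 e] True by simp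
      then show ?thesis using z1_0 True deriv_degree_0[of "z0 e"] by (simp add: D_def L_def op_lin_1 op_lin_2) (simp add: exd_def eps_lin)
    next
      case False
      have zz: "z0 e + \<theta> e (z1 e) = z e" by (simp add: z0_def)
      have "z1 e = 0 \<or> b = Suc (b - 1)" using False by simp
      note td = twisted_differential[OF fr[OF e] ann[OF e] sec_form_polys[OF z1 e] this]
      have E0: "E_diff b W z e = 0" using closed False by (simp add: Suc_le_eq)
      have "D e (z0 e) + (L e (z1 e) - \<theta> e (D e (z1 e))) = 0"
        unfolding L_def D_def \<theta>_def td[symmetric] using E0 zz by (simp add: E_diff_eq \<theta>_def)
      then have eq: "D e (z0 e) + L e (z1 e) = \<theta> e (D e (z1 e))" by (simp add: add_diff_eq)
      have aD: "annihilated e (D e (z0 e) + L e (z1 e))" "annihilated e (D e (z1 e))"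
        unfolding D_def L_def by (intro annihilated_lin annihilated_exd[OF fr[OF e]] annihilated_lefW[OF fr[OF e]] ann e)+
      have "iota (fst e) (\<theta> e (D e (z1 e))) = mult_e1 (D e (z1 e))"
        using aD(2) by (simp add: \<theta>_def iota_theta[OF fr[OF e]] annihilated_def op_lin_2)
      then have "mult_e1 (D e (z1 e)) = 0" using aD(1) unfolding eq by (simp add: annihilated_def)
      then have "D e (z1 e) = 0" by (rule mult_e1_eq_0D)
      then show ?thesis using eq by (simp add: \<theta>_def op_lin_2 eq_neg_iff_add_eq_0)
    qed
    then show "D e (z1 e) = 0" "D e (z0 e) = - L e (z1 e)" by blast+
  qed
  \<comment> \<open>For \<open>b = 0\<close> the equation \<open>D w1 = - z1\<close> is void, since \<open>z1 = 0\<close> and \<open>D\<close> vanishes in polynomial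
    degree \<open>0\<close>. So \<open>w1\<close> is free to remove the obstruction for \<open>w0\<close>.\<close>
  have "\<exists>w1\<in>sec (form_bundle (a - 2) b 0) W. (\<forall>e\<in>frames W. annihilated e (w1 e) \<and> D e (w1 e) = - z1 e \<and>
      (b = 0 \<longrightarrow> P e (z0 e - L e (w1 e)) = 0)) \<and> (a < 2 \<longrightarrow> w1 = 0)"
  proof (cases "b = 0")
    case True
    have a: "a + 1 = n" using ab True by simp
    have Pz: "(\<lambda>e. P e (z0 e)) \<in> sec (form_bundle a 0 0) W"
      unfolding P_def projW_def by (intro sec_diff sec_scale sec_num z0[unfolded True])
    have basP: "basic (fst e) (snd e) (dual1 e) (dual2 e) (P e (z0 e))" if e: "e \<in> frames W" for e
      unfolding P_def by (rule basic_projW[OF fr[OF e] ann(1)[OF e] sec_alternating[OF z0 e]])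
    from lefschetz_surjective[OF Pz a basP] obtain w1 where w1: "w1 \<in> sec (form_bundle (a - 2) 0 0) W" "a < 2 \<Longrightarrow> w1 = 0"
      "\<And>e. e \<in> frames W \<Longrightarrow> L e (w1 e) = P e (z0 e) \<and> basic (fst e) (snd e) (dual1 e) (dual2 e) (w1 e)"
      unfolding L_def by blast
    have "annihilated e (w1 e) \<and> D e (w1 e) = - z1 e \<and> P e (z0 e - L e (w1 e)) = 0" if e: "e \<in> frames W" for e
    proof (intro conjI)
      show "annihilated e (w1 e)" using w1(3)[OF e] by (simp add: basic_def annihilated_def)
      show "D e (w1 e) = - z1 e"
        using deriv_degree_0[OF sec_form_polys[OF w1(1) e]] z1_0 True by (simp add: D_def exd_def eps_lin)
      have lin: "P e (F - G) = P e F - P e G" for F G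
        by (simp add: P_def projW_def op_lin_1) (simp add: scale_poly_def fun_eq_iff algebra_simps)
      have "P e (L e (w1 e)) = L e (P e (w1 e))" unfolding P_def L_def by (rule projW_lefW[OF fr[OF e]])
      also have "P e (w1 e) = w1 e" unfolding P_def using w1(3)[OF e] by (intro projW_idem) (simp_all add: basic_def fr[OF e])
      finally show "P e (z0 e - L e (w1 e)) = 0" using w1(3)[OF e] by (simp add: lin)
    qed
    then show ?thesis using w1(1,2) unfolding True by blast
  next
    case False
    have no_obs: "P e (z1 e) = 0" if b: "b - 1 = 0" and e: "e \<in> frames W" for e
    proof (cases "a = 0")
      case True then show ?thesis using z1_0 by (simp add: P_def projW_def op_lin_1)
    next
      case a: False
      note lf = lefW_injective[OF fr[OF e] form_polys_projW[OF sec_form_polys[OF z1 e]] basic_projW[OF fr[OF e] ann(2)[OF e] sec_alternating[OF z1 e]]]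
      have "L e (P e (z1 e)) = P e (L e (z1 e))" unfolding P_def L_def by (rule projW_lefW[OF fr[OF e], symmetric])
      also have "L e (z1 e) = D e (- z0 e)" using dz(2)[OF e] by (simp add: D_def op_lin_1)
      also have "P e \<dots> = 0" unfolding P_def D_def by (rule projW_exd[OF fr[OF e]])
      finally show ?thesis unfolding P_def L_def by (intro lf) (use ab a b False in simp_all)
    qed
    have "\<exists>w\<in>sec (form_bundle (a - 1 - 1) (Suc (b - 1)) 0) W.
        (\<forall>e\<in>frames W. exd (fst e) (snd e) (w e) = z1 e \<and> annihilated e (w e)) \<and> (a - 1 = 0 \<longrightarrow> w = 0)"
    proof (rule poincare[OF z1])
      fix e assume e: "e \<in> frames W"
      show "exd (fst e) (snd e) (z1 e) = 0" using dz(1)[OF e] by (simp add: D_def)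
      show "annihilated e (z1 e)" by (rule ann(2)[OF e])
      show "projW (fst e) (snd e) (dual1 e) (dual2 e) (z1 e) = 0" if "b - 1 = 0"
        using no_obs[OF that e] by (simp add: P_def)
    qed
    then obtain v where v1: "v \<in> sec (form_bundle (a - 1 - 1) (Suc (b - 1)) 0) W"
      and v': "(\<forall>e\<in>frames W. exd (fst e) (snd e) (v e) = z1 e \<and> annihilated e (v e)) \<and> (a - 1 = 0 \<longrightarrow> v = 0)"
      by (rule bexE)
    have v3: "D e (v e) = z1 e \<and> annihilated e (v e)" if "e \<in> frames W" for e
      using conjunct1[OF v', rule_format, OF that] by (simp only: D_def)
    have v2: "v = 0" if "a < 2"
      using conjunct2[OF v'] that by simp
    note v = v1 v2 v3
    have eqs: "a - 1 - 1 = a - 2" "Suc (b - 1) = b" using False by simp_all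
    have "(\<lambda>e. scale_poly (- 1) (v e)) \<in> sec (form_bundle (a - 2) b 0) W"
      using v(1) unfolding eqs by (rule sec_scale)
    moreover have "annihilated e (scale_poly (- 1) (v e)) \<and> D e (scale_poly (- 1) (v e)) = - z1 e" if "e \<in> frames W" for e
      using v(3)[OF that] by (simp add: annihilated_def D_def op_lin op_lin_1 scale_poly_minus_1)
    moreover have "(\<lambda>e. scale_poly (- 1) (v e)) = 0" if "a < 2" using v(2)[OF that] by (simp add: fun_eq_iff scale_poly_def)
    ultimately show ?thesis using False by (intro bexI[of _ "\<lambda>e. scale_poly (- 1) (v e)"]) auto
  qed
  then obtain w1 where w1: "w1 \<in> sec (form_bundle (a - 2) b 0) W" "a < 2 \<Longrightarrow> w1 = 0"
    "\<And>e. e \<in> frames W \<Longrightarrow> annihilated e (w1 e)" "\<And>e. e \<in> frames W \<Longrightarrow> D e (w1 e) = - z1 e"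
    "\<And>e. e \<in> frames W \<Longrightarrow> b = 0 \<Longrightarrow> P e (z0 e - L e (w1 e)) = 0" by blast
  define y where "y e = z0 e - L e (w1 e)" for e
  have y: "y \<in> sec (form_bundle a b 0) W"
  proof (cases "a < 2")
    case True
    then have "w1 = 0" by (rule w1(2))
    then have "y = z0" by (intro ext) (simp add: y_def L_def op_lin_2)
    then show ?thesis using z0 by simp
  next
    case False
    then have a: "Suc (Suc (a - 2)) = a" by simp
    have "(\<lambda>e. L e (w1 e)) \<in> sec (form_bundle (Suc (Suc (a - 2))) b 0) W" unfolding L_def by (rule sec_lefW[OF w1(1)])
    then show ?thesis unfolding y_def a by (intro sec_diff z0)
  qed
  have "D e (y e) = 0" if e: "e \<in> frames W" for e
  proof -
    have "D e (L e (w1 e)) = L e (D e (w1 e))" unfolding D_def L_def by (rule exd_lefW[OF fr[OF e]])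
    moreover have "D e (F - G) = D e F - D e G" "L e (- F) = - L e F" for F G by (simp_all add: D_def L_def op_lin_1 op_lin_2)
    ultimately show ?thesis using w1(4)[OF e] dz(2)[OF e] by (simp add: y_def)
  qed
  moreover have "annihilated e (y e)" if e: "e \<in> frames W" for e
    unfolding y_def L_def by (intro annihilated_lin ann annihilated_lefW[OF fr[OF e]] w1(3) e)
  ultimately obtain w0 where w0: "w0 \<in> sec (form_bundle (a - 1) (Suc b) 0) W" "a = 0 \<Longrightarrow> w0 = 0"
    "\<And>e. e \<in> frames W \<Longrightarrow> D e (w0 e) = y e \<and> annihilated e (w0 e)"
    using poincare[OF y] w1(5) unfolding D_def P_def y_def by blast
  define w where "w e = w0 e + \<theta> e (w1 e)" for e
  have w: "w \<in> sec (form_bundle (a - 1) (Suc b) 0) W"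
  proof (cases "a < 2")
    case True
    then have "w1 = 0" by (rule w1(2))
    then have "w = w0" by (intro ext) (simp add: w_def \<theta>_def op_lin_2)
    then show ?thesis using w0 by simp
  next
    case False
    then have a: "Suc (a - 2) = a - 1" by simp
    have "(\<lambda>e. \<theta> e (w1 e)) \<in> sec (form_bundle (Suc (a - 2)) (Suc b) 0) W" unfolding \<theta>_def by (rule sec_theta[OF w1(1)])
    then show ?thesis unfolding w_def a by (intro sec_add w0(1))
  qed
  moreover have "vert W w = 0"
  proof
    fix e show "vert W w e = 0 e"
    proof (cases "e \<in> frames W")
      case True
      have "d0 (fst e, snd e) (\<theta> e (w1 e)) = 0"
        unfolding \<theta>_def using w1(3)[OF True] by (intro d0_theta[OF fr[OF True]]) (simp_all add: annihilated_def)
      then show ?thesis using annihilated_d0 w0(3)[OF True] by (simp add: vert_def w_def d0_lin)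
    qed (use sec_outside[OF w] in \<open>simp add: vert_def d0_lin\<close>)
  qed
  moreover have "E_diff (Suc b) W w = z"
  proof
    fix e show "E_diff (Suc b) W w e = z e"
    proof (cases "e \<in> frames W")
      case True
      have "E_diff (Suc b) W w e = D e (w0 e) + (L e (w1 e) - \<theta> e (D e (w1 e)))"
        using twisted_differential[OF fr[OF True] _ w1(3)[OF True] sec_form_polys[OF w1(1) True], of "w0 e" "Suc b"] w0(3)[OF True]
        by (simp add: E_diff_eq w_def D_def L_def \<theta>_def)
      then show ?thesis using w0(3)[OF True] w1(4)[OF True]
        by (simp add: y_def z0_def \<theta>_def op_lin_2)
    qed (use sec_outside[OF w] sec_outside[OF z] in \<open>simp add: E_diff_eq op_lin_1 lef_lin\<close>)
  qed
  moreover have "w = 0" if "a = 0"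
  proof -
    have "w0 = 0" "w1 = 0" using w0(2) w1(2) that by simp_all
    then show ?thesis by (intro ext) (simp add: w_def \<theta>_def op_lin_2)
  qed
  ultimately show ?thesis by blast
qed

end

section \<open>Sheaves of modules\<close>

lemma presheafD_sec:
  assumes "presheaf_of_modules T R M" "openin T W"
  shows "0 \<in> sec M W" "s \<in> sec M W \<Longrightarrow> s' \<in> sec M W \<Longrightarrow> s - s' \<in> sec M W" "s \<in> sec M W \<Longrightarrow> res M W s = s"
  using assms(1)[unfolded presheaf_of_modules_def, THEN conjunct1, rule_format, OF assms(2)] by simp_all

lemma presheafD_res:
  assumes "presheaf_of_modules T R M" "openin T W" "openin T W'" "W' \<subseteq> W"
  shows "s \<in> sec M W \<Longrightarrow> res M W' s \<in> sec M W'"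
    "s \<in> sec M W \<Longrightarrow> s' \<in> sec M W \<Longrightarrow> res M W' (s + s') = res M W' s + res M W' s'"
    "r \<in> R W \<Longrightarrow> s \<in> sec M W \<Longrightarrow> res M W' (act M r s) = act M r (res M W' s)"
    "openin T W'' \<Longrightarrow> W'' \<subseteq> W' \<Longrightarrow> s \<in> sec M W \<Longrightarrow> res M W'' (res M W' s) = res M W'' s"
  using assms(1)[unfolded presheaf_of_modules_def, THEN conjunct2, THEN conjunct1, rule_format, of W W'] assms(2-4)
  by simp_all

lemma presheafD_act:
  assumes "presheaf_of_modules T R M" "openin T W"
  shows "r \<in> R W \<Longrightarrow> s \<in> sec M W \<Longrightarrow> act M r s \<in> sec M W"
    "r \<in> R W \<Longrightarrow> r' \<in> R W \<Longrightarrow> s \<in> sec M W \<Longrightarrow> (\<forall>p\<in>W. r p = r' p) \<Longrightarrow> act M r s = act M r' s"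
    "r \<in> R W \<Longrightarrow> s \<in> sec M W \<Longrightarrow> s' \<in> sec M W \<Longrightarrow> act M r (s + s') = act M r s + act M r s'"
    "r \<in> R W \<Longrightarrow> r' \<in> R W \<Longrightarrow> s \<in> sec M W \<Longrightarrow> act M (\<lambda>p. r p + r' p) s = act M r s + act M r' s"
    "r \<in> R W \<Longrightarrow> r' \<in> R W \<Longrightarrow> s \<in> sec M W \<Longrightarrow> act M (\<lambda>p. r p * r' p) s = act M r (act M r' s)"
    "s \<in> sec M W \<Longrightarrow> act M (\<lambda>_. 1) s = s"
  using assms(1)[unfolded presheaf_of_modules_def, THEN conjunct2, THEN conjunct2, rule_format, OF assms(2)] by blast+

lemma presheaf_res_0:
  assumes M: "presheaf_of_modules T R M" and o: "openin T W" "openin T W'" "W' \<subseteq> W"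
  shows "res M W' 0 = 0"
  using presheafD_res(2)[OF M o presheafD_sec(1)[OF M o(1)] presheafD_sec(1)[OF M o(1)]] by simp

lemma presheaf_act_0:
  assumes M: "presheaf_of_modules T R M" and o: "openin T W" "r \<in> R W"
  shows "act M r 0 = 0"
  using presheafD_act(3)[OF M o presheafD_sec(1)[OF M o(1)] presheafD_sec(1)[OF M o(1)]] by simp

lemma presheaf_add:
  assumes M: "presheaf_of_modules T R M" and o: "openin T W" "s \<in> sec M W" "s' \<in> sec M W"
  shows "s + s' \<in> sec M W"
proof -
  have "0 - s' \<in> sec M W" by (rule presheafD_sec(2)[OF M o(1) presheafD_sec(1)[OF M o(1)] o(3)])
  from presheafD_sec(2)[OF M o(1,2) this] show ?thesis by simp
qed

lemma sheaf_presheaf: "sheaf_of_modules T R M \<Longrightarrow> presheaf_of_modules T R M"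
  by (simp add: sheaf_of_modules_def)

lemma ex1_unique: "\<exists>!x. P x \<Longrightarrow> P a \<Longrightarrow> P b \<Longrightarrow> a = b"
  by blast

lemma sheaf_glue:
  assumes "sheaf_of_modules T R M" "\<And>W. W \<in> \<W> \<Longrightarrow> openin T W" "\<And>W. W \<in> \<W> \<Longrightarrow> \<sigma> W \<in> sec M W"
    "\<And>W W'. W \<in> \<W> \<Longrightarrow> W' \<in> \<W> \<Longrightarrow> res M (W \<inter> W') (\<sigma> W) = res M (W \<inter> W') (\<sigma> W')"
  shows "\<exists>!s. s \<in> sec M (\<Union>\<W>) \<and> (\<forall>W\<in>\<W>. res M W s = \<sigma> W)"
  using assms(2-4)
  by (intro assms(1)[unfolded sheaf_of_modules_def, THEN conjunct2, THEN spec[of _ \<W>], THEN spec[of _ \<sigma>], THEN mp] conjI ballI) auto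

lemma sheaf_zero_sheaf: "sheaf_of_modules T R zero_sheaf"
proof -
  have "presheaf_of_modules T R zero_sheaf"
    by (simp add: presheaf_of_modules_def zero_sheaf_def)
  then show ?thesis
    unfolding sheaf_of_modules_def by (intro conjI allI impI ex1I[of _ 0]) (simp_all add: zero_sheaf_def)
qed

lemma sheaf_homD:
  assumes "sheaf_hom T R M N \<phi>"
  shows "openin T W \<Longrightarrow> s \<in> sec M W \<Longrightarrow> \<phi> W s \<in> sec N W"
    and "openin T W \<Longrightarrow> s \<in> sec M W \<Longrightarrow> s' \<in> sec M W \<Longrightarrow> \<phi> W (s + s') = \<phi> W s + \<phi> W s'"
    and "openin T W \<Longrightarrow> r \<in> R W \<Longrightarrow> s \<in> sec M W \<Longrightarrow> \<phi> W (act M r s) = act N r (\<phi> W s)"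
    and "openin T W \<Longrightarrow> openin T W' \<Longrightarrow> W' \<subseteq> W \<Longrightarrow> s \<in> sec M W \<Longrightarrow> res N W' (\<phi> W s) = \<phi> W' (res M W' s)"
  using assms[unfolded sheaf_hom_def, rule_format, of W] by simp_all

lemma sheaf_homI:
  assumes "\<And>W s. openin T W \<Longrightarrow> s \<in> sec M W \<Longrightarrow> \<phi> W s \<in> sec N W"
    and "\<And>W s s'. openin T W \<Longrightarrow> s \<in> sec M W \<Longrightarrow> s' \<in> sec M W \<Longrightarrow> \<phi> W (s + s') = \<phi> W s + \<phi> W s'"
    and "\<And>W r s. openin T W \<Longrightarrow> r \<in> R W \<Longrightarrow> s \<in> sec M W \<Longrightarrow> \<phi> W (act M r s) = act N r (\<phi> W s)"
    and "\<And>W W' s. openin T W \<Longrightarrow> openin T W' \<Longrightarrow> W' \<subseteq> W \<Longrightarrow> s \<in> sec M W \<Longrightarrow> res N W' (\<phi> W s) = \<phi> W' (res M W' s)"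
  shows "sheaf_hom T R M N \<phi>"
  unfolding sheaf_hom_def by (intro conjI allI impI ballI; (elim conjE)?; rule assms; assumption)

lemma sheaf_hom_0:
  assumes M: "presheaf_of_modules T R M" and \<phi>: "sheaf_hom T R M N \<phi>" and o: "openin T W"
  shows "\<phi> W 0 = 0"
  using sheaf_homD(2)[OF \<phi> o presheafD_sec(1)[OF M o] presheafD_sec(1)[OF M o]] by simp

lemma sheaf_hom_diff:
  assumes M: "presheaf_of_modules T R M" and \<phi>: "sheaf_hom T R M N \<phi>" and o: "openin T W" "s \<in> sec M W" "s' \<in> sec M W"
  shows "\<phi> W (s - s') = \<phi> W s - \<phi> W s'"
  using sheaf_homD(2)[OF \<phi> o(1) presheafD_sec(2)[OF M o] o(3)] by simp

lemma sheaf_hom_from_zero: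
  assumes "presheaf_of_modules T R N" "\<And>W. openin T W \<Longrightarrow> \<phi> W 0 = 0"
  shows "sheaf_hom T R zero_sheaf N \<phi>"
  by (rule sheaf_homI)
    (simp_all add: zero_sheaf_def assms presheafD_sec(1)[OF assms(1)] presheaf_res_0[OF assms(1)] presheaf_act_0[OF assms(1)])

lemma sheaf_hom_to_zero:
  assumes "presheaf_of_modules T R M" "\<And>W s. openin T W \<Longrightarrow> s \<in> sec M W \<Longrightarrow> \<phi> W s = 0"
  shows "sheaf_hom T R M zero_sheaf \<phi>"
  by (rule sheaf_homI)
    (simp_all add: zero_sheaf_def assms presheafD_res(1)[OF assms(1)] presheafD_act(1)[OF assms(1)] presheaf_add[OF assms(1)])

lemma kernel_sheaf_simps:
  "sec (kernel_sheaf M \<phi>) W = {s \<in> sec M W. \<phi> W s = 0}" "res (kernel_sheaf M \<phi>) = res M" "act (kernel_sheaf M \<phi>) = act M"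
  by (simp_all add: kernel_sheaf_def)

text \<open>
  Local sections of the kernel glue in \<open>M\<close>; that \<open>\<phi>\<close> kills the result follows from the uniqueness of
  gluing in \<open>N\<close>.
\<close>

lemma sheaf_kernel_sheaf:
  assumes M: "sheaf_of_modules T R M" and N: "sheaf_of_modules T R N" and \<phi>: "sheaf_hom T R M N \<phi>"
  shows "sheaf_of_modules T R (kernel_sheaf M \<phi>)"
proof -
  note pM = sheaf_presheaf[OF M] and pN = sheaf_presheaf[OF N]
  have "presheaf_of_modules T R (kernel_sheaf M \<phi>)"
    unfolding presheaf_of_modules_def kernel_sheaf_simps
  proof (intro conjI allI impI ballI; (elim conjE)?)
    fix W assume W: "openin T W"
    show "0 \<in> {s \<in> sec M W. \<phi> W s = 0}" using presheafD_sec(1)[OF pM W] sheaf_hom_0[OF pM \<phi> W] by simp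
    fix s assume "s \<in> {s \<in> sec M W. \<phi> W s = 0}"
    then have s: "s \<in> sec M W" "\<phi> W s = 0" by simp_all
    show "res M W s = s" by (rule presheafD_sec(3)[OF pM W s(1)])
    show "act M (\<lambda>_. 1) s = s" by (rule presheafD_act(6)[OF pM W s(1)])
    { fix s' assume "s' \<in> {s \<in> sec M W. \<phi> W s = 0}"
      then have s': "s' \<in> sec M W" "\<phi> W s' = 0" by simp_all
      show "s - s' \<in> {s \<in> sec M W. \<phi> W s = 0}"
        using presheafD_sec(2)[OF pM W s(1) s'(1)] sheaf_hom_diff[OF pM \<phi> W s(1) s'(1)] s(2) s'(2) by simp
      fix r assume r: "r \<in> R W"
      show "act M r (s + s') = act M r s + act M r s'" by (rule presheafD_act(3)[OF pM W r s(1) s'(1)]) }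
    fix r assume r: "r \<in> R W"
    show "act M r s \<in> {s \<in> sec M W. \<phi> W s = 0}"
      using presheafD_act(1)[OF pM W r s(1)] sheaf_homD(3)[OF \<phi> W r s(1)] s(2) presheaf_act_0[OF pN W r] by simp
    fix r' assume r': "r' \<in> R W"
    show "act M r s = act M r' s" if "\<forall>p\<in>W. r p = r' p" by (rule presheafD_act(2)[OF pM W r r' s(1) that])
    show "act M (\<lambda>p. r p + r' p) s = act M r s + act M r' s" by (rule presheafD_act(4)[OF pM W r r' s(1)])
    show "act M (\<lambda>p. r p * r' p) s = act M r (act M r' s)" by (rule presheafD_act(5)[OF pM W r r' s(1)])
  next
    fix W W' assume W: "openin T W" "openin T W'" "W' \<subseteq> W"
    fix s assume "s \<in> {s \<in> sec M W. \<phi> W s = 0}"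
    then have s: "s \<in> sec M W" "\<phi> W s = 0" by simp_all
    show "res M W' s \<in> {s \<in> sec M W'. \<phi> W' s = 0}"
      using presheafD_res(1)[OF pM W s(1)] sheaf_homD(4)[OF \<phi> W s(1)] s(2) presheaf_res_0[OF pN W] by simp
    show "res M W' (s + s') = res M W' s + res M W' s'" if "s' \<in> {s \<in> sec M W. \<phi> W s = 0}" for s'
      using that presheafD_res(2)[OF pM W s(1)] by simp
    show "res M W' (act M r s) = act M r (res M W' s)" if "r \<in> R W" for r
      by (rule presheafD_res(3)[OF pM W that s(1)])
    show "res M W'' (res M W' s) = res M W'' s" if "openin T W''" "W'' \<subseteq> W'" for W''
      by (rule presheafD_res(4)[OF pM W that s(1)])
  qed
  moreover have "\<exists>!s. s \<in> {s \<in> sec M (\<Union>\<W>). \<phi> (\<Union>\<W>) s = 0} \<and> (\<forall>W\<in>\<W>. res M W s = \<sigma> W)"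
    if \<sigma>: "\<forall>W\<in>\<W>. openin T W \<and> \<sigma> W \<in> {s \<in> sec M W. \<phi> W s = 0}"
      and compat: "\<forall>W\<in>\<W>. \<forall>W'\<in>\<W>. res M (W \<inter> W') (\<sigma> W) = res M (W \<inter> W') (\<sigma> W')" for \<W> \<sigma>
  proof -
    have U: "openin T (\<Union>\<W>)" using \<sigma> by blast
    have ex: "\<exists>!s. s \<in> sec M (\<Union>\<W>) \<and> (\<forall>W\<in>\<W>. res M W s = \<sigma> W)"
      by (rule sheaf_glue[OF M]) (use \<sigma> compat in auto)
    have "\<phi> (\<Union>\<W>) s = 0" if s: "s \<in> sec M (\<Union>\<W>)" "\<forall>W\<in>\<W>. res M W s = \<sigma> W" for s
    proof -
      have o: "openin T W" "W \<subseteq> \<Union>\<W>" if "W \<in> \<W>" for W using that \<sigma> by auto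
      have "\<exists>!u. u \<in> sec N (\<Union>\<W>) \<and> (\<forall>W\<in>\<W>. res N W u = 0)"
      proof (rule sheaf_glue[OF N, of \<W> "\<lambda>_. 0"])
        show "0 \<in> sec N W" if "W \<in> \<W>" for W by (rule presheafD_sec(1)[OF pN o(1)[OF that]])
      qed (use o in auto)
      moreover have "\<phi> (\<Union>\<W>) s \<in> sec N (\<Union>\<W>) \<and> (\<forall>W\<in>\<W>. res N W (\<phi> (\<Union>\<W>) s) = 0)"
        using sheaf_homD(1)[OF \<phi> U s(1)] sheaf_homD(4)[OF \<phi> U o s(1)] s(2) \<sigma> by auto
      moreover have "0 \<in> sec N (\<Union>\<W>) \<and> (\<forall>W\<in>\<W>. res N W 0 = 0)"
        using presheafD_sec(1)[OF pN U] presheaf_res_0[OF pN U o] by blast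
      ultimately show ?thesis by blast
    qed
    then show ?thesis using ex by blast
  qed
  ultimately show ?thesis
    unfolding sheaf_of_modules_def kernel_sheaf_simps by (intro conjI allI impI; (elim conjE)?; assumption?; simp only:)
qed

lemma direct_sum_sheaf_simps:
  "s \<in> sec (direct_sum_sheaf I M) W \<longleftrightarrow> (\<forall>i\<in>I. s i \<in> sec (M i) W) \<and> (\<forall>i. i \<notin> I \<longrightarrow> s i = 0)"
  "res (direct_sum_sheaf I M) W s i = (if i \<in> I then res (M i) W (s i) else 0)"
  "act (direct_sum_sheaf I M) r s i = (if i \<in> I then act (M i) r (s i) else 0)"
  by (simp_all add: direct_sum_sheaf_def)

lemma sheaf_direct_sum_sheaf:
  fixes M :: "'i \<Rightarrow> ('p, 'k::field, 's::ab_group_add) modsheaf"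
  assumes M: "\<And>i. i \<in> I \<Longrightarrow> sheaf_of_modules T R (M i)"
  shows "sheaf_of_modules T R (direct_sum_sheaf I M)"
proof -
  have p: "presheaf_of_modules T R (M i)" if "i \<in> I" for i by (rule sheaf_presheaf[OF M[OF that]])
  have "presheaf_of_modules T R (direct_sum_sheaf I M)"
    unfolding presheaf_of_modules_def
  proof (intro conjI allI impI ballI; (elim conjE)?)
    have si: "s i \<in> sec (M i) W" if "s \<in> sec (direct_sum_sheaf I M) W" "i \<in> I" for s i W
      using that by (simp add: direct_sum_sheaf_simps)
    have so: "s i = 0" if "s \<in> sec (direct_sum_sheaf I M) W" "i \<notin> I" for s i W
      using that by (simp add: direct_sum_sheaf_simps)
    {
      fix W assume W: "openin T W"
      show "0 \<in> sec (direct_sum_sheaf I M) W" using presheafD_sec(1)[OF p W] by (simp add: direct_sum_sheaf_simps)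
      fix s assume s: "s \<in> sec (direct_sum_sheaf I M) W"
      show "res (direct_sum_sheaf I M) W s = s"
        using presheafD_sec(3)[OF p W si[OF s]] so[OF s] by (simp add: direct_sum_sheaf_simps fun_eq_iff)
      show "act (direct_sum_sheaf I M) (\<lambda>_. 1) s = s"
        using presheafD_act(6)[OF p W si[OF s]] so[OF s] by (simp add: direct_sum_sheaf_simps fun_eq_iff)
      { fix s' assume s': "s' \<in> sec (direct_sum_sheaf I M) W"
        show "s - s' \<in> sec (direct_sum_sheaf I M) W"
          using presheafD_sec(2)[OF p W si[OF s] si[OF s']] so[OF s] so[OF s'] by (simp add: direct_sum_sheaf_simps)
        fix r assume r: "r \<in> R W"
        show "act (direct_sum_sheaf I M) r (s + s') = act (direct_sum_sheaf I M) r s + act (direct_sum_sheaf I M) r s'"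
          using presheafD_act(3)[OF p W r si[OF s] si[OF s']] by (simp add: direct_sum_sheaf_simps fun_eq_iff) }
      fix r assume r: "r \<in> R W"
      show "act (direct_sum_sheaf I M) r s \<in> sec (direct_sum_sheaf I M) W"
        using presheafD_act(1)[OF p W r si[OF s]] by (simp add: direct_sum_sheaf_simps)
      fix r' assume r': "r' \<in> R W"
      show "act (direct_sum_sheaf I M) r s = act (direct_sum_sheaf I M) r' s" if "\<forall>p\<in>W. r p = r' p"
        using presheafD_act(2)[OF p W r r' si[OF s] that] by (simp add: direct_sum_sheaf_simps fun_eq_iff)
      show "act (direct_sum_sheaf I M) (\<lambda>p. r p + r' p) s = act (direct_sum_sheaf I M) r s + act (direct_sum_sheaf I M) r' s"
        using presheafD_act(4)[OF p W r r' si[OF s]] by (simp add: direct_sum_sheaf_simps fun_eq_iff)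
      show "act (direct_sum_sheaf I M) (\<lambda>p. r p * r' p) s = act (direct_sum_sheaf I M) r (act (direct_sum_sheaf I M) r' s)"
        using presheafD_act(5)[OF p W r r' si[OF s]] by (simp add: direct_sum_sheaf_simps fun_eq_iff)
    next
      fix W W' assume W: "openin T W" "openin T W'" "W' \<subseteq> W"
      fix s assume s: "s \<in> sec (direct_sum_sheaf I M) W"
      show "res (direct_sum_sheaf I M) W' s \<in> sec (direct_sum_sheaf I M) W'"
        using presheafD_res(1)[OF p W si[OF s]] by (simp add: direct_sum_sheaf_simps)
      show "res (direct_sum_sheaf I M) W' (s + s') = res (direct_sum_sheaf I M) W' s + res (direct_sum_sheaf I M) W' s'"
        if "s' \<in> sec (direct_sum_sheaf I M) W" for s'
        using presheafD_res(2)[OF p W si[OF s] si[OF that]] by (simp add: direct_sum_sheaf_simps fun_eq_iff)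
      show "res (direct_sum_sheaf I M) W' (act (direct_sum_sheaf I M) r s) = act (direct_sum_sheaf I M) r (res (direct_sum_sheaf I M) W' s)"
        if "r \<in> R W" for r
        using presheafD_res(3)[OF p W that si[OF s]] by (simp add: direct_sum_sheaf_simps fun_eq_iff)
      show "res (direct_sum_sheaf I M) W'' (res (direct_sum_sheaf I M) W' s) = res (direct_sum_sheaf I M) W'' s"
        if "openin T W''" "W'' \<subseteq> W'" for W''
        using presheafD_res(4)[OF p W that si[OF s]] by (simp add: direct_sum_sheaf_simps fun_eq_iff)
    }
  qed
  moreover have "\<exists>!s. s \<in> sec (direct_sum_sheaf I M) (\<Union>\<W>) \<and> (\<forall>W\<in>\<W>. res (direct_sum_sheaf I M) W s = \<sigma> W)"
    if \<sigma>: "\<forall>W\<in>\<W>. openin T W \<and> \<sigma> W \<in> sec (direct_sum_sheaf I M) W"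
      and compat: "\<forall>W\<in>\<W>. \<forall>W'\<in>\<W>. res (direct_sum_sheaf I M) (W \<inter> W') (\<sigma> W) = res (direct_sum_sheaf I M) (W \<inter> W') (\<sigma> W')" for \<W> \<sigma>
  proof -
    have ex: "\<exists>!s. s \<in> sec (M i) (\<Union>\<W>) \<and> (\<forall>W\<in>\<W>. res (M i) W s = \<sigma> W i)" if i: "i \<in> I" for i
    proof (rule sheaf_glue[OF M[OF i]])
      fix W W' assume W: "W \<in> \<W>" and W': "W' \<in> \<W>"
      show "openin T W" "\<sigma> W i \<in> sec (M i) W" using \<sigma> W i by (auto simp: direct_sum_sheaf_simps)
      have "res (direct_sum_sheaf I M) (W \<inter> W') (\<sigma> W) i = res (direct_sum_sheaf I M) (W \<inter> W') (\<sigma> W') i"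
        using compat W W' by simp
      then show "res (M i) (W \<inter> W') (\<sigma> W i) = res (M i) (W \<inter> W') (\<sigma> W' i)"
        using i by (simp add: direct_sum_sheaf_simps)
    qed
    define s where "s i = (if i \<in> I then THE s. s \<in> sec (M i) (\<Union>\<W>) \<and> (\<forall>W\<in>\<W>. res (M i) W s = \<sigma> W i) else 0)" for i
    have s: "s i \<in> sec (M i) (\<Union>\<W>) \<and> (\<forall>W\<in>\<W>. res (M i) W (s i) = \<sigma> W i)" if "i \<in> I" for i
      using theI'[OF ex[OF that]] that by (simp add: s_def)
    have out: "\<sigma> W i = 0" if "W \<in> \<W>" "i \<notin> I" for W i using \<sigma> that by (simp add: direct_sum_sheaf_simps)
    show ?thesis
    proof (rule ex1I[of _ s])
      show "s \<in> sec (direct_sum_sheaf I M) (\<Union>\<W>) \<and> (\<forall>W\<in>\<W>. res (direct_sum_sheaf I M) W s = \<sigma> W)"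
        using s out by (auto simp: direct_sum_sheaf_simps fun_eq_iff s_def)
      fix s' assume s': "s' \<in> sec (direct_sum_sheaf I M) (\<Union>\<W>) \<and> (\<forall>W\<in>\<W>. res (direct_sum_sheaf I M) W s' = \<sigma> W)"
      show "s' = s"
      proof
        fix i show "s' i = s i"
        proof (cases "i \<in> I")
          case True
          have "res (M i) W (s' i) = \<sigma> W i" if "W \<in> \<W>" for W
          proof -
            have "res (direct_sum_sheaf I M) W s' i = \<sigma> W i" using s' that by simp
            then show ?thesis using True by (simp add: direct_sum_sheaf_simps)
          qed
          then have P: "s' i \<in> sec (M i) (\<Union>\<W>) \<and> (\<forall>W\<in>\<W>. res (M i) W (s' i) = \<sigma> W i)"
            using conjunct1[OF s'] True by (simp add: direct_sum_sheaf_simps)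
          show ?thesis by (rule ex1_unique[OF ex[OF True] P s[OF True]])
        qed (use s' in \<open>simp add: direct_sum_sheaf_simps s_def\<close>)
      qed
    qed
  qed
  ultimately show ?thesis
    unfolding sheaf_of_modules_def by (intro conjI allI impI; (elim conjE)?; assumption?; simp only:)
qed

context finite_symplectic_space
begin

lemma form_bundle_simps:
  "res (form_bundle p q m) W s = (\<lambda>e. if e \<in> frames W then s e else 0)"
  "act (form_bundle p q m) r s = (\<lambda>e. scale_poly (r (frame_span e)) (s e))"
  by (simp_all add: form_bundle_def scale_poly_def)

lemma res_sec:
  assumes s: "s \<in> sec (form_bundle p q m) W" and W': "W' \<subseteq> W"
  shows "(\<lambda>e. if e \<in> frames W' then s e else 0) \<in> sec (form_bundle p q m) W'"
proof (rule sec_form_bundleI)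
  have sub: "frames W' \<subseteq> frames W" by (rule frames_mono[OF W'])
  show "(if e \<in> frames W' then s e else 0) \<in> form_polys p q" if "e \<in> frames W'" for e
    using that sub sec_form_polys[OF s, of e] by auto
  have "regular_coeffs (frames W') s" by (rule regular_coeffs_subset[OF sec_regular[OF s] sub])
  then show "regular_coeffs (frames W') (\<lambda>e. if e \<in> frames W' then s e else 0)" by (simp cong: regular_coeffs_cong)
  fix x y a b c d assume "(x, y) \<in> frames W'" "(a *s x + b *s y, c *s x + d *s y) \<in> frames W'" "a * d - b * c \<noteq> 0"
  then show "transforms q a b c d ((a * d - b * c) ^ m) (if (x, y) \<in> frames W' then s (x, y) else 0)
      (if (a *s x + b *s y, c *s x + d *s y) \<in> frames W' then s (a *s x + b *s y, c *s x + d *s y) else 0)"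
    using sec_transforms[OF s] sub by auto
qed simp

lemma act_sec:
  assumes s: "s \<in> sec (form_bundle p q m) W" and r: "r \<in> IGr_reg W"
  shows "(\<lambda>e. scale_poly (r (frame_span e)) (s e)) \<in> sec (form_bundle p q m) W"
proof (rule sec_form_bundleI)
  show "regular_coeffs (frames W) (\<lambda>e. scale_poly (r (frame_span e)) (s e))"
    using r by (intro regular_coeffs_scale sec_regular[OF s]) (simp add: IGr_reg_def)
  fix x y a b c d assume e: "(x, y) \<in> frames W" "(a *s x + b *s y, c *s x + d *s y) \<in> frames W" "a * d - b * c \<noteq> 0"
  show "transforms q a b c d ((a * d - b * c) ^ m) (scale_poly (r (frame_span (x, y))) (s (x, y)))
      (scale_poly (r (frame_span (a *s x + b *s y, c *s x + d *s y))) (s (a *s x + b *s y, c *s x + d *s y)))"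
    unfolding frames_change(2)[OF e(3,1)] by (rule transforms_scale[OF sec_transforms[OF s e(1,3)]])
qed (simp_all add: sec_outside[OF s] form_polys_scale sec_form_polys[OF s])

lemma presheaf_form_bundle: "presheaf_of_modules IGr_top IGr_reg (form_bundle p q m)"
  unfolding presheaf_of_modules_def form_bundle_simps
proof (intro conjI allI impI ballI; (elim conjE)?)
  fix W s assume s: "s \<in> sec (form_bundle p q m) W"
  show "(\<lambda>e. if e \<in> frames W then s e else 0) = s" using sec_outside[OF s] by auto
  show "s - s' \<in> sec (form_bundle p q m) W" if "s' \<in> sec (form_bundle p q m) W" for s'
    using sec_diff[OF s that] by (simp add: fun_diff_def)
  show "(\<lambda>e. scale_poly 1 (s e)) = s" by simp
  show "(\<lambda>e. scale_poly (r (frame_span e)) (s e)) \<in> sec (form_bundle p q m) W" if "r \<in> IGr_reg W" for r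
    by (rule act_sec[OF s that])
  show "(\<lambda>e. scale_poly (r (frame_span e)) (s e)) = (\<lambda>e. scale_poly (r' (frame_span e)) (s e))" if "\<forall>p\<in>W. r p = r' p" for r r'
  proof
    fix e show "scale_poly (r (frame_span e)) (s e) = scale_poly (r' (frame_span e)) (s e)"
      using that frame_span_frames[of e W] sec_outside[OF s, of e] by (cases "e \<in> frames W") auto
  qed
qed (auto simp: sec_zero res_sec scale_poly_def fun_eq_iff algebra_simps dest: subsetD[OF frames_mono])

lemma frames_Union: "frames (\<Union>\<W>) = (\<Union>W\<in>\<W>. frames W)"
  by (auto simp: frames_def)

text \<open>
  A formula for \<open>f\<close> near \<open>e\<close> may fail outside \<open>W\<close>. Multiplying numerator and denominator by a polynomial
  that certifies the openness of \<open>W\<close> at \<open>e\<close> confines it to \<open>W\<close>.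
\<close>

lemma regular_on_Union:
  assumes "\<And>W. W \<in> \<W> \<Longrightarrow> zariski_open W" "\<And>W. W \<in> \<W> \<Longrightarrow> regular_on (frames W) f"
  shows "regular_on (frames (\<Union>\<W>)) f"
  unfolding regular_on_def
proof
  fix e assume "e \<in> frames (\<Union>\<W>)"
  then obtain W where W: "W \<in> \<W>" "e \<in> frames W" by (auto simp: frames_Union)
  obtain h0 where h0: "h0 \<in> poly_funs" "h0 e \<noteq> 0" "\<And>e'. e' \<in> frames IGr \<Longrightarrow> h0 e' \<noteq> 0 \<Longrightarrow> e' \<in> frames W"
    using assms(1)[OF W(1)] W(2) by (rule zariski_openD) (rule that)
  obtain g h where gh: "g \<in> poly_funs" "h \<in> poly_funs" "h e \<noteq> 0" "\<And>e'. e' \<in> frames W \<Longrightarrow> h e' \<noteq> 0 \<Longrightarrow> f e' = g e' / h e'"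
    using assms(2)[OF W(1)] W(2) by (rule regular_on_E) (rule that)
  have "frames (\<Union>\<W>) \<subseteq> frames IGr"
    using assms(1) by (intro frames_mono) (auto simp: zariski_open_def)
  then show "\<exists>g\<in>poly_funs. \<exists>h\<in>poly_funs. h e \<noteq> 0 \<and> (\<forall>e'\<in>frames (\<Union>\<W>). h e' \<noteq> 0 \<longrightarrow> f e' = g e' / h e')"
    by (intro bexI[OF _ poly_funs.times[OF gh(1) h0(1)]] bexI[OF _ poly_funs.times[OF gh(2) h0(1)]])
      (use gh h0 in auto)
qed

lemma sheaf_form_bundle: "sheaf_of_modules IGr_top IGr_reg (form_bundle p q m)"
  unfolding sheaf_of_modules_def
proof (intro conjI allI impI presheaf_form_bundle)
  fix \<W> and \<sigma> :: "'v set set \<Rightarrow> 'v \<times> 'v \<Rightarrow> ('k, 'v) form_poly"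
  assume H: "(\<forall>W\<in>\<W>. openin IGr_top W \<and> \<sigma> W \<in> sec (form_bundle p q m) W) \<and>
    (\<forall>W\<in>\<W>. \<forall>W'\<in>\<W>. res (form_bundle p q m) (W \<inter> W') (\<sigma> W) = res (form_bundle p q m) (W \<inter> W') (\<sigma> W'))"
  from conjunct1[OF H] have \<sigma>: "\<And>W. W \<in> \<W> \<Longrightarrow> zariski_open W" "\<And>W. W \<in> \<W> \<Longrightarrow> \<sigma> W \<in> sec (form_bundle p q m) W"
    by (simp_all add: openin_IGr_top)
  have compat: "\<And>W W'. W \<in> \<W> \<Longrightarrow> W' \<in> \<W> \<Longrightarrow> res (form_bundle p q m) (W \<inter> W') (\<sigma> W) = res (form_bundle p q m) (W \<inter> W') (\<sigma> W')"
    using conjunct2[OF H] by blast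
  have inter: "frames (W \<inter> W') = frames W \<inter> frames W'" for W W' by (auto simp: frames_def)
  have agree: "\<sigma> W e = \<sigma> W' e" if "W \<in> \<W>" "W' \<in> \<W>" "e \<in> frames W" "e \<in> frames W'" for W W' e
    using fun_cong[OF compat[OF that(1,2)], of e] that(3,4) by (simp add: form_bundle_simps inter)
  define s where "s e = (if e \<in> frames (\<Union>\<W>) then \<sigma> (SOME W. W \<in> \<W> \<and> e \<in> frames W) e else 0)" for e
  have s: "s e = \<sigma> W e" if "W \<in> \<W>" "e \<in> frames W" for W e
  proof -
    define W' where "W' = (SOME W. W \<in> \<W> \<and> e \<in> frames W)"
    have W': "W' \<in> \<W> \<and> e \<in> frames W'"
      unfolding W'_def by (rule someI[of "\<lambda>W. W \<in> \<W> \<and> e \<in> frames W" W]) (simp add: that)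
    have "e \<in> frames (\<Union>\<W>)" using that by (auto simp: frames_Union)
    then have "s e = \<sigma> W' e" by (simp add: s_def W'_def)
    also have "\<dots> = \<sigma> W e" using W' that by (intro agree) simp_all
    finally show ?thesis .
  qed
  have in_sec: "s \<in> sec (form_bundle p q m) (\<Union>\<W>)"
  proof (rule sec_form_bundleI)
    show "s e = 0" if "e \<notin> frames (\<Union>\<W>)" for e using that by (simp add: s_def)
    show "s e \<in> form_polys p q" if mem: "e \<in> frames (\<Union>\<W>)" for e
    proof -
      obtain W where "W \<in> \<W>" "e \<in> frames W" using mem by (auto simp: frames_Union)
      then show ?thesis using sec_form_polys[OF \<sigma>(2)] by (simp add: s)
    qed
    show "regular_coeffs (frames (\<Union>\<W>)) s"
      unfolding regular_coeffs_def
    proof (intro allI regular_on_Union \<sigma>(1))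
      fix i j vs W assume W: "W \<in> \<W>"
      have "regular_on (frames W) (\<lambda>e. \<sigma> W e i j vs)" using sec_regular[OF \<sigma>(2)[OF W]] by (simp add: regular_coeffs_def)
      then show "regular_on (frames W) (\<lambda>e. s e i j vs)" using s[OF W] by (simp cong: regular_on_cong)
    qed
    fix x y :: 'v and a b c d :: 'k
    assume e: "(x, y) \<in> frames (\<Union>\<W>)" "a * d - b * c \<noteq> 0"
    then obtain W where W: "W \<in> \<W>" "(x, y) \<in> frames W" by (auto simp: frames_Union)
    show "transforms q a b c d ((a * d - b * c) ^ m) (s (x, y)) (s (a *s x + b *s y, c *s x + d *s y))"
      using sec_transforms[OF \<sigma>(2)[OF W(1)] W(2) e(2)] s[OF W] s[OF W(1) frames_change(1)[OF e(2) W(2)]] by simp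
  qed
  show "\<exists>!s. s \<in> sec (form_bundle p q m) (\<Union>\<W>) \<and> (\<forall>W\<in>\<W>. res (form_bundle p q m) W s = \<sigma> W)"
  proof (rule ex1I[of _ s], intro conjI ballI in_sec)
    show "res (form_bundle p q m) W s = \<sigma> W" if "W \<in> \<W>" for W
      using s[OF that] sec_outside[OF \<sigma>(2)[OF that]] by (auto simp: form_bundle_simps)
    fix s' assume s': "s' \<in> sec (form_bundle p q m) (\<Union>\<W>) \<and> (\<forall>W\<in>\<W>. res (form_bundle p q m) W s' = \<sigma> W)"
    show "s' = s"
    proof
      fix e show "s' e = s e"
      proof (cases "e \<in> frames (\<Union>\<W>)")
        case True
        then obtain W where W: "W \<in> \<W>" "e \<in> frames W" by (auto simp: frames_Union)
        then have "res (form_bundle p q m) W s' e = \<sigma> W e" using s' by simp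
        then show ?thesis using s[OF W] W by (simp add: form_bundle_simps)
      qed (use sec_outside[OF conjunct1[OF s'], of e] in \<open>simp add: s_def\<close>)
    qed
  qed
qed

lemma sheaf_hom_pointwise:
  assumes maps: "\<And>W s. zariski_open W \<Longrightarrow> s \<in> sec (form_bundle p q m) W \<Longrightarrow> (\<lambda>e. H e (s e)) \<in> sec (form_bundle p' q' m') W"
    and add: "\<And>e F G. H e (F + G) = H e F + H e G" and scl: "\<And>e c F. H e (scale_poly c F) = scale_poly c (H e F)"
  shows "sheaf_hom IGr_top IGr_reg (form_bundle p q m) (form_bundle p' q' m') (\<lambda>W s e. H e (s e))"
proof (rule sheaf_homI)
  have "H e 0 = 0" for e using add[of e 0 0] by simp
  then show "res (form_bundle p' q' m') W' (\<lambda>e. H e (s e)) = (\<lambda>e. H e (res (form_bundle p q m) W' s e))" for W' s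
    by (auto simp: form_bundle_simps)
qed (use maps in \<open>auto simp: openin_IGr_top form_bundle_simps add scl\<close>)

end

section \<open>The bicomplex and its total complex\<close>

context finite_symplectic_space
begin

lemma d1_con: "d1 e F = lef (con (fst e) (snd e) F)" and d2_exd: "d2 e F = exd (fst e) (snd e) F"
  by (metis d1_eq prod.collapse, metis d2_eq prod.collapse)

lemma d1_lin: "d1 e (F + G) = d1 e F + d1 e G" "d1 e (scale_poly c F) = scale_poly c (d1 e F)"
  and d2_lin: "d2 e (F + G) = d2 e F + d2 e G" "d2 e (scale_poly c F) = scale_poly c (d2 e F)"
  by (simp_all add: d1_con d2_exd op_lin_1 lef_lin)

text \<open>
  The part of the horizontal arrow that depends on \<open>b\<close> and \<open>c\<close> only through \<open>q = b + c\<close>.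
\<close>

definition horiz_op :: "nat \<Rightarrow> 'v \<times> 'v \<Rightarrow> ('k, 'v) form_poly \<Rightarrow> ('k, 'v) form_poly" where
  "horiz_op q e F = scale_poly (1 / of_nat q) (scale_poly (1 / of_nat (q + 1)) (d1 e F) + d2 e F)"

lemma horiz_op_lin: "horiz_op q e (F + G) = horiz_op q e F + horiz_op q e G" "horiz_op q e (scale_poly c F) = scale_poly c (horiz_op q e F)"
  by (simp_all add: horiz_op_def d1_lin d2_lin op_lin mult.commute add_ac)

lemma horiz_op_0 [simp]: "horiz_op q e 0 = 0"
  using horiz_op_lin(2)[of q e 0 0] by simp

lemma bic_horiz_eq: "bic_horiz b c W s = (\<lambda>e. scale_poly ((- 1) ^ c * of_nat b) (horiz_op (b + c) e (s e)))"
  by (simp add: bic_horiz_def horiz_op_def scale_poly_def fun_eq_iff algebra_simps)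

lemma sec_d1:
  assumes s: "s \<in> sec (form_bundle p q m) W"
  shows "(\<lambda>e. d1 e (s e)) \<in> sec (form_bundle (Suc p) (q - 1) m) W"
proof (cases p)
  case 0
  have "d1 e (s e) = 0" for e
  proof (cases "e \<in> frames W")
    case True
    have F: "s e \<in> form_polys 0 q" using sec_form_polys[OF s True] 0 by simp
    show ?thesis using iota_degree_0[OF form_polys_deriv(1)[OF F]] iota_degree_0[OF form_polys_deriv(2)[OF F]] by (simp add: d1_con con_def lef_lin)
  next
    case False
    then show ?thesis using sec_outside[OF s False] by (simp add: d1_con op_lin_1 lef_lin)
  qed
  then have "(\<lambda>e. d1 e (s e)) = 0" by (intro ext) simp
  then show ?thesis by (simp only: sec_zero)
next
  case (Suc p')
  have "(\<lambda>e. lef (con (fst e) (snd e) (s e))) \<in> sec (form_bundle (Suc (Suc (p - 1))) (q - 1) m) W"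
    by (intro sec_lef sec_con s)
  then show ?thesis by (simp add: Suc d1_con)
qed

lemma sec_horiz_op:
  assumes s: "s \<in> sec (form_bundle p q m) W"
  shows "(\<lambda>e. horiz_op k e (s e)) \<in> sec (form_bundle (Suc p) (q - 1) m) W"
  unfolding horiz_op_def using sec_d1[OF s] sec_exd[OF s] by (intro sec_scale sec_add) (simp_all add: d2_exd)

lemma vert_degree_0: "s \<in> sec (form_bundle 0 q m) W \<Longrightarrow> vert W s = 0"
proof
  fix e assume s: "s \<in> sec (form_bundle 0 q m) W"
  show "vert W s e = 0 e"
  proof (cases "e \<in> frames W")
    case True
    have F: "s e \<in> form_polys 0 q" by (rule sec_form_polys[OF s True])
    show ?thesis using iota_degree_0[OF form_polys_mult(1)[OF F]] iota_degree_0[OF form_polys_mult(2)[OF F]]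
      by (cases e) (simp add: vert_def d0_eq)
  qed (use sec_outside[OF s] in \<open>simp add: vert_def d0_lin\<close>)
qed

lemma vert_lin: "vert W 0 = 0" "vert W (s + s') = vert W s + vert W s'" "vert W (- s) = - vert W s" "vert W (s - s') = vert W s - vert W s'"
  by (simp_all add: vert_def d0_lin fun_eq_iff)

lemma bic_horiz_lin: "bic_horiz b c W 0 = 0" "bic_horiz b c W (s + s') = bic_horiz b c W s + bic_horiz b c W s'"
  by (simp_all add: bic_horiz_eq horiz_op_lin scale_poly_add fun_eq_iff)

lemma bic_horiz_minus: "bic_horiz b c W (- s) = - bic_horiz b c W s"
  using bic_horiz_lin(2)[of b c W "- s" s] by (simp add: bic_horiz_lin(1) eq_neg_iff_add_eq_0)

abbreviation bic_obj :: "nat \<Rightarrow> nat \<Rightarrow> nat \<Rightarrow> ('v set, 'k, 'v \<times> 'v \<Rightarrow> ('k, 'v) form_poly) modsheaf" where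
  "bic_obj t b c \<equiv> bicomplex_obj (bic_index t) (bic_term t) b c"

lemma bic_obj_inside: "b + c \<le> t \<Longrightarrow> bic_obj t b c = form_bundle (t - b - c) (b + c) c"
  and bic_obj_outside: "\<not> b + c \<le> t \<Longrightarrow> bic_obj t b c = zero_sheaf"
  by (simp_all add: bicomplex_obj_def bic_index_def bic_term_def)

lemma sec_zero_sheaf: "s \<in> sec zero_sheaf W \<longleftrightarrow> s = 0"
  by (simp add: zero_sheaf_def)

lemma sheaf_bic_obj: "sheaf_of_modules IGr_top IGr_reg (bic_obj t b c)"
  by (cases "b + c \<le> t") (simp_all add: bic_obj_inside bic_obj_outside sheaf_form_bundle sheaf_zero_sheaf)

lemma vert_hom: "sheaf_hom IGr_top IGr_reg (bic_obj t b c) (bic_obj t b (c + 1)) vert"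
proof -
  consider "b + (c + 1) \<le> t" | "b + c = t" | "\<not> b + c \<le> t" by linarith
  then show ?thesis
  proof cases
    case 1
    then have objs: "bic_obj t b c = form_bundle (t - b - c) (b + c) c"
      "bic_obj t b (c + 1) = form_bundle (t - b - c - 1) (Suc (b + c)) (Suc c)"
      by (simp_all add: bic_obj_inside)
    show ?thesis
      unfolding vert_def[abs_def] objs by (rule sheaf_hom_pointwise[OF sec_d0 d0_lin(2) d0_lin(5)])
  next
    case 2
    then have b: "b + c \<le> t" and nb: "\<not> b + (c + 1) \<le> t" by simp_all
    show ?thesis unfolding bic_obj_outside[OF nb]
      by (rule sheaf_hom_to_zero[OF sheaf_presheaf[OF sheaf_bic_obj]]) (use 2 in \<open>auto simp: bic_obj_inside intro: vert_degree_0\<close>)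
  next
    case 3
    show ?thesis unfolding bic_obj_outside[OF 3]
      by (rule sheaf_hom_from_zero[OF sheaf_presheaf[OF sheaf_bic_obj]]) (rule vert_lin(1))
  qed
qed

lemma bic_horiz_hom: "sheaf_hom IGr_top IGr_reg (bic_obj t (b + 1) c) (bic_obj t b c) (bic_horiz (b + 1) c)"
proof (cases "b + 1 + c \<le> t")
  case True
  then have objs: "bic_obj t (b + 1) c = form_bundle (t - (b + 1) - c) (b + 1 + c) c"
    "bic_obj t b c = form_bundle (Suc (t - (b + 1) - c)) (b + 1 + c - 1) c"
    by (simp_all add: bic_obj_inside Suc_diff_Suc)
  show ?thesis
    unfolding bic_horiz_eq[abs_def] objs
    by (rule sheaf_hom_pointwise)
      (rule sec_scale, erule sec_horiz_op, simp_all only: horiz_op_lin scale_poly_add scale_poly_scale_poly mult.commute)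
next
  case False
  show ?thesis unfolding bic_obj_outside[OF False]
    by (rule sheaf_hom_from_zero[OF sheaf_presheaf[OF sheaf_bic_obj]]) (rule bic_horiz_lin(1))
qed

lemma vert_vert:
  assumes W: "zariski_open W" and s: "s \<in> sec (bic_obj t b c) W"
  shows "vert W (vert W s) = 0"
proof (cases "b + c \<le> t")
  case True
  then have s: "s \<in> sec (form_bundle (t - b - c) (b + c) c) W" using s by (simp add: bic_obj_inside)
  show ?thesis
  proof
    fix e show "vert W (vert W s) e = 0 e"
    proof (cases "e \<in> frames W")
      case True
      show ?thesis using d0_d0[OF sec_alternating[OF s True], of "fst e" "snd e"] by (simp add: vert_def)
    qed (use sec_outside[OF s] in \<open>simp add: vert_def d0_lin\<close>)
  qed
next
  case False then show ?thesis using s by (simp add: bic_obj_outside sec_zero_sheaf vert_lin)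
qed

lemma bic_horiz_bic_horiz:
  assumes W: "zariski_open W" and s: "s \<in> sec (bic_obj t (b + 2) c) W"
  shows "bic_horiz (b + 1) c W (bic_horiz (b + 2) c W s) = 0"
proof (cases "b + 2 + c \<le> t")
  case True
  then have s: "s \<in> sec (form_bundle (t - (b + 2) - c) (b + 2 + c) c) W" using s by (simp add: bic_obj_inside)
  show ?thesis
  proof
    fix e show "bic_horiz (b + 1) c W (bic_horiz (b + 2) c W s) e = 0 e"
    proof (cases "e \<in> frames W")
      case True
      have iso: "\<omega> (fst e) (snd e) = 0" using frames_isotropic[of W "fst e" "snd e"] W True by (simp add: zariski_open_def)
      have q: "b + 2 + c \<ge> 2" "b + 2 + c - 1 = b + 1 + c" by simp_all
      note z = horizontal_square_zero[OF sec_form_polys[OF s True] q(1) iso, unfolded q(2) prod.collapse]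
      have "horiz_op (b + 1 + c) e (horiz_op (b + 2 + c) e (s e)) = 0"
        unfolding horiz_op_def d1_lin d2_lin
        using arg_cong[OF z, of "\<lambda>F. scale_poly (1 / of_nat (b + 1 + c)) (scale_poly (1 / of_nat (b + 2 + c)) F)"]
        by (simp add: op_lin d1_lin d2_lin mult_ac)
      then show ?thesis by (simp add: bic_horiz_eq horiz_op_lin)
    qed (use sec_outside[OF s] in \<open>simp add: bic_horiz_eq horiz_op_lin\<close>)
  qed
next
  case False then show ?thesis using s by (simp add: bic_obj_outside sec_zero_sheaf bic_horiz_lin)
qed

lemma bic_horiz_vert:
  assumes W: "zariski_open W" and s: "s \<in> sec (bic_obj t (b + 1) c) W"
  shows "bic_horiz (b + 1) (c + 1) W (vert W s) = vert W (bic_horiz (b + 1) c W s)"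
proof (cases "b + 1 + c \<le> t")
  case True
  then have s: "s \<in> sec (form_bundle (t - (b + 1) - c) (b + 1 + c) c) W" using s by (simp add: bic_obj_inside)
  show ?thesis
  proof
    fix e show "bic_horiz (b + 1) (c + 1) W (vert W s) e = vert W (bic_horiz (b + 1) c W s) e"
    proof (cases "e \<in> frames W")
      case True
      have iso: "\<omega> (fst e) (snd e) = 0" using frames_isotropic[of W "fst e" "snd e"] W True by (simp add: zariski_open_def)
      have "horiz_op (b + 1 + (c + 1)) e (d0 e (s e)) = - d0 e (horiz_op (b + 1 + c) e (s e))"
        using horizontal_vertical_commute[OF sec_form_polys[OF s True] _ iso] by (simp add: horiz_op_def add_ac)
      then show ?thesis by (simp add: bic_horiz_eq vert_def d0_lin scale_poly_minus) (simp add: scale_poly_def fun_eq_iff)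
    qed (use sec_outside[OF s] in \<open>simp add: bic_horiz_eq vert_def d0_lin\<close>)
  qed
next
  case False then show ?thesis using s by (simp add: bic_obj_outside sec_zero_sheaf bic_horiz_lin vert_lin)
qed

lemma is_bicomplex_bic: "is_bicomplex IGr_top IGr_reg (bic_index t) (bic_term t) bic_horiz bic_vert"
  unfolding is_bicomplex_def Let_def bic_vert_def openin_IGr_top
  by (intro conjI allI impI ballI sheaf_bic_obj vert_hom bic_horiz_hom vert_vert bic_horiz_bic_horiz bic_horiz_vert; assumption)

subsection \<open>The total complex\<close>

lemma total_obj:
  "s \<in> sec (obj (bic_total t) k) W \<longleftrightarrow>
    (\<forall>b c. if b + c \<le> t \<and> int c - int b = k then s (b, c) \<in> sec (form_bundle (t - b - c) (b + c) c) W else s (b, c) = 0)"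
  by (auto simp: bic_total_def total_complex_def direct_sum_sheaf_simps bic_index_def bic_term_def)

lemma total_sec_obj: "s \<in> sec (obj (bic_total t) k) W \<Longrightarrow> int c - int b = k \<Longrightarrow> s (b, c) \<in> sec (bic_obj t b c) W"
  by (cases "b + c \<le> t") (auto simp: total_obj bic_obj_inside bic_obj_outside sec_zero_sheaf split: if_splits)

lemma total_sec_outside: "s \<in> sec (obj (bic_total t) k) W \<Longrightarrow> \<not> (b + c \<le> t \<and> int c - int b = k) \<Longrightarrow> s (b, c) = 0"
  using total_obj by (metis (no_types, lifting))

definition alt_sign :: "nat \<Rightarrow> 's \<Rightarrow> 's :: ab_group_add" where
  "alt_sign b x = (if even b then x else - x)"

lemma alt_sign_simps: "alt_sign b 0 = 0" "alt_sign b (x + y) = alt_sign b x + alt_sign b y"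
  "alt_sign (Suc b) x = - alt_sign b x" "alt_sign b (alt_sign b x) = x" "alt_sign b (x - y) = alt_sign b x - alt_sign b y"
  "alt_sign b x = 0 \<longleftrightarrow> x = 0" "vert W (alt_sign b s) = alt_sign b (vert W s)"
  "bic_horiz b' c W (alt_sign b s) = alt_sign b (bic_horiz b' c W s)"
  by (simp_all add: alt_sign_def vert_lin bic_horiz_minus)

lemma total_diff_outside: "\<not> (b + c \<le> t \<and> int c - int b = k + 1) \<Longrightarrow> diff (bic_total t) k W s (b, c) = 0"
  by (auto simp: bic_total_def total_complex_def bic_index_def)

text \<open>
  The terms outside the triangle have no nonzero sections, so the horizontal part needs no case
  distinction on membership of its source in the index set.
\<close>

lemma total_diff:
  assumes W: "zariski_open W" and s: "s \<in> sec (obj (bic_total t) k) W" and deg: "int c - int b = k + 1"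
  shows "diff (bic_total t) k W s (b, c) = bic_horiz (b + 1) c W (s (b + 1, c)) + (if c > 0 then alt_sign b (vert W (s (b, c - 1))) else 0)"
proof (cases "b + c \<le> t")
  case True
  have "bic_horiz (b + 1) c W (s (b + 1, c)) = 0" if "\<not> b + 1 + c \<le> t"
    using total_sec_outside[OF s, of "b + 1" c] that by (simp add: bic_horiz_lin)
  then show ?thesis using True deg
    by (cases "b + 1 + c \<le> t"; cases "c = 0") (auto simp: bic_total_def total_complex_def bic_index_def alt_sign_def bic_vert_def)
next
  case False
  have h: "s (b + 1, c) = 0" using total_sec_outside[OF s, of "b + 1" c] False by simp
  have "vert W (s (b, c - 1)) = 0" if c: "c > 0"
  proof -
    have "s (b, c - 1) \<in> sec (bic_obj t b (c - 1)) W" by (rule total_sec_obj[OF s]) (use deg c in simp)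
    from sheaf_homD(1)[OF vert_hom _ this] have "vert W (s (b, c - 1)) \<in> sec (bic_obj t b c) W"
      using W c by (simp add: openin_IGr_top)
    then show ?thesis using False by (simp add: bic_obj_outside sec_zero_sheaf)
  qed
  then show ?thesis using False h total_diff_outside[of b c t k W s] by (simp add: bic_horiz_lin alt_sign_simps)
qed

lemma total_diff_add: "diff (bic_total t) k W (s + s') = diff (bic_total t) k W s + diff (bic_total t) k W s'"
  by (auto simp: bic_total_def total_complex_def bic_vert_def vert_lin bic_horiz_lin fun_eq_iff)

lemma total_diff_diff: "diff (bic_total t) k W (s - s') = diff (bic_total t) k W s - diff (bic_total t) k W s'"
  using total_diff_add[of t k W "s - s'" s'] by simp

lemma sheaf_total: "sheaf_of_modules IGr_top IGr_reg (obj (bic_total t) k)"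
  unfolding bic_total_def total_complex_def
  by (simp, rule sheaf_direct_sum_sheaf) (auto simp: bic_term_def sheaf_form_bundle)

lemma total_res: "s \<in> sec (obj (bic_total t) k) W \<Longrightarrow> res (obj (bic_total t) k) W' s = (\<lambda>i e. if e \<in> frames W' then s i e else 0)"
proof
  fix i assume s: "s \<in> sec (obj (bic_total t) k) W"
  show "res (obj (bic_total t) k) W' s i = (\<lambda>e. if e \<in> frames W' then s i e else 0)"
    using total_sec_outside[OF s] by (cases i) (auto simp: bic_total_def total_complex_def direct_sum_sheaf_simps bic_index_def bic_term_def form_bundle_simps)
qed

lemma total_act: "s \<in> sec (obj (bic_total t) k) W \<Longrightarrow> act (obj (bic_total t) k) r s = (\<lambda>i e. scale_poly (r (frame_span e)) (s i e))"
proof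
  fix i assume s: "s \<in> sec (obj (bic_total t) k) W"
  show "act (obj (bic_total t) k) r s i = (\<lambda>e. scale_poly (r (frame_span e)) (s i e))"
    using total_sec_outside[OF s] by (cases i) (auto simp: bic_total_def total_complex_def direct_sum_sheaf_simps bic_index_def bic_term_def form_bundle_simps)
qed

lemma total_diff_sec:
  assumes W: "zariski_open W" and s: "s \<in> sec (obj (bic_total t) k) W"
  shows "diff (bic_total t) k W s \<in> sec (obj (bic_total t) (k + 1)) W"
  unfolding total_obj
proof (intro allI)
  fix b c
  show "if b + c \<le> t \<and> int c - int b = k + 1 then diff (bic_total t) k W s (b, c) \<in> sec (form_bundle (t - b - c) (b + c) c) W
     else diff (bic_total t) k W s (b, c) = 0"
  proof (cases "b + c \<le> t \<and> int c - int b = k + 1")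
    case True
    then have deg: "int c - int b = k + 1" by simp
    have o: "openin IGr_top W" using W by (simp add: openin_IGr_top)
    have pre: "presheaf_of_modules IGr_top IGr_reg (bic_obj t b c)" by (rule sheaf_presheaf[OF sheaf_bic_obj])
    have 1: "bic_horiz (b + 1) c W (s (b + 1, c)) \<in> sec (bic_obj t b c) W"
      by (rule sheaf_homD(1)[OF bic_horiz_hom o total_sec_obj[OF s]]) (use deg in simp)
    have 2: "alt_sign b (vert W (s (b, c - 1))) \<in> sec (bic_obj t b c) W" if c: "c > 0"
    proof -
      have "vert W (s (b, c - 1)) \<in> sec (bic_obj t b (c - 1 + 1)) W"
        by (rule sheaf_homD(1)[OF vert_hom o total_sec_obj[OF s]]) (use deg c in simp)
      then have v: "vert W (s (b, c - 1)) \<in> sec (bic_obj t b c) W" using c by simp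
      show ?thesis using v presheafD_sec(2)[OF pre o presheafD_sec(1)[OF pre o] v] by (simp add: alt_sign_def)
    qed
    have "diff (bic_total t) k W s (b, c) \<in> sec (bic_obj t b c) W"
      unfolding total_diff[OF W s deg] using presheaf_add[OF pre o 1 2] 1 by auto
    then show ?thesis using True by (simp add: bic_obj_inside)
  qed (use total_diff_outside in auto)
qed

lemma total_diff_square:
  assumes W: "zariski_open W" and s: "s \<in> sec (obj (bic_total t) k) W"
  shows "diff (bic_total t) (k + 1) W (diff (bic_total t) k W s) = 0"
proof
  fix i :: "nat \<times> nat"
  obtain b c where i: "i = (b, c)" by (cases i)
  let ?D = "diff (bic_total t) k W s"
  show "diff (bic_total t) (k + 1) W ?D i = 0 i"
  proof (cases "int c - int b = k + 1 + 1")
    case deg: True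
    have Ds: "?D \<in> sec (obj (bic_total t) (k + 1)) W" by (rule total_diff_sec[OF W s])
    have hh: "bic_horiz (b + 1) c W (bic_horiz (b + 2) c W (s (b + 2, c))) = 0"
      by (rule bic_horiz_bic_horiz[OF W total_sec_obj[OF s]]) (use deg in simp)
    have D1: "?D (b + 1, c) = bic_horiz (b + 2) c W (s (b + 2, c)) + (if c > 0 then alt_sign (b + 1) (vert W (s (b + 1, c - 1))) else 0)"
      using total_diff[OF W s, of c "b + 1"] deg by simp
    show ?thesis
    proof (cases "c = 0")
      case True
      then show ?thesis using total_diff[OF W Ds deg] D1 hh by (simp add: i)
    next
      case False
      have D2: "?D (b, c - 1) = bic_horiz (b + 1) (c - 1) W (s (b + 1, c - 1)) + (if c - 1 > 0 then alt_sign b (vert W (s (b, c - 2))) else 0)"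
        using total_diff[OF W s, of "c - 1" b] deg False by (simp add: numeral_2_eq_2)
      have hv: "bic_horiz (b + 1) c W (vert W (s (b + 1, c - 1))) = vert W (bic_horiz (b + 1) (c - 1) W (s (b + 1, c - 1)))"
        using bic_horiz_vert[OF W total_sec_obj[OF s], of "c - 1" b] deg False by simp
      have vv: "vert W (if c - 1 > 0 then alt_sign b (vert W (s (b, c - 2))) else 0) = 0"
      proof (cases "c - 1 > 0")
        case True
        then have "vert W (vert W (s (b, c - 2))) = 0"
          by (intro vert_vert[OF W total_sec_obj[OF s]]) (use deg in simp)
        then show ?thesis by (simp add: alt_sign_simps vert_lin)
      qed (simp add: vert_lin)
      have "bic_horiz (b + 1) c W (?D (b + 1, c)) = alt_sign (b + 1) (vert W (bic_horiz (b + 1) (c - 1) W (s (b + 1, c - 1))))"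
        unfolding D1 bic_horiz_lin hh using False hv by (simp add: alt_sign_simps bic_horiz_minus)
      moreover have "vert W (?D (b, c - 1)) = vert W (bic_horiz (b + 1) (c - 1) W (s (b + 1, c - 1)))"
        unfolding D2 vert_lin vv by simp
      ultimately show ?thesis unfolding i total_diff[OF W Ds deg] using False by (simp add: alt_sign_simps)
    qed
  qed (simp add: i total_diff_outside)
qed

lemma total_diff_hom: "sheaf_hom IGr_top IGr_reg (obj (bic_total t) k) (obj (bic_total t) (k + 1)) (diff (bic_total t) k)"
proof (rule sheaf_homI, unfold openin_IGr_top)
  fix W s assume W: "zariski_open W" and s: "s \<in> sec (obj (bic_total t) k) W"
  show "diff (bic_total t) k W s \<in> sec (obj (bic_total t) (k + 1)) W" by (rule total_diff_sec[OF W s])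
  show "diff (bic_total t) k W (s + s') = diff (bic_total t) k W s + diff (bic_total t) k W s'" for s' by (rule total_diff_add)
  show "diff (bic_total t) k W (act (obj (bic_total t) k) r s) = act (obj (bic_total t) (k + 1)) r (diff (bic_total t) k W s)" for r
    unfolding total_act[OF s] total_act[OF total_diff_sec[OF W s]]
    by (auto simp: bic_total_def total_complex_def bic_vert_def vert_def bic_horiz_eq fun_eq_iff d0_lin horiz_op_lin scale_poly_add scale_poly_scale_poly scale_poly_minus mult_ac)
  fix W' assume W': "zariski_open W'" "W' \<subseteq> W"
  show "res (obj (bic_total t) (k + 1)) W' (diff (bic_total t) k W s) = diff (bic_total t) k W' (res (obj (bic_total t) k) W' s)"
    unfolding total_res[OF s] total_res[OF total_diff_sec[OF W s]]
    by (auto simp: bic_total_def total_complex_def bic_vert_def vert_def bic_horiz_eq fun_eq_iff d0_lin)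
qed

lemma is_complex_total: "is_complex IGr_top IGr_reg (bic_total t)"
  unfolding is_complex_def openin_IGr_top using sheaf_total total_diff_hom total_diff_square by blast

end

section \<open>Comparison with the complex of kernels\<close>

context finite_symplectic_space
begin

text \<open>
  A dual family of a basis of \<open>U\<close> is corrected to span an isotropic plane. Being paired perfectly with
  that plane is the nonvanishing of the discriminant, a polynomial in the frame.
\<close>

lemma adapted_neighbourhood:
  assumes W: "zariski_open W" and U: "U \<in> W"
  shows "\<exists>W' \<gamma>\<^sub>1 \<gamma>\<^sub>2. zariski_open W' \<and> W' \<subseteq> W \<and> U \<in> W' \<and> adapted_open scale \<omega> Bs bd n \<gamma>\<^sub>1 \<gamma>\<^sub>2 W'"
proof -
  have IGr: "W \<subseteq> IGr" using W by (simp add: zariski_open_def)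
  then have "subspace U" "dim U = 2" using U by (auto simp: IGr_def)
  obtain S where S: "S \<subseteq> U" "independent S" "U \<subseteq> span S" "card S = dim U" using basis_exists[of U] by blast
  with \<open>dim U = 2\<close> obtain x y where xy: "S = {x, y}" "x \<noteq> y" by (auto simp: card_2_iff)
  have "span {x, y} = U" using S \<open>subspace U\<close> xy span_minimal[of S U] by blast
  then have e: "(x, y) \<in> frames W" using U S(2) xy by (simp add: frames_def)
  have iso: "\<omega> x y = 0" by (rule frames_isotropic[OF IGr e])
  have "\<exists>\<gamma>. \<forall>s\<in>{x, y}. \<forall>s'\<in>{x, y}. \<omega> (\<gamma> s) s' = (if s = s' then 1 else 0)"
    using S(2) xy by (intro dual_family_exists) simp_all
  then obtain \<gamma> where "\<forall>s\<in>{x, y}. \<forall>s'\<in>{x, y}. \<omega> (\<gamma> s) s' = (if s = s' then 1 else 0)" ..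
  then have \<gamma>: "\<omega> (\<gamma> s) s' = (if s = s' then 1 else 0)" if "s \<in> {x, y}" "s' \<in> {x, y}" for s s' using that by blast
  define \<gamma>\<^sub>1 where "\<gamma>\<^sub>1 = \<gamma> x"
  \<comment> \<open>Adding a multiple of \<open>x\<close> does not change the pairing with \<open>U\<close>, which is isotropic.\<close>
  define \<gamma>\<^sub>2 where "\<gamma>\<^sub>2 = \<gamma> y - \<omega> (\<gamma> x) (\<gamma> y) *s x"
  have pair: "\<omega> \<gamma>\<^sub>1 x = 1" "\<omega> \<gamma>\<^sub>1 y = 0" "\<omega> \<gamma>\<^sub>2 x = 0" "\<omega> \<gamma>\<^sub>2 y = 1" "\<omega> \<gamma>\<^sub>1 \<gamma>\<^sub>2 = 0"
    using \<gamma>[of x x] \<gamma>[of x y] \<gamma>[of y x] \<gamma>[of y y] xy(2) iso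
    by (simp_all add: \<gamma>\<^sub>1_def \<gamma>\<^sub>2_def \<omega>_diff_left \<omega>_diff_right \<omega>_linear alternating)
  define disc where "disc e = \<omega> \<gamma>\<^sub>1 (fst e) * \<omega> \<gamma>\<^sub>2 (snd e) - \<omega> \<gamma>\<^sub>1 (snd e) * \<omega> \<gamma>\<^sub>2 (fst e)" for e
  define W' where "W' = {U \<in> W. \<forall>z\<in>U. \<omega> \<gamma>\<^sub>1 z = 0 \<and> \<omega> \<gamma>\<^sub>2 z = 0 \<longrightarrow> z = 0}"
  have disc_iff: "disc e \<noteq> 0 \<longleftrightarrow> (\<forall>z\<in>frame_span e. \<omega> \<gamma>\<^sub>1 z = 0 \<and> \<omega> \<gamma>\<^sub>2 z = 0 \<longrightarrow> z = 0)" if e: "e \<in> frames W''" for e W''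
  proof -
    obtain a b where ab: "e = (a, b)" by (cases e)
    have ind: "s = 0 \<and> t = 0" if "s *s a + t *s b = 0" for s t
      using e that independent_pair_iff[of a b] by (auto simp: ab frames_def)
    show ?thesis
    proof
      assume d: "disc e \<noteq> 0"
      show "\<forall>z\<in>frame_span e. \<omega> \<gamma>\<^sub>1 z = 0 \<and> \<omega> \<gamma>\<^sub>2 z = 0 \<longrightarrow> z = 0"
      proof (intro ballI impI, elim conjE)
        fix z assume z: "z \<in> frame_span e" "\<omega> \<gamma>\<^sub>1 z = 0" "\<omega> \<gamma>\<^sub>2 z = 0"
        then obtain s t where st: "z = s *s a + t *s b" by (auto simp: frame_span_def ab span_pair)
        have 0: "s * \<omega> \<gamma>\<^sub>1 a + t * \<omega> \<gamma>\<^sub>1 b = 0" "s * \<omega> \<gamma>\<^sub>2 a + t * \<omega> \<gamma>\<^sub>2 b = 0"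
          using z(2,3) by (simp_all add: st \<omega>_linear)
        have "s * disc e = \<omega> \<gamma>\<^sub>2 b * (s * \<omega> \<gamma>\<^sub>1 a + t * \<omega> \<gamma>\<^sub>1 b) - \<omega> \<gamma>\<^sub>1 b * (s * \<omega> \<gamma>\<^sub>2 a + t * \<omega> \<gamma>\<^sub>2 b)"
          "t * disc e = \<omega> \<gamma>\<^sub>1 a * (s * \<omega> \<gamma>\<^sub>2 a + t * \<omega> \<gamma>\<^sub>2 b) - \<omega> \<gamma>\<^sub>2 a * (s * \<omega> \<gamma>\<^sub>1 a + t * \<omega> \<gamma>\<^sub>1 b)"
          by (simp_all add: disc_def ab algebra_simps)
        then have "s * disc e = 0" "t * disc e = 0" unfolding 0 by simp_all
        then show "z = 0" using d by (simp add: st)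
      qed
    next
      assume R: "\<forall>z\<in>frame_span e. \<omega> \<gamma>\<^sub>1 z = 0 \<and> \<omega> \<gamma>\<^sub>2 z = 0 \<longrightarrow> z = 0"
      have mem: "s *s a + t *s b \<in> frame_span e" for s t by (auto simp: frame_span_def ab span_pair)
      show "disc e \<noteq> 0"
      proof
        assume d: "disc e = 0"
        have z: "\<omega> \<gamma>\<^sub>1 b * \<omega> \<gamma>\<^sub>2 a = \<omega> \<gamma>\<^sub>1 a * \<omega> \<gamma>\<^sub>2 b" using d by (simp add: disc_def ab)
        have "\<omega> \<gamma>\<^sub>1 b *s a + (- \<omega> \<gamma>\<^sub>1 a) *s b = 0" "\<omega> \<gamma>\<^sub>2 b *s a + (- \<omega> \<gamma>\<^sub>2 a) *s b = 0"
          using z by (intro R[rule_format] mem; simp add: \<omega>_linear mult.commute del: scale_minus_left)+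
        then have "\<omega> \<gamma>\<^sub>1 a = 0" "\<omega> \<gamma>\<^sub>2 a = 0" using ind by (metis neg_equal_0_iff_equal)+
        then have "1 *s a + 0 *s b = 0" using R[rule_format, OF mem, of 1 0] by (simp add: \<omega>_linear)
        then show False using ind by (metis zero_neq_one)
      qed
    qed
  qed
  have disc_W': "disc e \<noteq> 0" if "e \<in> frames W'" for e
    using disc_iff[OF that] frame_span_frames[OF that] by (simp add: W'_def)
  have poly: "disc \<in> poly_funs"
  proof -
    have "(\<lambda>e. \<omega> \<gamma>\<^sub>1 (fst e) * \<omega> \<gamma>\<^sub>2 (snd e) + - (\<omega> \<gamma>\<^sub>1 (snd e) * \<omega> \<gamma>\<^sub>2 (fst e))) \<in> poly_funs"
      by (intro poly_funs.plus poly_funs.times poly_funs_uminus poly_funs_\<omega>)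
    then show ?thesis by (simp add: disc_def[abs_def])
  qed
  have "W' \<subseteq> W" by (auto simp: W'_def)
  moreover have "U \<in> W'"
  proof -
    have "disc (x, y) \<noteq> 0" by (simp add: disc_def pair)
    then show ?thesis using disc_iff[OF e] U \<open>span {x, y} = U\<close> by (simp add: W'_def frame_span_def)
  qed
  moreover have "zariski_open W'"
    unfolding zariski_open_def
  proof (intro conjI ballI)
    show "W' \<subseteq> IGr" using \<open>W' \<subseteq> W\<close> IGr by blast
    fix e assume e: "e \<in> frames W'"
    then have "e \<in> frames W" using frames_mono[OF \<open>W' \<subseteq> W\<close>] by blast
    with W obtain h where h: "h \<in> poly_funs" "h e \<noteq> 0" "\<And>e'. e' \<in> frames IGr \<Longrightarrow> h e' \<noteq> 0 \<Longrightarrow> e' \<in> frames W"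
      by (rule zariski_openD) (rule that)
    have "e' \<in> frames W'" if "e' \<in> frames W" "disc e' \<noteq> 0" for e'
      using that disc_iff[OF that(1)] by (cases e') (auto simp: W'_def frames_def frame_span_def)
    then show "\<exists>h\<in>poly_funs. h e \<noteq> 0 \<and> (\<forall>e'\<in>frames IGr. h e' \<noteq> 0 \<longrightarrow> e' \<in> frames W')"
      using h disc_W'[OF e] by (intro bexI[OF _ poly_funs.times[OF h(1) poly]]) auto
  qed
  moreover have "adapted_open scale \<omega> Bs bd n \<gamma>\<^sub>1 \<gamma>\<^sub>2 W'"
    by unfold_locales (use pair(5) \<open>W' \<subseteq> W\<close> IGr disc_W' in \<open>auto simp: disc_def\<close>)
  ultimately show ?thesis by blast
qed

end

context adapted_open
begin

lemma column_exact:
  assumes s: "s \<in> sec (form_bundle (t - b - c) (b + c) c) W" and bc: "b + c \<le> t" "c \<ge> 1" and zero: "vert W s = 0"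
  shows "\<exists>u\<in>sec (form_bundle (t - b - (c - 1)) (b + (c - 1)) (c - 1)) W. vert W u = s"
proof -
  have c: "c = Suc (c - 1)" and eqs: "Suc (t - b - c) = t - b - (c - 1)" "b + c - 1 = b + (c - 1)" using bc by simp_all
  have "s \<in> sec (form_bundle (t - b - c) (b + c) (Suc (c - 1))) W" using s c by simp
  from vertical_exact[OF this _ zero] show ?thesis unfolding eqs using bc by simp
qed

text \<open>
  Since the columns are exact above the bottom row, a cochain whose differential lives in the
  bottom row can be moved into the bottom row by a coboundary: its highest component is vertically
  closed, hence can be removed at the expense of a lower one.
\<close>

lemma move_to_bottom_row:
  assumes Wo: "zariski_open W" and w: "w \<in> sec (obj (bic_total t) k) W"
    and bottom: "\<And>b c. c \<ge> 1 \<Longrightarrow> diff (bic_total t) k W w (b, c) = 0"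
  shows "\<exists>u\<in>sec (obj (bic_total t) (k - 1)) W. \<forall>b c. c \<ge> 1 \<longrightarrow> (w - diff (bic_total t) (k - 1) W u) (b, c) = 0"
proof -
  let ?D = "diff (bic_total t)"
  have pre: "presheaf_of_modules IGr_top IGr_reg (obj (bic_total t) j)" for j by (rule sheaf_presheaf[OF sheaf_total])
  have o: "openin IGr_top W" using Wo by (simp add: openin_IGr_top)
  have "\<exists>u\<in>sec (obj (bic_total t) (k - 1)) W. \<forall>b c. c \<ge> m \<longrightarrow> (w - ?D (k - 1) W u) (b, c) = 0" if "1 \<le> m" "m \<le> t + 1" for m
    using that(2,1)
  proof (induction rule: inc_induct)
    case base
    define z :: "nat \<times> nat \<Rightarrow> 'v \<times> 'v \<Rightarrow> ('k, 'v) form_poly" where "z = 0"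
    have Dz: "?D (k - 1) W z = 0" unfolding z_def by (rule sheaf_hom_0[OF pre total_diff_hom o])
    have "z \<in> sec (obj (bic_total t) (k - 1)) W" unfolding z_def by (rule presheafD_sec(1)[OF pre o])
    moreover have "(w - ?D (k - 1) W z) (b, c) = 0" if "c \<ge> t + 1" for b c
      unfolding Dz using total_sec_outside[OF w, of b c] that by simp
    ultimately show ?case by blast
  next
    case (step m)
    have "1 \<le> Suc m" by simp
    from step.IH[OF this] obtain u where u: "u \<in> sec (obj (bic_total t) (k - 1)) W"
      "\<And>b c. c \<ge> Suc m \<Longrightarrow> (w - ?D (k - 1) W u) (b, c) = 0"
      by blast
    define w' where "w' = w - ?D (k - 1) W u"
    have Du: "?D (k - 1) W u \<in> sec (obj (bic_total t) k) W" using total_diff_sec[OF Wo u(1)] by simp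
    have w': "w' \<in> sec (obj (bic_total t) k) W" unfolding w'_def by (rule presheafD_sec(2)[OF pre o w Du])
    have Dw': "?D k W w' = ?D k W w" using total_diff_square[OF Wo u(1)] by (simp add: w'_def total_diff_diff)
    show ?case
    proof (cases "\<exists>b. b + m \<le> t \<and> int m - int b = k")
      case False
      have "w' (b, c) = 0" if "c \<ge> m" for b c
        using that u(2)[of c b] total_sec_outside[OF w', of b c] False by (cases "c = m") (auto simp: w'_def)
      then show ?thesis using u(1) by (intro bexI[of _ u]) (auto simp: w'_def)
    next
      case True
      then obtain b where b: "b + m \<le> t" "int m - int b = k" by blast
      have s: "w' (b, m) \<in> sec (form_bundle (t - b - m) (b + m) m) W"
        using w' b by (auto simp: total_obj split: if_splits)
      have "?D k W w' (b, m + 1) = bic_horiz (b + 1) (m + 1) W (w' (b + 1, m + 1)) + alt_sign b (vert W (w' (b, m)))"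
        using total_diff[OF Wo w', of "m + 1" b] b by simp
      moreover have "w' (b + 1, m + 1) = 0" using u(2) by (simp add: w'_def)
      ultimately have "vert W (w' (b, m)) = 0" using bottom[of "m + 1" b] Dw' by (simp add: bic_horiz_lin alt_sign_simps)
      from column_exact[OF s b(1) step.prems this]
      obtain y where y: "y \<in> sec (form_bundle (t - b - (m - 1)) (b + (m - 1)) (m - 1)) W" "vert W y = w' (b, m)" by blast
      define v where "v i = (if i = (b, m - 1) then alt_sign b y else 0)" for i
      have y': "alt_sign b y \<in> sec (form_bundle (t - b - (m - 1)) (b + (m - 1)) (m - 1)) W"
        using y(1) sec_diff[OF sec_zero y(1)] by (simp add: alt_sign_def fun_Compl_def)
      have v: "v \<in> sec (obj (bic_total t) (k - 1)) W"
        using y' b step.prems by (auto simp: total_obj v_def of_nat_diff sec_zero)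
      have Dv: "?D (k - 1) W v (b', c) = (if b' = b \<and> c = m then w' (b, m) else 0)" if "c \<ge> m" for b' c
      proof (cases "int c - int b' = k")
        case True
        have "bic_horiz (b' + 1) c W (v (b' + 1, c)) = 0" using that step.prems by (auto simp: v_def bic_horiz_lin)
        moreover have "(if c > 0 then alt_sign b' (vert W (v (b', c - 1))) else 0) = (if b' = b \<and> c = m then w' (b, m) else 0)"
          using that step.prems y(2) by (auto simp: v_def alt_sign_simps vert_lin)
        ultimately show ?thesis using total_diff[OF Wo v, of c b'] True by simp
      next
        case False then show ?thesis using b total_diff_outside[of b' c t "k - 1" W v] by auto
      qed
      have "(w - ?D (k - 1) W (u + v)) (b', c) = 0" if "c \<ge> m" for b' c
      proof -
        have "(w - ?D (k - 1) W (u + v)) (b', c) = w' (b', c) - ?D (k - 1) W v (b', c)"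
          by (simp add: w'_def total_diff_add)
        also have "\<dots> = 0"
        proof (cases "c = m")
          case True
          show ?thesis
          proof (cases "b' = b")
            case True then show ?thesis using Dv[OF that] \<open>c = m\<close> by simp
          next
            case False
            then have "w' (b', c) = 0" using b \<open>c = m\<close> by (intro total_sec_outside[OF w']) auto
            then show ?thesis using Dv[OF that] False by simp
          qed
        next
          case False
          then show ?thesis using Dv[OF that] u(2)[of c b'] that by (simp add: w'_def)
        qed
        finally show ?thesis .
      qed
      then show ?thesis using presheaf_add[OF pre o u(1) v] by blast
    qed
  qed
  from this[of 1] show ?thesis by simp
qed

end

context finite_symplectic_space
begin

subsection \<open>The complex of kernels\<close>

lemma E_sheaf_simps:
  "s \<in> sec (E_sheaf a b) W \<longleftrightarrow> s \<in> sec (form_bundle a b 0) W \<and> vert W s = 0"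
  "res (E_sheaf a b) W s = (\<lambda>e. if e \<in> frames W then s e else 0)"
  "act (E_sheaf a b) r s = (\<lambda>e. scale_poly (r (frame_span e)) (s e))"
  by (simp_all add: E_sheaf_def kernel_sheaf_simps form_bundle_simps)

lemma sheaf_E_sheaf: "sheaf_of_modules IGr_top IGr_reg (E_sheaf a b)"
  unfolding E_sheaf_def
  by (rule sheaf_kernel_sheaf[OF sheaf_form_bundle sheaf_form_bundle[of "a - 1" "Suc b" "Suc 0"]])
    (unfold vert_def[abs_def], rule sheaf_hom_pointwise[OF sec_d0 d0_lin(2) d0_lin(5)])

lemma E_diff_horiz: "b \<ge> 1 \<Longrightarrow> E_diff b W s = bic_horiz b 0 W s"
  by (simp add: E_diff_def bic_horiz_def fun_eq_iff)

lemma E_obj: "obj (E_complex t) k = (if - int t \<le> k \<and> k \<le> 0 then E_sheaf (t - nat (- k)) (nat (- k)) else zero_sheaf)"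
  and E_complex_diff: "diff (E_complex t) k W s = (if - int t \<le> k \<and> k < 0 then bic_horiz (nat (- k)) 0 W s else 0)"
  by (auto simp: E_complex_def intro!: E_diff_horiz)

lemma E_sec_bic: "s \<in> sec (E_sheaf (t - b) b) W \<Longrightarrow> b \<le> t \<Longrightarrow> s \<in> sec (bic_obj t b 0) W"
  by (simp add: bic_obj_inside E_sheaf_simps)

lemma sheaf_E_obj: "sheaf_of_modules IGr_top IGr_reg (obj (E_complex t) k)"
  by (simp add: E_obj sheaf_E_sheaf sheaf_zero_sheaf)

lemma E_diff_sec:
  assumes W: "zariski_open W" and s: "s \<in> sec (E_sheaf (t - Suc b) (Suc b)) W" and b: "Suc b \<le> t"
  shows "bic_horiz (Suc b) 0 W s \<in> sec (E_sheaf (t - b) b) W"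
proof -
  have s': "s \<in> sec (bic_obj t (b + 1) 0) W" using E_sec_bic[OF s b] by simp
  have "bic_horiz (b + 1) 0 W s \<in> sec (bic_obj t b 0) W"
    using sheaf_homD(1)[OF bic_horiz_hom _ s'] W by (simp add: openin_IGr_top)
  moreover have "vert W (bic_horiz (b + 1) 0 W s) = bic_horiz (b + 1) (0 + 1) W (vert W s)"
    by (rule bic_horiz_vert[OF W s', symmetric])
  moreover have "vert W s = 0" using s by (simp add: E_sheaf_simps)
  ultimately show ?thesis using b by (simp add: E_sheaf_simps bic_obj_inside bic_horiz_lin)
qed

lemma E_diff_hom: "sheaf_hom IGr_top IGr_reg (obj (E_complex t) k) (obj (E_complex t) (k + 1)) (diff (E_complex t) k)"
proof (cases "- int t \<le> k \<and> k < 0")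
  case True
  define b where "b = nat (- k - 1)"
  have k: "k = - int (Suc b)" using True by (simp add: b_def)
  then have b: "k = - int (Suc b)" "Suc b \<le> t" using True by linarith+
  have objs: "obj (E_complex t) k = E_sheaf (t - Suc b) (Suc b)" "obj (E_complex t) (k + 1) = E_sheaf (t - b) b"
    and d: "diff (E_complex t) k = bic_horiz (Suc b) 0"
    using b by (simp_all add: E_obj E_complex_diff fun_eq_iff nat_add_distrib)
  show ?thesis
    unfolding objs d
  proof (rule sheaf_homI, unfold openin_IGr_top)
    show "bic_horiz (Suc b) 0 W s \<in> sec (E_sheaf (t - b) b) W" if "zariski_open W" "s \<in> sec (E_sheaf (t - Suc b) (Suc b)) W" for W s
      by (rule E_diff_sec[OF that b(2)])
    show "bic_horiz (Suc b) 0 W (s + s') = bic_horiz (Suc b) 0 W s + bic_horiz (Suc b) 0 W s'" for W s s'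
      by (rule bic_horiz_lin(2))
  qed (auto simp: bic_horiz_lin E_sheaf_simps bic_horiz_eq horiz_op_lin scale_poly_scale_poly mult_ac simp del: of_nat_Suc)
next
  case False
  have d: "diff (E_complex t) k W s = 0" for W s using False by (auto simp: E_complex_diff)
  consider "obj (E_complex t) k = zero_sheaf" | "obj (E_complex t) (k + 1) = zero_sheaf" using False by (auto simp: E_obj)
  then show ?thesis
  proof cases
    case 1
    show ?thesis unfolding 1 by (rule sheaf_hom_from_zero[OF sheaf_presheaf[OF sheaf_E_obj]]) (rule d)
  next
    case 2
    show ?thesis unfolding 2 by (rule sheaf_hom_to_zero[OF sheaf_presheaf[OF sheaf_E_obj]]) (rule d)
  qed
qed

lemma E_diff_square:
  assumes W: "zariski_open W" and s: "s \<in> sec (obj (E_complex t) k) W"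
  shows "diff (E_complex t) (k + 1) W (diff (E_complex t) k W s) = 0"
proof (cases "- int t \<le> k \<and> k < - 1")
  case True
  define b where "b = nat (- k - 2)"
  have k: "k = - int (b + 2)" using True by (simp add: b_def)
  then have b: "k = - int (b + 2)" "b + 2 \<le> t" using True by linarith+
  have "s \<in> sec (bic_obj t (b + 2) 0) W" using s b by (intro E_sec_bic) (auto simp: E_obj nat_add_distrib)
  from bic_horiz_bic_horiz[OF W this] show ?thesis using b by (simp add: E_complex_diff nat_add_distrib)
qed (auto simp: E_complex_diff bic_horiz_lin)

lemma is_complex_E: "is_complex IGr_top IGr_reg (E_complex t)"
  unfolding is_complex_def openin_IGr_top using sheaf_E_obj E_diff_hom E_diff_square by blast

text \<open>
  On the bottom row the horizontal arrow is the differential of \<open>\<E>\<^sub>t\<close> (\<open>E_diff_horiz\<close>), so the inclusion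
  is a chain map without signs or scalars.
\<close>

definition E_inclusion :: "nat \<Rightarrow> int \<Rightarrow> 'v set set \<Rightarrow> ('v \<times> 'v \<Rightarrow> ('k, 'v) form_poly) \<Rightarrow> nat \<times> nat \<Rightarrow> 'v \<times> 'v \<Rightarrow> ('k, 'v) form_poly" where
  "E_inclusion t k W s = (\<lambda>(b, c). if c = 0 \<and> int b = - k \<and> b \<le> t then s else 0)"

lemma E_inclusion_sec: "s \<in> sec (obj (E_complex t) k) W \<Longrightarrow> E_inclusion t k W s \<in> sec (obj (bic_total t) k) W"
  unfolding total_obj
proof (intro allI)
  fix b c assume s: "s \<in> sec (obj (E_complex t) k) W"
  show "if b + c \<le> t \<and> int c - int b = k then E_inclusion t k W s (b, c) \<in> sec (form_bundle (t - b - c) (b + c) c) W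
     else E_inclusion t k W s (b, c) = 0"
  proof (cases "c = 0 \<and> int b = - k \<and> b \<le> t")
    case True
    then have k: "k = - int b" "- int t \<le> k \<and> k \<le> 0" by simp_all
    then have "s \<in> sec (form_bundle (t - b) b 0) W" using s by (simp add: E_obj E_sheaf_simps)
    then show ?thesis using True k(1) by (simp add: E_inclusion_def)
  next
    case False
    then show ?thesis using sec_zero by (auto simp: E_inclusion_def)
  qed
qed

lemma E_inclusion_diff:
  assumes W: "zariski_open W" and s: "s \<in> sec (obj (E_complex t) k) W"
  shows "diff (bic_total t) k W (E_inclusion t k W s) = E_inclusion t (k + 1) W (diff (E_complex t) k W s)"
proof
  fix i :: "nat \<times> nat"
  obtain b c where i: "i = (b, c)" by (cases i)
  have v: "vert W s = 0" using s by (auto simp: E_obj E_sheaf_simps sec_zero_sheaf vert_lin split: if_splits)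
  show "diff (bic_total t) k W (E_inclusion t k W s) i = E_inclusion t (k + 1) W (diff (E_complex t) k W s) i"
  proof (cases "int c - int b = k + 1")
    case True
    have "(if c > 0 then alt_sign b (vert W (E_inclusion t k W s (b, c - 1))) else 0) = 0"
      by (simp add: E_inclusion_def v vert_lin alt_sign_simps)
    then have "diff (bic_total t) k W (E_inclusion t k W s) (b, c) = bic_horiz (b + 1) c W (E_inclusion t k W s (b + 1, c))"
      using total_diff[OF W E_inclusion_sec[OF s] True] by simp
    also have "\<dots> = E_inclusion t (k + 1) W (diff (E_complex t) k W s) (b, c)"
    proof (cases "c = 0 \<and> b + 1 \<le> t")
      case c: True
      then have "nat (- k) = Suc b" "int (b + 1) = - k" using True by simp_all
      then show ?thesis using c True by (simp add: E_inclusion_def E_complex_diff)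
    next
      case False
      then show ?thesis using True by (auto simp: E_inclusion_def E_complex_diff bic_horiz_lin)
    qed
    finally show ?thesis by (simp add: i)
  next
    case False
    then show ?thesis by (auto simp: i total_diff_outside E_inclusion_def)
  qed
qed

lemma E_inclusion_chain_map: "chain_map IGr_top IGr_reg (E_complex t) (bic_total t) (E_inclusion t)"
  unfolding chain_map_def openin_IGr_top
proof (intro allI conjI impI ballI)
  fix k
  show "sheaf_hom IGr_top IGr_reg (obj (E_complex t) k) (obj (bic_total t) k) (E_inclusion t k)"
  proof (rule sheaf_homI, unfold openin_IGr_top)
    fix W s assume W: "zariski_open W" and s: "s \<in> sec (obj (E_complex t) k) W"
    note s' = E_inclusion_sec[OF s]
    have out: "s = 0" "obj (E_complex t) k = zero_sheaf" if "\<not> (- int t \<le> k \<and> k \<le> 0)"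
      using s that by (auto simp: E_obj sec_zero_sheaf)
    have act: "act (obj (E_complex t) k) r s = (\<lambda>e. scale_poly (r (frame_span e)) (s e))" for r
    proof (cases "- int t \<le> k \<and> k \<le> 0")
      case False then show ?thesis using out by (intro ext) (simp add: zero_sheaf_def)
    qed (simp add: E_obj E_sheaf_simps)
    have res: "res (obj (E_complex t) k) W' s = (\<lambda>e. if e \<in> frames W' then s e else 0)" for W'
    proof (cases "- int t \<le> k \<and> k \<le> 0")
      case False then show ?thesis using out by (intro ext) (simp add: zero_sheaf_def)
    qed (simp add: E_obj E_sheaf_simps)
    show "E_inclusion t k W s \<in> sec (obj (bic_total t) k) W" by (rule s')
    show "E_inclusion t k W (s + s'') = E_inclusion t k W s + E_inclusion t k W s''" for s''
      by (auto simp: E_inclusion_def)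
    show "E_inclusion t k W (act (obj (E_complex t) k) r s) = act (obj (bic_total t) k) r (E_inclusion t k W s)" for r
      unfolding total_act[OF s'] act by (intro ext) (simp add: E_inclusion_def split: prod.split)
    show "res (obj (bic_total t) k) W' (E_inclusion t k W s) = E_inclusion t k W' (res (obj (E_complex t) k) W' s)" for W'
      unfolding total_res[OF s'] res by (intro ext) (simp add: E_inclusion_def split: prod.split)
  qed
qed (simp add: E_inclusion_diff)

end

context adapted_open
begin

lemma bottom_row_E:
  assumes Wo: "zariski_open W" and w: "w \<in> sec (obj (bic_total t) k) W"
    and bottom: "\<And>b c. c \<ge> 1 \<Longrightarrow> w (b, c) = 0" and dbottom: "\<And>b c. c \<ge> 1 \<Longrightarrow> diff (bic_total t) k W w (b, c) = 0"
  shows "\<exists>s\<in>sec (obj (E_complex t) k) W. w = E_inclusion t k W s"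
proof (cases "- int t \<le> k \<and> k \<le> 0")
  case True
  define b where "b = nat (- k)"
  have k: "k = - int b" using True by (simp add: b_def)
  then have b: "k = - int b" "b \<le> t" using True by linarith+
  have "w (b, 0) \<in> sec (form_bundle (t - b) b 0) W" using total_sec_obj[OF w, of 0 b] b by (simp add: bic_obj_inside)
  moreover have "vert W (w (b, 0)) = 0"
    using total_diff[OF Wo w, of 1 b] dbottom[of 1 b] bottom[of 1 "b + 1"] b by (simp add: bic_horiz_lin alt_sign_simps)
  ultimately have "w (b, 0) \<in> sec (obj (E_complex t) k) W" using b by (simp add: E_obj E_sheaf_simps)
  moreover have "w = E_inclusion t k W (w (b, 0))"
  proof
    fix i show "w i = E_inclusion t k W (w (b, 0)) i"
      using bottom[of "snd i" "fst i"] total_sec_outside[OF w, of "fst i" "snd i"] b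
      by (cases i; cases "snd i = 0") (auto simp: E_inclusion_def)
  qed
  ultimately show ?thesis by blast
next
  case False
  have "w i = 0" for i
    using bottom[of "snd i" "fst i"] total_sec_outside[OF w, of "fst i" "snd i"] False by (cases i; cases "snd i = 0") auto
  then have "w = E_inclusion t k W 0" by (auto simp: E_inclusion_def)
  moreover have "0 \<in> sec (obj (E_complex t) k) W"
    using presheafD_sec(1)[OF sheaf_presheaf[OF sheaf_E_obj]] Wo by (simp add: openin_IGr_top)
  ultimately show ?thesis by blast
qed

text \<open>
  This serves both halves of the quasi-isomorphism: \<open>w\<close> is a cocycle for surjectivity on cohomology, and
  a cochain whose differential lies in \<open>\<E>\<^sub>t\<close> for injectivity.
\<close>

lemma cocycle_from_E:
  assumes Wo: "zariski_open W" and w: "w \<in> sec (obj (bic_total t) k) W"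
    and bottom: "\<And>b c. c \<ge> 1 \<Longrightarrow> diff (bic_total t) k W w (b, c) = 0"
  shows "\<exists>s\<in>sec (obj (E_complex t) k) W. \<exists>u\<in>sec (obj (bic_total t) (k - 1)) W.
    w = E_inclusion t k W s + diff (bic_total t) (k - 1) W u \<and> E_inclusion t (k + 1) W (diff (E_complex t) k W s) = diff (bic_total t) k W w"
proof -
  have pre: "presheaf_of_modules IGr_top IGr_reg (obj (bic_total t) j)" for j by (rule sheaf_presheaf[OF sheaf_total])
  have o: "openin IGr_top W" using Wo by (simp add: openin_IGr_top)
  obtain u where u: "u \<in> sec (obj (bic_total t) (k - 1)) W"
    and z: "\<And>b c. c \<ge> 1 \<Longrightarrow> (w - diff (bic_total t) (k - 1) W u) (b, c) = 0"
    using move_to_bottom_row[OF Wo w bottom] by blast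
  let ?w = "w - diff (bic_total t) (k - 1) W u"
  have Du: "diff (bic_total t) (k - 1) W u \<in> sec (obj (bic_total t) k) W" using total_diff_sec[OF Wo u] by simp
  have w': "?w \<in> sec (obj (bic_total t) k) W" by (rule presheafD_sec(2)[OF pre o w Du])
  have D: "diff (bic_total t) k W ?w = diff (bic_total t) k W w"
    using total_diff_square[OF Wo u] by (simp add: total_diff_diff)
  obtain s where s: "s \<in> sec (obj (E_complex t) k) W" "?w = E_inclusion t k W s"
    using bottom_row_E[OF Wo w' z] bottom unfolding D by blast
  have "E_inclusion t (k + 1) W (diff (E_complex t) k W s) = diff (bic_total t) k W w"
    using E_inclusion_diff[OF Wo s(1)] D unfolding s(2) by simp
  moreover have "w = E_inclusion t k W s + diff (bic_total t) (k - 1) W u" using s(2) by (simp add: diff_eq_eq)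
  ultimately show ?thesis using s(1) u by blast
qed

end

section \<open>Quasi-isomorphism and acyclicity\<close>

context finite_symplectic_space
begin

lemma E_inclusion_injective:
  assumes "s \<in> sec (obj (E_complex t) k) W" "s' \<in> sec (obj (E_complex t) k) W" "E_inclusion t k W s = E_inclusion t k W s'"
  shows "s = s'"
proof (cases "- int t \<le> k \<and> k \<le> 0")
  case True
  define b where "b = nat (- k)"
  have k: "k = - int b" using True by (simp add: b_def)
  then have "b \<le> t" using True by linarith
  then show ?thesis using fun_cong[OF assms(3), of "(b, 0)"] k by (simp add: E_inclusion_def)
next
  case False
  then show ?thesis using assms(1,2) by (auto simp: E_obj sec_zero_sheaf split: if_splits)
qed

lemma E_inclusion_zero: "E_inclusion t k W 0 = 0"
  by (intro ext) (simp add: E_inclusion_def split: prod.split)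

lemma sec_zero_E: "zariski_open W \<Longrightarrow> 0 \<in> sec (obj (E_complex t) k) W"
  using presheafD_sec(1)[OF sheaf_presheaf[OF sheaf_E_obj]] by (simp add: openin_IGr_top)

lemma total_diff_res:
  assumes W: "zariski_open W" "zariski_open W'" "W' \<subseteq> W" and s: "s \<in> sec (obj (bic_total t) k) W"
  shows "res (obj (bic_total t) k) W' s \<in> sec (obj (bic_total t) k) W'"
    and "diff (bic_total t) k W' (res (obj (bic_total t) k) W' s) = res (obj (bic_total t) (k + 1)) W' (diff (bic_total t) k W s)"
  using presheafD_res(1)[OF sheaf_presheaf[OF sheaf_total], of W W' s] sheaf_homD(4)[OF total_diff_hom, of W W' s] W s
  by (simp_all add: openin_IGr_top)

lemma cocycle_locally_from_E:
  assumes W: "zariski_open W" "p \<in> W" and z: "z \<in> cocycles (bic_total t) k W"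
  shows "\<exists>W' \<gamma>\<^sub>1 \<gamma>\<^sub>2. zariski_open W' \<and> p \<in> W' \<and> W' \<subseteq> W \<and> adapted_open scale \<omega> Bs bd n \<gamma>\<^sub>1 \<gamma>\<^sub>2 W' \<and>
    (\<exists>s\<in>cocycles (E_complex t) k W'. \<exists>u\<in>sec (obj (bic_total t) (k - 1)) W'.
      res (obj (bic_total t) k) W' z = E_inclusion t k W' s + diff (bic_total t) (k - 1) W' u)"
proof -
  have z: "z \<in> sec (obj (bic_total t) k) W" "diff (bic_total t) k W z = 0" using z by (simp_all add: cocycles_def)
  obtain W' \<gamma>\<^sub>1 \<gamma>\<^sub>2 where W': "zariski_open W'" "W' \<subseteq> W" "p \<in> W'" and adapted: "adapted_open scale \<omega> Bs bd n \<gamma>\<^sub>1 \<gamma>\<^sub>2 W'"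
    using adapted_neighbourhood[OF W] by blast
  then interpret adapted_open scale \<omega> Bs bd n \<gamma>\<^sub>1 \<gamma>\<^sub>2 W' by simp
  note o = W(1)[folded openin_IGr_top] W'(1)[folded openin_IGr_top]
  define z' where "z' = res (obj (bic_total t) k) W' z"
  have z': "z' \<in> sec (obj (bic_total t) k) W'" unfolding z'_def by (rule total_diff_res(1)[OF W(1) W'(1,2) z(1)])
  have Dz': "diff (bic_total t) k W' z' = 0"
    unfolding z'_def total_diff_res(2)[OF W(1) W'(1,2) z(1)] z(2)
    by (rule presheaf_res_0[OF sheaf_presheaf[OF sheaf_total] o W'(2)])
  have "diff (bic_total t) k W' z' (b, c) = 0" for b c by (simp add: Dz')
  from cocycle_from_E[OF W'(1) z' this] obtain s u where s: "s \<in> sec (obj (E_complex t) k) W'"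
    and u: "u \<in> sec (obj (bic_total t) (k - 1)) W'" "z' = E_inclusion t k W' s + diff (bic_total t) (k - 1) W' u"
    and ds: "E_inclusion t (k + 1) W' (diff (E_complex t) k W' s) = 0"
    unfolding Dz' by blast
  have "diff (E_complex t) k W' s = 0"
    using sheaf_homD(1)[OF E_diff_hom o(2) s] sec_zero_E[OF W'(1)] ds
    by (intro E_inclusion_injective[of _ t "k + 1" W']) (simp_all only: E_inclusion_zero)
  then have "s \<in> cocycles (E_complex t) k W'" using s by (simp add: cocycles_def)
  then show ?thesis using W' adapted u unfolding z'_def by blast
qed

lemma E_inclusion_quasi_isomorphism:
  "quasi_isomorphism IGr_top IGr_reg (E_complex t) (bic_total t) (E_inclusion t)"
  unfolding quasi_isomorphism_def openin_IGr_top
proof (intro conjI is_complex_E is_complex_total E_inclusion_chain_map allI impI ballI; (elim conjE exE)?)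
  fix k W p assume W: "zariski_open W" "p \<in> W"
  {
    fix s W1 assume "s \<in> cocycles (E_complex t) k W" and W1: "zariski_open W1" "p \<in> W1" "W1 \<subseteq> W"
      and cob: "res (obj (bic_total t) k) W1 (E_inclusion t k W s) \<in> coboundaries (bic_total t) k W1"
    then have s: "s \<in> sec (obj (E_complex t) k) W" by (simp add: cocycles_def)
    obtain W' \<gamma>\<^sub>1 \<gamma>\<^sub>2 where W': "zariski_open W'" "W' \<subseteq> W1" "p \<in> W'" and "adapted_open scale \<omega> Bs bd n \<gamma>\<^sub>1 \<gamma>\<^sub>2 W'"
      using adapted_neighbourhood[OF W1(1,2)] by blast
    then interpret adapted_open scale \<omega> Bs bd n \<gamma>\<^sub>1 \<gamma>\<^sub>2 W' by simp
    have W'W: "W' \<subseteq> W" using W' W1 by blast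
    note o = W(1)[folded openin_IGr_top] W1(1)[folded openin_IGr_top] W'(1)[folded openin_IGr_top]
    note hom = E_inclusion_chain_map[unfolded chain_map_def, rule_format, THEN conjunct1]
    define s' where "s' = res (obj (E_complex t) k) W' s"
    have s': "s' \<in> sec (obj (E_complex t) k) W'"
      unfolding s'_def by (rule presheafD_res(1)[OF sheaf_presheaf[OF sheaf_E_obj] o(1,3) W'W s])
    obtain w1 where w1: "w1 \<in> sec (obj (bic_total t) (k - 1)) W1"
      "res (obj (bic_total t) k) W1 (E_inclusion t k W s) = diff (bic_total t) (k - 1) W1 w1"
      using cob by (auto simp: coboundaries_def)
    define w where "w = res (obj (bic_total t) (k - 1)) W' w1"
    have w: "w \<in> sec (obj (bic_total t) (k - 1)) W'"
      unfolding w_def by (rule total_diff_res(1)[OF W1(1) W'(1,2) w1(1)])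
    have "diff (bic_total t) (k - 1) W' w = res (obj (bic_total t) k) W' (res (obj (bic_total t) k) W1 (E_inclusion t k W s))"
      unfolding w_def w1(2) using total_diff_res(2)[OF W1(1) W'(1,2) w1(1)] by simp
    also have "\<dots> = res (obj (bic_total t) k) W' (E_inclusion t k W s)"
      by (rule presheafD_res(4)[OF sheaf_presheaf[OF sheaf_total] o(1,2) W1(3) o(3) W'(2) E_inclusion_sec[OF s]])
    also have "\<dots> = E_inclusion t k W' s'"
      unfolding s'_def by (rule sheaf_homD(4)[OF hom o(1,3) W'W s])
    finally have Dw: "diff (bic_total t) (k - 1) W' w = E_inclusion t k W' s'" .
    have "diff (bic_total t) (k - 1) W' w (b, c) = 0" if "c \<ge> 1" for b c
      unfolding Dw using that by (simp add: E_inclusion_def)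
    from cocycle_from_E[OF W'(1) w this] obtain y where y: "y \<in> sec (obj (E_complex t) (k - 1)) W'"
      "E_inclusion t k W' (diff (E_complex t) (k - 1) W' y) = E_inclusion t k W' s'"
      unfolding Dw by auto
    have "diff (E_complex t) (k - 1) W' y \<in> sec (obj (E_complex t) k) W'"
      using sheaf_homD(1)[OF E_diff_hom o(3) y(1)] by simp
    from E_inclusion_injective[OF this s' y(2)] have "s' \<in> coboundaries (E_complex t) k W'"
      using y(1) by (auto simp: coboundaries_def)
    then show "\<exists>W'. zariski_open W' \<and> p \<in> W' \<and> W' \<subseteq> W \<and> res (obj (E_complex t) k) W' s \<in> coboundaries (E_complex t) k W'"
      using W' W'W by (auto simp: s'_def)
  }
  fix z assume "z \<in> cocycles (bic_total t) k W"
  from cocycle_locally_from_E[OF W this] obtain W' s u where W': "zariski_open W'" "p \<in> W'" "W' \<subseteq> W"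
    and s: "s \<in> cocycles (E_complex t) k W'" and u: "u \<in> sec (obj (bic_total t) (k - 1)) W'"
    and z: "res (obj (bic_total t) k) W' z = E_inclusion t k W' s + diff (bic_total t) (k - 1) W' u"
    by blast
  have "res (obj (bic_total t) k) W' z - E_inclusion t k W' s \<in> coboundaries (bic_total t) k W'"
    using u by (auto simp: coboundaries_def z)
  then show "\<exists>W'. zariski_open W' \<and> p \<in> W' \<and> W' \<subseteq> W \<and>
      (\<exists>s\<in>cocycles (E_complex t) k W'. res (obj (bic_total t) k) W' z - E_inclusion t k W' s \<in> coboundaries (bic_total t) k W')"
    using W' s by blast
qed

text \<open>
  The second leg of the roof that connects the total complex with \<open>\<E>\<^sub>t\<close>.
\<close>

lemma E_identity_quasi_isomorphism:
  "quasi_isomorphism IGr_top IGr_reg (E_complex t) (E_complex t) (\<lambda>_ _ s. s)"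
  unfolding quasi_isomorphism_def
proof (intro conjI is_complex_E allI impI ballI; (elim conjE exE)?)
  show "chain_map IGr_top IGr_reg (E_complex t) (E_complex t) (\<lambda>_ _ s. s)"
    by (simp add: chain_map_def sheaf_hom_def)
  fix k W p assume W: "openin IGr_top W" "p \<in> W"
  show "\<exists>W'. openin IGr_top W' \<and> p \<in> W' \<and> W' \<subseteq> W \<and> res (obj (E_complex t) k) W' s \<in> coboundaries (E_complex t) k W'"
    if "openin IGr_top W'" "p \<in> W'" "W' \<subseteq> W" "res (obj (E_complex t) k) W' s \<in> coboundaries (E_complex t) k W'" for s W'
    using that by blast
  fix z assume z: "z \<in> cocycles (E_complex t) k W"
  have pre: "presheaf_of_modules IGr_top IGr_reg (obj (E_complex t) j)" for j by (rule sheaf_presheaf[OF sheaf_E_obj])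
  have "diff (E_complex t) (k - 1) W 0 = 0" by (rule sheaf_hom_0[OF pre E_diff_hom W(1)])
  then have "0 \<in> coboundaries (E_complex t) k W"
    using presheafD_sec(1)[OF pre W(1)] by (force simp: coboundaries_def)
  moreover have "res (obj (E_complex t) k) W z = z" using z presheafD_sec(3)[OF pre W(1)] by (simp add: cocycles_def)
  ultimately have "res (obj (E_complex t) k) W z - z \<in> coboundaries (E_complex t) k W" by (simp only: diff_self)
  then show "\<exists>W'. openin IGr_top W' \<and> p \<in> W' \<and> W' \<subseteq> W \<and>
      (\<exists>s\<in>cocycles (E_complex t) k W'. res (obj (E_complex t) k) W' z - s \<in> coboundaries (E_complex t) k W')"
    using W z by blast
qed

lemma total_quasi_isomorphic_E: "quasi_isomorphic IGr_top IGr_reg (bic_total t) (E_complex t)"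
  unfolding quasi_isomorphic_def using E_inclusion_quasi_isomorphism E_identity_quasi_isomorphism by blast

lemma total_acyclic:
  assumes t: "t + 1 = n"
  shows "acyclic_complex IGr_top IGr_reg (bic_total t)"
  unfolding acyclic_complex_def openin_IGr_top
proof (intro conjI is_complex_total allI impI ballI; (elim conjE)?)
  fix k W p z assume W: "zariski_open W" "p \<in> W" and z: "z \<in> cocycles (bic_total t) k W"
  from cocycle_locally_from_E[OF W z] obtain W' \<gamma>\<^sub>1 \<gamma>\<^sub>2 s u where W': "zariski_open W'" "p \<in> W'" "W' \<subseteq> W"
    and adapted: "adapted_open scale \<omega> Bs bd n \<gamma>\<^sub>1 \<gamma>\<^sub>2 W'" and "s \<in> cocycles (E_complex t) k W'"
    and u: "u \<in> sec (obj (bic_total t) (k - 1)) W'" "res (obj (bic_total t) k) W' z = E_inclusion t k W' s + diff (bic_total t) (k - 1) W' u"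
    by blast
  then have s: "s \<in> sec (obj (E_complex t) k) W'" and ds: "diff (E_complex t) k W' s = 0" by (simp_all add: cocycles_def)
  interpret adapted_open scale \<omega> Bs bd n \<gamma>\<^sub>1 \<gamma>\<^sub>2 W' by (rule adapted)
  note o = W'(1)[folded openin_IGr_top]
  have "\<exists>w\<in>sec (obj (E_complex t) (k - 1)) W'. diff (E_complex t) (k - 1) W' w = s"
  proof (cases "- int t \<le> k \<and> k \<le> 0")
    case True
    define b where "b = nat (- k)"
    have k: "k = - int b" using True by (simp add: b_def)
    then have b: "b \<le> t" using True by linarith
    have s: "s \<in> sec (form_bundle (t - b) b 0) W'" "vert W' s = 0" using s True k by (simp_all add: E_obj E_sheaf_simps)
    have "E_diff b W' s = 0" if "b \<ge> 1" using ds that True k by (simp add: E_diff_horiz E_complex_diff)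
    from E_exact[OF s(1) _ s(2) this] obtain w where w: "w \<in> sec (form_bundle (t - b - 1) (Suc b) 0) W'" "vert W' w = 0"
      "E_diff (Suc b) W' w = s" "t - b = 0 \<Longrightarrow> w = 0" using b t by auto
    have w3: "bic_horiz (Suc b) 0 W' w = s" using w(3) by (simp add: E_diff_horiz)
    show ?thesis
    proof (cases "b = t")
      case True
      then have "s = 0" using w3 w(4) by (simp add: bic_horiz_lin)
      then show ?thesis
        using sec_zero_E[OF W'(1)] sheaf_hom_0[OF sheaf_presheaf[OF sheaf_E_obj] E_diff_hom o] by blast
    next
      case False
      then have "- int t \<le> k - 1" "nat (- (k - 1)) = Suc b" using b k by simp_all
      then show ?thesis using w w3 k by (intro bexI[of _ w]) (simp_all add: E_complex_diff E_obj E_sheaf_simps)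
    qed
  next
    case False
    then have "s = 0" using s by (auto simp: E_obj sec_zero_sheaf split: if_splits)
    then show ?thesis
      using sec_zero_E[OF W'(1)] sheaf_hom_0[OF sheaf_presheaf[OF sheaf_E_obj] E_diff_hom o] by blast
  qed
  then obtain w where w: "w \<in> sec (obj (E_complex t) (k - 1)) W'" "diff (E_complex t) (k - 1) W' w = s" by blast
  have "diff (bic_total t) (k - 1) W' (E_inclusion t (k - 1) W' w + u) = res (obj (bic_total t) k) W' z"
    using E_inclusion_diff[OF W'(1) w(1)] w(2) u(2) by (simp add: total_diff_add)
  moreover have "E_inclusion t (k - 1) W' w + u \<in> sec (obj (bic_total t) (k - 1)) W'"
    by (rule presheaf_add[OF sheaf_presheaf[OF sheaf_total] o E_inclusion_sec[OF w(1)] u(1)])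
  ultimately have "res (obj (bic_total t) k) W' z \<in> coboundaries (bic_total t) k W'" unfolding coboundaries_def by (metis imageI)
  then show "\<exists>W'. zariski_open W' \<and> p \<in> W' \<and> W' \<subseteq> W \<and> res (obj (bic_total t) k) W' z \<in> coboundaries (bic_total t) k W'"
    using W' by blast
qed

end

theorem corollary4p4:
  fixes scale :: "'k::{alg_closed_field, field_char_0} \<Rightarrow> 'v::ab_group_add \<Rightarrow> 'v"
    and \<omega> :: "'v \<Rightarrow> 'v \<Rightarrow> 'k" and n t :: nat
  assumes "symplectic_space scale \<omega>"
    and "vector_space.dim scale (UNIV :: 'v set) = 2 * n"
    and "n \<ge> 2" and "t \<le> 2 * n - 2"
  shows
    "is_bicomplex (symplectic_space.IGr_top scale \<omega>) (symplectic_space.IGr_reg scale)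
       (symplectic_space.bic_index t) (symplectic_space.bic_term scale t)
       (symplectic_space.bic_horiz \<omega>) symplectic_space.bic_vert \<and>
     quasi_isomorphic (symplectic_space.IGr_top scale \<omega>) (symplectic_space.IGr_reg scale)
       (symplectic_space.bic_total scale \<omega> t) (symplectic_space.E_complex scale \<omega> t) \<and>
     (t = n - 1 \<longrightarrow>
       acyclic_complex (symplectic_space.IGr_top scale \<omega>) (symplectic_space.IGr_reg scale)
         (symplectic_space.bic_total scale \<omega> t))"
proof -
  interpret symplectic_space scale \<omega> by (rule assms(1))
  obtain Bs :: "'v set" where Bs: "independent Bs" "UNIV \<subseteq> span Bs" "card Bs = dim (UNIV :: 'v set)"
    using basis_exists[of UNIV] by blast
  have card: "card Bs = 2 * n" using Bs(3) assms(2) by simp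
  then have fin: "finite Bs" using assms(3) by (intro card_ge_0_finite) simp
  obtain bd where bd: "\<forall>b\<in>Bs. \<forall>c\<in>Bs. \<omega> (bd b) c = (if b = c then 1 else 0)"
    using dual_family_exists[OF fin Bs(1)] by blast
  interpret finite_symplectic_space scale \<omega> Bs bd n
    by unfold_locales (use fin card Bs(2) bd in auto)
  show ?thesis
    using is_bicomplex_bic total_quasi_isomorphic_E total_acyclic[of t] assms(3) by auto
qed

end
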